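(* Let $q=p^e$ with $p$ prime, let $\pi_{\mathsf{sq}}$ be the parallelism on the right cosets of Sylow $p$-subgroups of $\mathrm{SL}(2,q^2)$ defined below and $\Gamma$ its stabilizer in $\mathfrak A\ltimes R$. Then (a) $\Gamma=\big(\langle\vartheta_h : h\in\mathrm{SL}(2,q^2)\rangle\rtimes\mathrm{Aut}(\mathbb F_{q^2})\big)\times\langle\rho_{-\mathbb 1}\rangle\cong\mathrm{P\Sigma L}(2,q^2)\times\langle\rho_{-\mathbb 1}\rangle$; (b) $|\Gamma|=2e(q^2-1)q^2(q^2+1)$.
   Context: $\overline{\,\cdot\,}$ is $y\mapsto y^q$ on $\mathbb F_{q^2}$, applied entrywise to matrices. $T=\left\{\begin{pmatrix}1&x\\0&1\end{pmatrix}: x\in\mathbb F_{q^2}\right\}$, $\Omega=\{g\in\mathrm{SL}(2,q^2): \text{the lower-left entry of } g \text{ lies in } \mathbb F_q\}$, $\Omega^{\mathsf c}$ its complement, $A=\{Tg: g\in\Omega\}\cup\{gT: g\in\Omega^{\mathsf c}\}$. For $h\in\mathrm{SL}(2,q^2)$, $\vartheta_h$ is the permutation $x\mapsto h^{-1}x\overline h$ of $\mathrm{SL}(2,q^2)$ (it equals $\gamma_h\rho_{h^{-1}\overline h}$), acting elementwise on cosets and memberwise on $A$; $\pi_{\mathsf{sq}}=\{A\cdot\vartheta_h : h\in\mathrm{SL}(2,q^2)\}$. Permutations act on the right, composed left to right, and act on parallelisms in the induced way. $\mathfrak A$ is the group of permutations of $\mathrm{SL}(2,q^2)$ given by its group automorphisms;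 $R=\{\rho_h: g\mapsto gh\}$; $\mathfrak A\ltimes R$ the group they generate; $\gamma_a\colon g\mapsto a^{-1}ga$. $\mathrm{Aut}(\mathbb F_{q^2})$ acts entrywise. $\mathrm{P\Sigma L}(2,q^2)=\mathrm{PSL}(2,q^2)\rtimes\mathrm{Aut}(\mathbb F_{q^2})$. $\mathbb 1$ is the identity matrix. *)

theory Defs
  imports
    "HOL-Analysis.Determinants"
    "HOL-Algebra.Bij"
    "HOL-Algebra.Coset"
    "HOL-Algebra.Generated_Groups"
    "HOL-Computational_Algebra.Primes"
begin

section \<open>General group theory\<close>

text \<open>The symmetric group on \<open>S\<close>, acting on the right: \<open>f \<otimes> g\<close> means first \<open>f\<close>, then \<open>g\<close>.
  (The library's \<open>BijGroup S\<close> has the same elements with the opposite multiplication.)\<close>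

definition SymR :: "'a set \<Rightarrow> ('a \<Rightarrow> 'a) monoid" where
  "SymR S = \<lparr>carrier = Bij S,
             mult = (\<lambda>f \<in> Bij S. \<lambda>g \<in> Bij S. compose S g f),
             one = (\<lambda>x \<in> S. x)\<rparr>"

definition group_centre :: "('a, 'b) monoid_scheme \<Rightarrow> 'a set" where
  "group_centre G = {z \<in> carrier G. \<forall>g \<in> carrier G. z \<otimes>\<^bsub>G\<^esub> g = g \<otimes>\<^bsub>G\<^esub> z}"

text \<open>External semidirect product of \<open>N\<close> by \<open>H\<close>, for a left action \<open>\<phi>\<close> of \<open>H\<close> on \<open>N\<close>.\<close>

definition semidirect ::
  "('a, 'c) monoid_scheme \<Rightarrow> ('b, 'd) monoid_scheme \<Rightarrow> ('b \<Rightarrow> 'a \<Rightarrow> 'a) \<Rightarrow> ('a \<times> 'b) monoid" where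
  "semidirect N H \<phi> =
    \<lparr>carrier = carrier N \<times> carrier H,
     mult = (\<lambda>(n, h) (n', h'). (n \<otimes>\<^bsub>N\<^esub> \<phi> h n', h \<otimes>\<^bsub>H\<^esub> h')),
     one = (\<one>\<^bsub>N\<^esub>, \<one>\<^bsub>H\<^esub>)\<rparr>"

text \<open>\<open>K = N \<rtimes> H\<close> and \<open>K = A \<times> B\<close> as internal products of subgroups of \<open>G\<close>.\<close>

definition internal_semidirect ::
  "('a, 'b) monoid_scheme \<Rightarrow> 'a set \<Rightarrow> 'a set \<Rightarrow> 'a set \<Rightarrow> bool" where
  "internal_semidirect G K N H \<longleftrightarrow>
     subgroup K G \<and> N \<lhd> G\<lparr>carrier := K\<rparr> \<and> subgroup H (G\<lparr>carrier := K\<rparr>) \<and>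
     N \<inter> H = {\<one>\<^bsub>G\<^esub>} \<and> K = N <#>\<^bsub>G\<^esub> H"

definition internal_direct ::
  "('a, 'b) monoid_scheme \<Rightarrow> 'a set \<Rightarrow> 'a set \<Rightarrow> 'a set \<Rightarrow> bool" where
  "internal_direct G K A B \<longleftrightarrow>
     subgroup K G \<and> A \<lhd> G\<lparr>carrier := K\<rparr> \<and> B \<lhd> G\<lparr>carrier := K\<rparr> \<and>
     A \<inter> B = {\<one>\<^bsub>G\<^esub>} \<and> K = A <#>\<^bsub>G\<^esub> B"


section \<open>The groups $\mathrm{SL}(2,F)$ and $\mathrm{P\Sigma L}(2,F)$\<close>

definition SL2 :: "('a::field ^ 2 ^ 2) monoid" where
  "SL2 = \<lparr>carrier = {M. det M = 1}, mult = (**), one = mat 1\<rparr>"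

definition PSL2 :: "('a::field ^ 2 ^ 2) set monoid" where
  "PSL2 = SL2 Mod group_centre SL2"

definition field_auts :: "('a::field \<Rightarrow> 'a) set" where
  "field_auts = {\<alpha>. bij \<alpha> \<and> \<alpha> 1 = 1 \<and>
     (\<forall>x y. \<alpha> (x + y) = \<alpha> x + \<alpha> y) \<and> (\<forall>x y. \<alpha> (x * y) = \<alpha> x * \<alpha> y)}"

definition AutF :: "('a::field \<Rightarrow> 'a) monoid" where
  "AutF = \<lparr>carrier = field_auts, mult = (\<circ>), one = id\<rparr>"

text \<open>Field automorphisms act entrywise on matrices, hence on the elements of \<open>PSL2\<close>,
  which are cosets of the centre.\<close>

definition PSigmaL2 :: "(('a::field ^ 2 ^ 2) set \<times> ('a \<Rightarrow> 'a)) monoid" where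
  "PSigmaL2 = semidirect PSL2 AutF (\<lambda>\<alpha> X. map_matrix \<alpha> ` X)"


section \<open>The parallelism $\pi_{\mathsf{sq}}$\<close>

text \<open>Throughout, the ambient field \<open>'a\<close> is meant to have \<open>q\<^sup>2\<close> elements.  Its subfield with
  \<open>q\<close> elements is the fixed field of \<open>y \<mapsto> y ^ q\<close>.\<close>

definition subfield_q :: "nat \<Rightarrow> ('a::field) set" where
  "subfield_q q = {y. y ^ q = y}"

definition bar :: "nat \<Rightarrow> 'a::field ^ 2 ^ 2 \<Rightarrow> 'a ^ 2 ^ 2" where
  "bar q M = map_matrix (\<lambda>y. y ^ q) M"

definition Tgrp :: "('a::field ^ 2 ^ 2) set" where
  "Tgrp = {vector [vector [1, x], vector [0, 1]] | x. True}"

definition Omega :: "nat \<Rightarrow> ('a::field ^ 2 ^ 2) set" where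
  "Omega q = {g \<in> carrier SL2. g $ 2 $ 1 \<in> subfield_q q}"

definition Acls :: "nat \<Rightarrow> ('a::field ^ 2 ^ 2) set set" where
  "Acls q = {Tgrp #>\<^bsub>SL2\<^esub> g | g. g \<in> Omega q} \<union>
            {g <#\<^bsub>SL2\<^esub> Tgrp | g. g \<in> carrier SL2 - Omega q}"

definition theta :: "nat \<Rightarrow> 'a::field ^ 2 ^ 2 \<Rightarrow> 'a ^ 2 ^ 2 \<Rightarrow> 'a ^ 2 ^ 2" where
  "theta q h = (\<lambda>x \<in> carrier SL2. inv\<^bsub>SL2\<^esub> h \<otimes>\<^bsub>SL2\<^esub> x \<otimes>\<^bsub>SL2\<^esub> bar q h)"

text \<open>Induced actions of a permutation: on a set of cosets, and on a set of such sets.\<close>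

definition act_class :: "'a set set \<Rightarrow> ('a \<Rightarrow> 'a) \<Rightarrow> 'a set set" where
  "act_class B \<sigma> = (\<lambda>X. \<sigma> ` X) ` B"

definition act_par :: "'a set set set \<Rightarrow> ('a \<Rightarrow> 'a) \<Rightarrow> 'a set set set" where
  "act_par \<pi> \<sigma> = (\<lambda>B. act_class B \<sigma>) ` \<pi>"

definition pi_sq :: "nat \<Rightarrow> ('a::field ^ 2 ^ 2) set set set" where
  "pi_sq q = {act_class (Acls q) (theta q h) | h. h \<in> carrier SL2}"


section \<open>The stabilizer and its constituents\<close>

text \<open>All of the following live in the symmetric group on the set \<open>SL(2, F)\<close>;
  \<open>auto\<close> is the library's set of automorphisms of a group, as extensional functions.\<close>

definition SymSL :: "('a::field ^ 2 ^ 2 \<Rightarrow> 'a ^ 2 ^ 2) monoid" where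
  "SymSL = SymR (carrier SL2)"

definition rho :: "'a::field ^ 2 ^ 2 \<Rightarrow> 'a ^ 2 ^ 2 \<Rightarrow> 'a ^ 2 ^ 2" where
  "rho h = (\<lambda>g \<in> carrier SL2. g \<otimes>\<^bsub>SL2\<^esub> h)"

definition AutR :: "('a::field ^ 2 ^ 2 \<Rightarrow> 'a ^ 2 ^ 2) set" where
  "AutR = generate SymSL (auto SL2 \<union> {rho h | h. h \<in> carrier SL2})"

definition Gam :: "nat \<Rightarrow> ('a::field ^ 2 ^ 2 \<Rightarrow> 'a ^ 2 ^ 2) set" where
  "Gam q = {\<sigma> \<in> AutR. act_par (pi_sq q) \<sigma> = pi_sq q}"

definition Theta :: "nat \<Rightarrow> ('a::field ^ 2 ^ 2 \<Rightarrow> 'a ^ 2 ^ 2) set" where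
  "Theta q = generate SymSL {theta q h | h. h \<in> carrier SL2}"

definition field_perms :: "('a::field ^ 2 ^ 2 \<Rightarrow> 'a ^ 2 ^ 2) set" where
  "field_perms = {restrict (map_matrix \<alpha>) (carrier SL2) | \<alpha>. \<alpha> \<in> field_auts}"

definition rho_minus :: "('a::field ^ 2 ^ 2 \<Rightarrow> 'a ^ 2 ^ 2) set" where
  "rho_minus = generate SymSL {rho (- mat 1)}"

end

theory Submission
  imports Defs "HOL-Computational_Algebra.Polynomial_Factorial" "HOL-Algebra.Multiplicative_Group"
begin

text \<open>Every element of \<open>AutR\<close> is of the form \<open>x \<mapsto> a \<alpha>(x) b\<close> with a field automorphism \<open>\<alpha>\<close>, because
  every automorphism of $\mathrm{SL}(2,F)$ is semilinear: the image of an elementary unipotent matrix has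
  order \<open>p\<close>, hence is unipotent, and after a conjugation the automorphism stabilises both unitriangular
  subgroups, on which it acts through one and the same field automorphism.

  Field automorphisms preserve \<open>\<pi>\<close>, so consider \<open>x \<mapsto> m x n\<close>.  If it maps \<open>A \<vartheta>\<^sub>h\<close> to \<open>A \<vartheta>\<^sub>k\<close>, then
  \<open>x \<mapsto> (k m h\<^sup>-\<^sup>1) x (bar h n bar k\<^sup>-\<^sup>1)\<close> preserves \<open>A\<close>, which makes both factors upper triangular; hence so is
  \<open>bar h (n bar m) bar h\<^sup>-\<^sup>1\<close>.  As \<open>h\<close> is arbitrary, \<open>n bar m\<close> is a scalar \<open>\<mu>\<close>.  Finally, \<open>A\<close> being
  defined by lower-left entries in the subfield forces \<open>\<mu> \<mu>\<^sup>q = 1\<close>, so that \<open>det m\<close> is a square and \<open>m\<close> can be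
  rescaled to determinant 1, giving \<open>\<plusminus>\<vartheta>\<^sub>h\<close>.\<close>

section \<open>Finite fields\<close>

text \<open>The factors \<open>m\<close> and \<open>n\<close> range over GL(2,F) with only det m *
  det n = 1 known, because conjugation by any invertible matrix is an automorphism of SL(2,F). The
  obstacle is to exclude a non-square d = det m. Taking determinants in n bar m = \<mu> gives
  \<mu>^2 d = d^q, hence only \<mu>^(q+1) = 1 or -1; in odd characteristic this sign decides whether
  d is a square. The subfield settles it: members of \<open>A\<close> with lower-left entry in the
  subfield have a constant second row, the others a constant first column, so a row member must not
  be moved to a lower-left entry outside the subfield, and this puts d \<mu> into the subfield.
  After division of \<open>m\<close> by a square root of d, a scalar with square 1 remains; it is
  the source of \<open>rho (- mat 1)\<close>. In characteristic 2 that factor is trivial. The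
  statements are arranged so that both cases share one proof and separate only where squares are
  needed.\<close>

lemma CHAR_finite_field:
  assumes "prime p" "CARD('a::{field,finite}) = p ^ n"
  shows "CHAR('a) = p"
proof -
  have pr: "prime CHAR('a)"
    using finite_imp_CHAR_pos[where ?'a = 'a] by (intro prime_CHAR_semidom) auto
  \<comment> \<open>Translation by 1 permutes the field; comparing the sums of all elements before
    and after it gives \<open>CARD('a)\<close> = 0 in the field.\<close>
  have "bij (\<lambda>x::'a. x + 1)"
    by (rule o_bij[of "\<lambda>x. x - 1"]) auto
  hence "(\<Sum>x\<in>UNIV. x) = (\<Sum>x\<in>(UNIV::'a set). x + 1)"
    using sum.reindex_bij_betw[of "\<lambda>x::'a. x + 1" UNIV UNIV "\<lambda>x. x"] by simp
  hence "of_nat CARD('a) = (0::'a)"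
    by (simp add: sum.distrib)
  hence "CHAR('a) dvd p ^ n"
    using assms(2) by (metis of_nat_eq_0_iff_char_dvd)
  thus ?thesis
    using pr assms(1) prime_dvd_power primes_dvd_imp_eq by blast
qed

text \<open>Multiplication by a nonzero \<open>x\<close> permutes the nonzero elements, so their
  product cancels. The extra factor \<open>x\<close> raises the exponent from
  \<open>CARD('a) - 1\<close> to \<open>CARD('a)\<close>.\<close>

lemma power_CARD_finite_field: "(x::'a::{field,finite}) ^ CARD('a) = x"
proof (cases "x = 0")
  case False
  have "x * (\<Prod>y\<in>UNIV-{0}. x * y) = x * x ^ (CARD('a) - 1) * \<Prod>(UNIV-{0})"
    by (simp add: prod.distrib mult_ac)
  also have "x * x ^ (CARD('a) - 1) = x ^ CARD('a)"
    by (simp add: power_eq_if)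
  also have "(\<Prod>y\<in>UNIV-{0}. x * y) = (\<Prod>y\<in>UNIV-{0}. y)"
    by (rule prod.reindex_bij_witness[of _ "\<lambda>y. y / x" "\<lambda>y. x * y"]) (use False in auto)
  finally show ?thesis
    by simp
qed (simp add: power_0_left)

lemma card_power_fixed_le:
  assumes "1 < m"
  shows "card {y::'a::field. y ^ m = y} \<le> m"
proof -
  have "degree (Polynomial.monom (1::'a) m + (- Polynomial.monom 1 1)) = m"
    by (subst degree_add_eq_left) (use assms in \<open>auto simp: degree_monom_eq\<close>)
  hence "degree (Polynomial.monom (1::'a) m - Polynomial.monom 1 1) = m"
    by simp
  moreover from this have "Polynomial.monom (1::'a) m - Polynomial.monom 1 1 \<noteq> 0"
    using assms by auto
  ultimately have "card {y::'a. poly (Polynomial.monom 1 m - Polynomial.monom 1 1) y = 0} \<le> m"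
    by (metis card_poly_roots_bound)
  thus ?thesis
    by (simp add: poly_monom)
qed

lemma ex_power_not_fixed:
  assumes "1 < m" "m < CARD('a::{field,finite})"
  shows "\<exists>y::'a. y ^ m \<noteq> y"
proof (rule ccontr)
  assume "\<not> ?thesis"
  hence "{y::'a. y ^ m = y} = UNIV"
    by auto
  thus False
    using card_power_fixed_le[OF assms(1), where ?'a = 'a] assms(2) by simp
qed

section \<open>Field automorphisms and powers of the Frobenius map\<close>

lemma field_auts_simps:
  assumes "\<alpha> \<in> field_auts"
  shows "\<alpha> 1 = 1" "\<alpha> 0 = 0" "\<alpha> (x + y) = \<alpha> x + \<alpha> y" "\<alpha> (x * y) = \<alpha> x * \<alpha> y"
    "\<alpha> (- x) = - \<alpha> x" "\<alpha> (x - y) = \<alpha> x - \<alpha> y" "\<alpha> (x ^ n) = \<alpha> x ^ n"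
    "\<alpha> x = \<alpha> y \<longleftrightarrow> x = y"
proof -
  have *: "\<alpha> 1 = 1" "\<And>x y. \<alpha> (x + y) = \<alpha> x + \<alpha> y" "\<And>x y. \<alpha> (x * y) = \<alpha> x * \<alpha> y" "bij \<alpha>"
    using assms unfolding field_auts_def by auto
  show 0: "\<alpha> 0 = 0"
    using *(2)[of 0 0] by (metis add.right_neutral add_left_cancel)
  have neg: "\<alpha> (- x) = - \<alpha> x" for x
    using *(2)[of x "- x"] 0 by (simp add: eq_neg_iff_add_eq_0 add.commute)
  show "\<alpha> (- x) = - \<alpha> x" "\<alpha> (x - y) = \<alpha> x - \<alpha> y"
    using neg *(2)[of x "- y"] by auto
  show "\<alpha> (x ^ n) = \<alpha> x ^ n"
    by (induction n) (auto simp: *)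
  show "\<alpha> x = \<alpha> y \<longleftrightarrow> x = y"
    using *(4) by (simp add: bij_is_inj inj_eq)
qed (use assms in \<open>auto simp: field_auts_def\<close>)

lemma field_auts_sum:
  assumes "\<alpha> \<in> field_auts"
  shows "\<alpha> (sum f A) = (\<Sum>i\<in>A. \<alpha> (f i))"
  by (induction A rule: infinite_finite_induct) (auto simp: field_auts_simps[OF assms])

lemma field_auts_comp: "\<alpha> \<in> field_auts \<Longrightarrow> \<beta> \<in> field_auts \<Longrightarrow> \<alpha> \<circ> \<beta> \<in> field_auts"
  unfolding field_auts_def by (auto intro: bij_comp)

lemma id_field_auts: "id \<in> field_auts"
  unfolding field_auts_def by auto

lemma field_auts_inv:
  assumes "\<alpha> \<in> field_auts"
  shows "inv_into UNIV \<alpha> \<in> field_auts" "\<alpha> \<circ> inv_into UNIV \<alpha> = id" "inv_into UNIV \<alpha> \<circ> \<alpha> = id"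
proof -
  have b: "bij \<alpha>"
    using assms by (simp add: field_auts_def)
  hence [simp]: "\<alpha> (inv_into UNIV \<alpha> x) = x" for x
    by (simp add: bij_is_surj surj_f_inv_f)
  have eqI: "inv_into UNIV \<alpha> x = y" if "x = \<alpha> y" for x y
    using that b by (simp add: bij_is_inj)
  show "inv_into UNIV \<alpha> \<in> field_auts"
    unfolding field_auts_def
    by (auto simp: field_auts_simps(1-4)[OF assms] bij_imp_bij_inv[OF b] intro!: eqI)
  show "\<alpha> \<circ> inv_into UNIV \<alpha> = id" "inv_into UNIV \<alpha> \<circ> \<alpha> = id"
    using b by (auto simp: fun_eq_iff bij_is_inj)
qed

text \<open>A homomorphism of fields kills no nonzero element, and on a finite set injectivity gives
  bijectivity.\<close>

lemma additive_multiplicative_field_auts: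
  fixes f :: "'a::{field,finite} \<Rightarrow> 'a"
  assumes "\<And>x y. f (x + y) = f x + f y" "\<And>x y. f (x * y) = f x * f y" "f 1 = 1"
  shows "f \<in> field_auts"
proof -
  have f0: "f 0 = 0"
    using assms(1)[of 0 0] by (metis add.right_neutral add_left_cancel)
  have nz: "f x \<noteq> 0" if "x \<noteq> 0" for x
    using assms(2)[of x "inverse x"] that assms(3) by auto
  have "inj f"
  proof (rule injI)
    fix x y assume "f x = f y"
    hence "f (x - y) = 0"
      using assms(1)[of "x - y" y] by simp
    thus "x = y"
      using nz[of "x - y"] by auto
  qed
  hence "bij f"
    by (simp add: finite_UNIV_inj_surj bij_def)
  thus ?thesis
    using assms unfolding field_auts_def by auto
qed

lemma frobenius_power_field_auts:
  assumes "prime CHAR('a::{field,finite})"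
  shows "(\<lambda>y::'a. y ^ (CHAR('a) ^ k)) \<in> field_auts"
  by (rule additive_multiplicative_field_auts)
     (auto simp: freshmans_dream'[OF assms refl] power_mult_distrib)

text \<open>The multiplicative group of a finite field is cyclic; the record \<open>R\<close>
  presents the type class field as a ring with a carrier so that this applies.\<close>

lemma ex_primitive_element: "\<exists>g::'a::{field,finite}. \<forall>x. x \<noteq> 0 \<longrightarrow> (\<exists>i::nat. x = g ^ i)"
proof -
  define R :: "'a ring" where
    "R = \<lparr>carrier = UNIV, monoid.mult = (*), one = 1, ring.zero = 0, add = (+)\<rparr>"
  interpret R: Ring.field R
  proof -
    have "\<exists>y. x + y = 0" for x :: 'a
      by (rule exI[of _ "- x"]) simp
    moreover have "\<exists>y. x * y = 1" if "x \<noteq> 0" for x :: 'a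
      using that by (intro exI[of _ "inverse x"]) simp
    ultimately show "Ring.field R"
      unfolding R_def by unfold_locales (auto simp: algebra_simps Units_def)
  qed
  have pow: "a [^]\<^bsub>R\<^esub> i = a ^ i" for a :: 'a and i :: nat
    by (induction i) (auto simp: R_def nat_pow_def)
  have "finite (carrier R)"
    by (simp add: R_def)
  then obtain a :: 'a where "carrier (mult_of R) = {a [^]\<^bsub>R\<^esub> i | i::nat. i \<in> UNIV}"
    using R.finite_field_mult_group_has_gen by blast
  moreover have "carrier (mult_of R) = UNIV - {0}"
    by (simp add: R_def)
  ultimately have "UNIV - {0} = {a ^ i | i::nat. True}"
    by (simp only: pow) simp
  thus ?thesis
    by blast
qed

text \<open>With p the characteristic, the first p multiples of 1 are distinct and fixed by the
  Frobenius map; as X^p - X has at most p roots, nothing else is fixed.\<close>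

lemma frobenius_fixed_of_nat:
  assumes "prime CHAR('a::{field,finite})" "(c::'a) ^ CHAR('a) = c"
  shows "\<exists>k. c = of_nat k"
proof -
  let ?p = "CHAR('a)"
  have fx: "of_nat k ^ ?p = (of_nat k :: 'a)" for k
  proof (induction k)
    case 0
    thus ?case using assms(1) prime_gt_0_nat by (auto simp: power_0_left)
  next
    case (Suc k)
    thus ?case using freshmans_dream[OF assms(1) refl, of 1 "of_nat k"] by simp
  qed
  have "of_nat j \<noteq> (of_nat k :: 'a)" if "j < k" "k < ?p" for j k
  proof
    assume "of_nat j = (of_nat k :: 'a)"
    hence "of_nat (k - j) = (0::'a)"
      using that by (simp add: of_nat_diff)
    hence "?p dvd k - j"
      by (simp add: of_nat_eq_0_iff_char_dvd)
    thus False
      using that by (auto dest!: dvd_imp_le)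
  qed
  hence "inj_on (of_nat :: nat \<Rightarrow> 'a) {..<?p}"
    by (metis inj_onI lessThan_iff linorder_neqE_nat)
  hence "card ((of_nat :: nat \<Rightarrow> 'a) ` {..<?p}) = ?p"
    by (simp add: card_image)
  moreover have "card {y::'a. y ^ ?p = y} \<le> ?p"
    by (rule card_power_fixed_le) (use assms(1) prime_gt_1_nat in auto)
  ultimately have "(of_nat :: nat \<Rightarrow> 'a) ` {..<?p} = {y. y ^ ?p = y}"
    by (intro card_seteq) (auto simp: fx)
  thus ?thesis
    using assms(2) by blast
qed

lemma field_aut_of_nat: "\<alpha> \<in> field_auts \<Longrightarrow> \<alpha> (of_nat k) = of_nat k"
  by (induction k) (auto simp: field_auts_simps)

text \<open>The polynomial whose roots are the Frobenius conjugates of a primitive element has its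
  coefficients in the prime field, so an automorphism permutes these conjugates.\<close>

lemma field_aut_eq_frobenius_power:
  assumes p: "prime p" and card: "CARD('a::{field,finite}) = p ^ n" and \<alpha>: "(\<alpha>::'a \<Rightarrow> 'a) \<in> field_auts"
  shows "\<exists>k<n. \<alpha> = (\<lambda>y. y ^ (p ^ k))"
proof -
  have ch: "CHAR('a) = p"
    by (rule CHAR_finite_field[OF p card])
  hence pc: "prime CHAR('a)"
    using p by simp
  obtain g :: 'a where g: "\<And>x. x \<noteq> 0 \<Longrightarrow> \<exists>i::nat. x = g ^ i"
    using ex_primitive_element by blast
  have "n \<noteq> 0"
  proof
    assume "n = 0"
    hence "CARD('a) = 1" using card by simp
    then obtain z :: 'a where "UNIV = {z}" using card_1_singletonE by blast
    thus False using zero_neq_one[where ?'a = 'a] by (metis UNIV_I singletonD)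
  qed
  have frob: "(\<lambda>y::'a. y ^ p) \<in> field_auts"
    using frobenius_power_field_auts[OF pc, of 1] ch by simp
  \<comment> \<open>\<open>P\<close> has the roots g^(p^i) for i < n, and \<open>Q\<close> is
    \<open>P\<close> with the Frobenius map applied to its coefficients. The aim is
    \<open>P = Q\<close>.\<close>
  define P where "P = (\<Prod>i<n. [:- (g ^ (p ^ i)), 1:])"
  define Q where "Q = map_poly (\<lambda>c. c ^ p) P"
  have polyP: "poly P x = (\<Prod>i<n. x - g ^ (p ^ i))" for x
    by (simp add: P_def poly_prod)
  have degP: "degree P = n"
    unfolding P_def by (subst degree_prod_eq_sum_degree) auto
  have coeffQ: "Polynomial.coeff Q i = Polynomial.coeff P i ^ p" for i
    unfolding Q_def by (subst coeff_map_poly) (use p prime_gt_0_nat in \<open>auto simp: power_0_left\<close>)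
  have degQ: "degree Q \<le> n"
    using degP p by (intro degree_le) (auto simp: coeffQ coeff_eq_0 power_0_left)
  have PQ: "poly Q (x ^ p) = poly P x ^ p" for x
  proof -
    have "poly Q (x ^ p) = (\<Sum>i\<le>n. Polynomial.coeff Q i * (x ^ p) ^ i)"
      unfolding poly_altdef using degQ by (intro sum.mono_neutral_left) (auto simp: coeff_eq_0)
    also have "\<dots> = (\<Sum>i\<le>n. (Polynomial.coeff P i * x ^ i) ^ p)"
      by (simp add: coeffQ power_mult_distrib mult.commute flip: power_mult)
    also have "\<dots> = (\<Sum>i\<le>n. Polynomial.coeff P i * x ^ i) ^ p"
      by (rule field_auts_sum[OF frob, symmetric])
    also have "(\<Sum>i\<le>n. Polynomial.coeff P i * x ^ i) = poly P x"
      using degP by (simp add: poly_altdef)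
    finally show ?thesis .
  qed
  have gn: "g ^ (p ^ n) = g"
    using power_CARD_finite_field[of g] card by simp
  \<comment> \<open>Raising to the power p shifts the conjugates g^(p^i) by one step, and g^(p^n) =
    g closes the cycle.\<close>
  have PP: "poly P x ^ p = poly P (x ^ p)" for x
  proof -
    have "poly P x ^ p = (\<Prod>i<n. x ^ p - g ^ (p ^ Suc i))"
      by (simp add: polyP field_auts_simps(6)[OF frob] prod_power_distrib mult.commute flip: power_mult)
    also have "\<dots> = (\<Prod>i\<in>Suc ` {..<n}. x ^ p - g ^ (p ^ i))"
      by (subst prod.reindex) auto
    also have "Suc ` {..<n} = insert n ({..<n} - {0})"
      using \<open>n \<noteq> 0\<close> image_Suc_lessThan[of n] by auto
    also have "(\<Prod>i\<in>insert n ({..<n} - {0}). x ^ p - g ^ (p ^ i)) = (x ^ p - g) * (\<Prod>i\<in>{..<n} - {0}. x ^ p - g ^ (p ^ i))"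
      by (subst prod.insert) (auto simp: gn)
    also have "\<dots> = (\<Prod>i<n. x ^ p - g ^ (p ^ i))"
      using \<open>n \<noteq> 0\<close> by (subst (2) prod.remove[of _ 0]) auto
    finally show ?thesis
      by (simp add: polyP)
  qed
  \<comment> \<open>Every element is a p-th power, so \<open>P\<close> and \<open>Q\<close> agree at
    all p^n points of the field, more than the degree bound n permits for distinct
    polynomials.\<close>
  have "poly (P - Q) x = 0" for x
  proof -
    have "bij (\<lambda>y::'a. y ^ p)"
      using frob by (simp add: field_auts_def)
    then obtain y where "x = y ^ p"
      by (metis bij_is_surj surjD)
    thus ?thesis
      using PQ[of y] PP[of y] by simp
  qed
  hence "card {x. poly (P - Q) x = 0} = p ^ n"
    by (simp add: card)
  moreover have "degree (P - Q) < p ^ n"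
  proof -
    have "degree (P - Q) \<le> n"
      using degP degQ by (intro degree_diff_le) auto
    also have "n < p ^ n"
      using prime_gt_1_nat[OF p] by (intro power_gt_expt) auto
    finally show ?thesis .
  qed
  ultimately have "P = Q"
    using card_poly_roots_bound[of "P - Q"] by fastforce
  hence "Polynomial.coeff P i ^ p = Polynomial.coeff P i" for i
    using coeffQ[of i] by simp
  hence fixc: "\<alpha> (Polynomial.coeff P i) = Polynomial.coeff P i" for i
    using frobenius_fixed_of_nat[OF pc, of "Polynomial.coeff P i"] ch field_aut_of_nat[OF \<alpha>] by auto
  have "poly P (\<alpha> g) = \<alpha> (poly P g)"
    by (simp add: poly_altdef field_auts_sum[OF \<alpha>] field_auts_simps[OF \<alpha>] fixc)
  also have "poly P g = 0"
    unfolding polyP using \<open>n \<noteq> 0\<close> by (auto intro!: bexI[of _ 0])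
  \<comment> \<open>A root of \<open>P\<close> is one of the conjugates of \<open>g\<close>, and the
    value at \<open>g\<close> determines \<alpha> on all powers of \<open>g\<close>.\<close>
  finally obtain k where k: "k < n" "\<alpha> g = g ^ (p ^ k)"
    by (auto simp: polyP field_auts_simps[OF \<alpha>])
  have "\<alpha> x = x ^ (p ^ k)" for x
  proof (cases "x = 0")
    case True
    thus ?thesis using p prime_gt_0_nat by (auto simp: field_auts_simps[OF \<alpha>] power_0_left)
  next
    case False
    then obtain i where "x = g ^ i" using g by blast
    thus ?thesis by (simp add: field_auts_simps[OF \<alpha>] k mult.commute flip: power_mult)
  qed
  thus ?thesis
    using k(1) by blast
qed

text \<open>If the Frobenius powers with exponents j < k < n coincided, injectivity of the j-th
  would give y^(p^(k-j)) = y on the whole field, which is too many roots.\<close>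

lemma card_field_auts:
  assumes p: "prime p" and card: "CARD('a::{field,finite}) = p ^ n"
  shows "card (field_auts :: ('a \<Rightarrow> 'a) set) = n"
proof -
  have ch: "CHAR('a) = p"
    by (rule CHAR_finite_field[OF p card])
  define F where "F k = (\<lambda>y::'a. y ^ (p ^ k))" for k
  have F: "F k \<in> field_auts" for k
    using frobenius_power_field_auts[where ?'a = 'a] p ch unfolding F_def by simp
  have "(field_auts :: ('a \<Rightarrow> 'a) set) = F ` {..<n}"
    using field_aut_eq_frobenius_power[OF p card] F unfolding F_def by auto
  moreover have "F j \<noteq> F k" if "j < k" "k < n" for j k
  proof
    assume eq: "F j = F k"
    have "(y::'a) ^ (p ^ (k - j)) = y" for y
    proof -
      have "F k y = F j (y ^ (p ^ (k - j)))"
        using that by (simp add: F_def flip: power_mult power_add)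
      thus ?thesis
        using eq field_auts_simps(8)[OF F[of j]] by simp
    qed
    moreover have "1 < p ^ (k - j)" "p ^ (k - j) < CARD('a)"
      unfolding card using that prime_gt_1_nat[OF p]
    by (auto intro!: power_strict_increasing one_less_power simp del: One_nat_def)
    ultimately show False
      using ex_power_not_fixed by blast
  qed
  hence "inj_on F {..<n}"
    by (metis inj_onI lessThan_iff linorder_neqE_nat)
  ultimately show ?thesis
    by (metis card_image card_lessThan)
qed

text \<open>Here t = - t, so s^2 = t^2 forces s = t: squaring is injective, hence surjective on a
  finite set.\<close>

lemma finite_field_square_char_2:
  assumes "(1::'a::{field,finite}) + 1 = 0"
  shows "\<exists>s::'a. x = s\<^sup>2"
proof -
  have "inj (\<lambda>s::'a. s\<^sup>2)"
  proof (rule injI)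
    fix s t :: 'a assume "s\<^sup>2 = t\<^sup>2"
    moreover have "t + t = 0"
      using assms by (metis distrib_left mult.right_neutral mult_zero_right)
    ultimately show "s = t"
      by (metis add_eq_0_iff2 eq_neg_iff_add_eq_0 power2_eq_iff)
  qed
  hence "surj (\<lambda>s::'a. s\<^sup>2)"
    by (simp add: finite_UNIV_inj_surj)
  thus ?thesis
    by (metis surjD)
qed

text \<open>Write x = g^i with \<open>g\<close> primitive. For odd i, x^m = 1 together with g^(2m) =
  1 would give g^m = 1, hence y^(m+1) = y for all y, although m + 1 is below the size of the
  field.\<close>

lemma euler_criterion_finite_field:
  assumes card: "CARD('a::{field,finite}) = 2 * m + 1" and x: "(x::'a) ^ m = 1"
  shows "\<exists>s. x = s\<^sup>2"
proof -
  obtain g :: 'a where g: "\<And>x. x \<noteq> 0 \<Longrightarrow> \<exists>i::nat. x = g ^ i"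
    using ex_primitive_element by blast
  have m: "m > 0"
    using card card_mono[of "UNIV::'a set" "{0,1}"] by (cases m) auto
  hence "x \<noteq> 0"
    using x by (auto simp: power_0_left)
  then obtain i where i: "x = g ^ i"
    using g by blast
  have "even i"
  proof (rule ccontr)
    assume "odd i"
    then obtain j where j: "i = 2 * j + 1" by (elim oddE)
    have g0: "g \<noteq> 0" using \<open>x \<noteq> 0\<close> i j by auto
    have g2: "g ^ (2 * m) = 1"
      using power_CARD_finite_field[of g] card g0 by simp
    have "1 = (g ^ (2 * m)) ^ j * g ^ m"
      using x i j by (simp add: algebra_simps flip: power_mult power_add)
    hence gm: "g ^ m = 1" using g2 by simp
    have "y ^ (m + 1) = y" for y :: 'a
    proof (cases "y = 0")
      case False
      then obtain k where "y = g ^ k" using g by blast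
      hence "y ^ m = (g ^ m) ^ k" by (simp add: mult.commute flip: power_mult)
      thus ?thesis using gm by simp
    qed auto
    thus False
      using ex_power_not_fixed[of "m + 1", where ?'a = 'a] card m by auto
  qed
  thus ?thesis
    using i by (metis evenE mult.commute power_mult)
qed


section \<open>Two by two matrices\<close>

definition mat2 :: "'a \<Rightarrow> 'a \<Rightarrow> 'a \<Rightarrow> 'a \<Rightarrow> 'a::zero ^ 2 ^ 2" where
  "mat2 a b c d = vector [vector [a, b], vector [c, d]]"

lemma mat2_nth [simp]:
  "mat2 a b c d $ 1 $ 1 = a" "mat2 a b c d $ 1 $ 2 = b"
  "mat2 a b c d $ 2 $ 1 = c" "mat2 a b c d $ 2 $ 2 = d"
  by (simp_all add: mat2_def vector_2)

lemma mat2_eq_iff: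
  "A = B \<longleftrightarrow> A $ 1 $ 1 = B $ 1 $ 1 \<and> A $ 1 $ 2 = B $ 1 $ 2 \<and> A $ 2 $ 1 = B $ 2 $ 1 \<and> A $ 2 $ 2 = B $ 2 $ 2"
  for A B :: "'a ^ 2 ^ 2"
  by (auto simp: vec_eq_iff forall_2)

lemma mult2_nth:
  "(A ** B) $ i $ j = A $ i $ 1 * B $ 1 $ j + A $ i $ 2 * B $ 2 $ j" for A B :: "'a::semiring_1 ^ 2 ^ 2"
  by (simp add: matrix_matrix_mult_def sum_2)

lemma mat_nth2 [simp]:
  "(mat k :: 'a::zero ^ 2 ^ 2) $ 1 $ 1 = k" "(mat k :: 'a ^ 2 ^ 2) $ 1 $ 2 = 0"
  "(mat k :: 'a ^ 2 ^ 2) $ 2 $ 1 = 0" "(mat k :: 'a ^ 2 ^ 2) $ 2 $ 2 = k"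
  by (simp_all add: mat_def)

lemma det_mat1 [simp]: "det (mat 1 :: 'a::comm_ring_1 ^ 2 ^ 2) = 1"
  by (simp add: det_2)

lemma det_uminus2 [simp]: "det (- M) = det M" for M :: "'a::comm_ring_1 ^ 2 ^ 2"
  by (simp add: det_2)

text \<open>The adjugate. It serves as a total, division-free inverse: on \<open>SL2\<close> it is
  the group inverse, and it commutes with field automorphisms for matrices of any
  determinant.\<close>

definition adj2 :: "'a::comm_ring_1 ^ 2 ^ 2 \<Rightarrow> 'a ^ 2 ^ 2" where
  "adj2 M = mat2 (M $ 2 $ 2) (- (M $ 1 $ 2)) (- (M $ 2 $ 1)) (M $ 1 $ 1)"

lemma adj2_nth [simp]:
  "adj2 M $ 1 $ 1 = M $ 2 $ 2" "adj2 M $ 1 $ 2 = - (M $ 1 $ 2)"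
  "adj2 M $ 2 $ 1 = - (M $ 2 $ 1)" "adj2 M $ 2 $ 2 = M $ 1 $ 1"
  by (simp_all add: adj2_def)

lemma adj2_mult:
  "adj2 M ** M = mat (det M)" "M ** adj2 M = mat (det M)"
  by (simp_all add: mat2_eq_iff mult2_nth det_2 algebra_simps)

lemma adj2_adj2 [simp]: "adj2 (adj2 M) = M"
  by (simp add: mat2_eq_iff)

lemma det_adj2 [simp]: "det (adj2 M) = det M"
  by (simp add: det_2 algebra_simps)

lemma adj2_mult_distrib: "adj2 (M ** N) = adj2 N ** adj2 M"
  by (simp add: mat2_eq_iff mult2_nth algebra_simps)

lemma adj2_mat1 [simp]: "adj2 (mat 1) = mat 1"
  by (simp add: mat2_eq_iff)

lemma adj2_uminus: "adj2 (- M) = - adj2 M"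
  by (simp add: mat2_eq_iff)

lemma mult2_uminus:
  "(- M) ** N = - (M ** N)" "M ** (- N) = - (M ** N)" for M N :: "'a::comm_ring_1 ^ 2 ^ 2"
  by (simp_all add: mat2_eq_iff mult2_nth)

lemma mat_mult2_commute: "mat k ** M = M ** mat k" for M :: "'a::comm_ring_1 ^ 2 ^ 2"
  by (simp add: mat2_eq_iff mult2_nth mult.commute)

lemma mat_mult_mat2: "mat k ** mat l = (mat (k * l) :: 'a::comm_ring_1 ^ 2 ^ 2)"
  by (simp add: mat2_eq_iff mult2_nth)

lemma det_mat_2 [simp]: "det (mat k :: 'a::comm_ring_1 ^ 2 ^ 2) = k\<^sup>2"
  by (simp add: det_2 power2_eq_square)

lemma map_matrix_mult:
  fixes A B :: "'a::field ^ 2 ^ 2"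
  assumes "\<alpha> \<in> field_auts"
  shows "map_matrix \<alpha> (A ** B) = map_matrix \<alpha> A ** map_matrix \<alpha> B"
  by (simp add: mat2_eq_iff mult2_nth field_auts_simps[OF assms])

lemma det_map_matrix:
  fixes A :: "'a::field ^ 2 ^ 2"
  assumes "\<alpha> \<in> field_auts"
  shows "det (map_matrix \<alpha> A) = \<alpha> (det A)"
  by (simp add: det_2 field_auts_simps[OF assms])

lemma map_matrix_mat:
  assumes "\<alpha> \<in> field_auts"
  shows "map_matrix \<alpha> (mat k) = (mat (\<alpha> k) :: 'a::field ^ 2 ^ 2)"
  by (simp add: mat2_eq_iff field_auts_simps[OF assms])

lemma map_matrix_adj2:
  fixes A :: "'a::field ^ 2 ^ 2"
  assumes "\<alpha> \<in> field_auts"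
  shows "map_matrix \<alpha> (adj2 A) = adj2 (map_matrix \<alpha> A)"
  by (simp add: mat2_eq_iff field_auts_simps[OF assms])

lemma map_matrix_uminus:
  fixes A :: "'a::field ^ 2 ^ 2"
  assumes "\<alpha> \<in> field_auts"
  shows "map_matrix \<alpha> (- A) = - map_matrix \<alpha> A"
  by (simp add: mat2_eq_iff field_auts_simps[OF assms])

lemma map_matrix_comp: "map_matrix \<alpha> (map_matrix \<beta> A) = map_matrix (\<alpha> \<circ> \<beta>) A" for A :: "'a ^ 2 ^ 2"
  by (simp add: mat2_eq_iff)

lemma map_matrix_id [simp]: "map_matrix id A = A" for A :: "'a ^ 2 ^ 2"
  by (simp add: mat2_eq_iff)

lemma mult2_cancel_left:
  fixes m X Y :: "'a::field ^ 2 ^ 2"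
  assumes "det m \<noteq> 0"
  shows "m ** X = m ** Y \<longleftrightarrow> X = Y"
proof
  assume "m ** X = m ** Y"
  hence "adj2 m ** m ** X = adj2 m ** m ** Y"
    by (simp flip: matrix_mul_assoc)
  thus "X = Y"
    using assms by (auto simp: adj2_mult mat2_eq_iff mult2_nth)
qed simp

lemma mult2_cancel_right:
  fixes m X Y :: "'a::field ^ 2 ^ 2"
  assumes "det m \<noteq> 0"
  shows "X ** m = Y ** m \<longleftrightarrow> X = Y"
proof
  assume "X ** m = Y ** m"
  hence "X ** (m ** adj2 m) = Y ** (m ** adj2 m)"
    by (simp add: matrix_mul_assoc)
  thus "X = Y"
    using assms by (auto simp: adj2_mult mat2_eq_iff mult2_nth)
qed simp


section \<open>The groups of permutations of $\mathrm{SL}(2,F)$\<close>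

lemma carrier_SL2: "carrier SL2 = {M. det M = 1}"
  and mult_SL2 [simp]: "M \<otimes>\<^bsub>SL2\<^esub> N = M ** N"
  and one_SL2 [simp]: "\<one>\<^bsub>SL2\<^esub> = mat 1"
  by (simp_all add: SL2_def)

lemma SL2_iff: "M \<in> carrier SL2 \<longleftrightarrow> det M = 1"
  by (simp add: carrier_SL2)

lemma adj2_inverse:
  assumes "M \<in> carrier SL2"
  shows "adj2 M ** M = mat 1" "M ** adj2 M = mat 1" "adj2 M \<in> carrier SL2"
  using assms by (auto simp: SL2_iff adj2_mult)

lemma mult_in_SL2: "M \<in> carrier SL2 \<Longrightarrow> N \<in> carrier SL2 \<Longrightarrow> M ** N \<in> carrier SL2"
  by (simp add: SL2_iff det_mul)

lemma mat1_in_SL2 [simp]: "mat 1 \<in> carrier SL2" and minus_mat1_in_SL2 [simp]: "- mat 1 \<in> carrier SL2"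
  by (simp_all add: SL2_iff)

lemma group_SL2: "group SL2"
proof (rule groupI)
  fix x :: "'a::field ^ 2 ^ 2" assume "x \<in> carrier SL2"
  thus "\<exists>y\<in>carrier SL2. y \<otimes>\<^bsub>SL2\<^esub> x = \<one>\<^bsub>SL2\<^esub>"
    using adj2_inverse[of x] by auto
qed (auto simp: mult_in_SL2 matrix_mul_assoc)

lemma inv_SL2: "h \<in> carrier SL2 \<Longrightarrow> inv\<^bsub>SL2\<^esub> h = adj2 h"
  using adj2_inverse[of h] by (intro group.inv_equality[OF group_SL2]) auto

lemma map_matrix_in_SL2: "\<alpha> \<in> field_auts \<Longrightarrow> map_matrix \<alpha> M \<in> carrier SL2 \<longleftrightarrow> M \<in> carrier SL2"
  using field_auts_simps(8)[of \<alpha> "det M" 1] field_auts_simps(1)[of \<alpha>] by (simp add: SL2_iff det_map_matrix)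

section \<open>Permutations composed from left to right, and semilinear permutations\<close>

lemma group_SymR: "group (SymR S)"
proof (rule groupI)
  fix f assume "f \<in> carrier (SymR S)"
  hence f: "f \<in> Bij S"
    by (simp add: SymR_def)
  hence "compose S f (restrict (inv_into S f) S) = (\<lambda>x\<in>S. x)"
    by (auto simp: fun_eq_iff compose_def Bij_def bij_betw_def f_inv_into_f)
  thus "\<exists>g\<in>carrier (SymR S). g \<otimes>\<^bsub>SymR S\<^esub> f = \<one>\<^bsub>SymR S\<^esub>"
    using f restrict_inv_into_Bij[OF f] by (auto simp: SymR_def)
next
  fix f g h assume "f \<in> carrier (SymR S)" "g \<in> carrier (SymR S)" "h \<in> carrier (SymR S)"
  thus "f \<otimes>\<^bsub>SymR S\<^esub> g \<otimes>\<^bsub>SymR S\<^esub> h = f \<otimes>\<^bsub>SymR S\<^esub> (g \<otimes>\<^bsub>SymR S\<^esub> h)"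
    using compose_assoc[of f S S h g]
    by (auto simp: SymR_def compose_Bij Bij_imp_funcset)
next
  fix f assume "f \<in> carrier (SymR S)"
  hence f: "f \<in> Bij S"
    by (simp add: SymR_def)
  have "compose S f (\<lambda>x\<in>S. x) = f"
    using extensional_arb[OF Bij_imp_extensional[OF f]] by (auto simp: fun_eq_iff compose_def)
  thus "\<one>\<^bsub>SymR S\<^esub> \<otimes>\<^bsub>SymR S\<^esub> f = f"
    using f by (simp add: SymR_def id_Bij)
qed (auto simp: SymR_def compose_Bij id_Bij)

lemma group_SymSL: "group SymSL"
  unfolding SymSL_def by (rule group_SymR)

text \<open>Common shape of \<open>theta\<close>, \<open>rho\<close> and the field automorphisms.
  The lemmas below ask only that det a * det b = 1, not that each determinant be 1, so that
  conjugation by GL(2,F) is covered.\<close>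

definition lin :: "'a::field ^ 2 ^ 2 \<Rightarrow> ('a \<Rightarrow> 'a) \<Rightarrow> 'a ^ 2 ^ 2 \<Rightarrow> 'a ^ 2 ^ 2 \<Rightarrow> 'a ^ 2 ^ 2" where
  "lin a \<alpha> b = (\<lambda>x \<in> carrier SL2. a ** map_matrix \<alpha> x ** b)"

lemma lin_apply [simp]: "x \<in> carrier SL2 \<Longrightarrow> lin a \<alpha> b x = a ** map_matrix \<alpha> x ** b"
  by (simp add: lin_def)

lemma lin_closed:
  assumes "\<alpha> \<in> field_auts" "det a * det b = 1" "x \<in> carrier SL2"
  shows "a ** map_matrix \<alpha> x ** b \<in> carrier SL2"
  using assms(2,3) field_auts_simps(1)[OF assms(1)] by (simp add: SL2_iff det_mul det_map_matrix[OF assms(1)])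

lemma compose_lin:
  assumes "\<alpha> \<in> field_auts" "det a * det b = 1" "\<beta> \<in> field_auts"
  shows "compose (carrier SL2) (lin c \<beta> d) (lin a \<alpha> b) =
    lin (c ** map_matrix \<beta> a) (\<beta> \<circ> \<alpha>) (map_matrix \<beta> b ** d)"
  using lin_closed[OF assms(1,2)]
  by (auto simp: fun_eq_iff compose_def lin_def map_matrix_mult[OF assms(3)] map_matrix_comp matrix_mul_assoc)

text \<open>The adjugates invert \<open>a\<close> and \<open>b\<close> up to the scalars det a and
  det b. These end up on opposite sides of \<open>x\<close> and cancel, since their product is 1 and
  \<beta> preserves that.\<close>

lemma compose_lin_inverse:
  fixes a b :: "'a::field ^ 2 ^ 2"
  assumes "\<alpha> \<in> field_auts" "det a * det b = 1"
  defines "\<beta> \<equiv> inv_into UNIV \<alpha>"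
  shows "compose (carrier SL2) (lin (map_matrix \<beta> (adj2 a)) \<beta> (map_matrix \<beta> (adj2 b))) (lin a \<alpha> b) = (\<lambda>x\<in>carrier SL2. x)"
    (is ?th1)
    and "compose (carrier SL2) (lin a \<alpha> b) (lin (map_matrix \<beta> (adj2 a)) \<beta> (map_matrix \<beta> (adj2 b))) = (\<lambda>x\<in>carrier SL2. x)"
    (is ?th2)
    and "det (map_matrix \<beta> (adj2 a)) * det (map_matrix \<beta> (adj2 b)) = 1" (is ?th3)
proof -
  note \<beta> = field_auts_inv[OF assms(1), folded \<beta>_def]
  have \<beta>1: "\<beta> (det a) * \<beta> (det b) = 1"
    using assms(2) field_auts_simps(1,4)[OF \<beta>(1)] by metis
  have cancel: "mat k ** x ** mat l = x" if "k * l = 1" for k l :: 'a and x :: "'a ^ 2 ^ 2"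
  proof -
    have "k * y * l = y" for y
      using that by (metis mult.assoc mult.commute mult_1)
    thus ?thesis
      by (simp add: mat2_eq_iff mult2_nth)
  qed
  show 3: ?th3
    using \<beta>1 by (simp add: det_map_matrix[OF \<beta>(1)])
  show ?th1
    unfolding compose_lin[OF assms(1,2) \<beta>(1)] \<beta>
    by (auto simp: lin_def fun_eq_iff adj2_mult cancel[OF \<beta>1] map_matrix_mat[OF \<beta>(1)]
        simp flip: map_matrix_mult[OF \<beta>(1)])
  show ?th2
    unfolding compose_lin[OF \<beta>(1) 3 assms(1)] \<beta>
    by (auto simp: lin_def fun_eq_iff adj2_mult cancel[OF assms(2)] map_matrix_comp \<beta>)
qed

lemma lin_in_Bij:
  assumes "\<alpha> \<in> field_auts" "det a * det b = 1"
  shows "lin a \<alpha> b \<in> Bij (carrier SL2)"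
proof -
  let ?g = "lin (map_matrix (inv_into UNIV \<alpha>) (adj2 a)) (inv_into UNIV \<alpha>) (map_matrix (inv_into UNIV \<alpha>) (adj2 b))"
  note c = compose_lin_inverse[OF assms]
  have "bij_betw (lin a \<alpha> b) (carrier SL2) (carrier SL2)"
  proof (rule bij_betw_byWitness[where f' = ?g])
    show "\<forall>x\<in>carrier SL2. ?g (lin a \<alpha> b x) = x"
    proof
      fix x :: "'a ^ 2 ^ 2" assume x: "x \<in> carrier SL2"
      show "?g (lin a \<alpha> b x) = x"
        using fun_cong[OF c(1), of x] unfolding compose_eq[OF x] restrict_apply'[OF x] .
    qed
    show "\<forall>x\<in>carrier SL2. lin a \<alpha> b (?g x) = x"
    proof
      fix x :: "'a ^ 2 ^ 2" assume x: "x \<in> carrier SL2"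
      show "lin a \<alpha> b (?g x) = x"
        using fun_cong[OF c(2), of x] unfolding compose_eq[OF x] restrict_apply'[OF x] .
    qed
    show "lin a \<alpha> b ` carrier SL2 \<subseteq> carrier SL2"
      using lin_closed[OF assms] by auto
    show "?g ` carrier SL2 \<subseteq> carrier SL2"
      using lin_closed[OF field_auts_inv(1)[OF assms(1)] c(3)] by auto
  qed
  thus ?thesis
    by (simp add: Bij_def lin_def)
qed

lemma carrier_SymSL: "carrier SymSL = Bij (carrier SL2)"
  and one_SymSL: "\<one>\<^bsub>SymSL\<^esub> = (\<lambda>x\<in>carrier SL2. x)"
  and mult_SymSL: "f \<in> Bij (carrier SL2) \<Longrightarrow> g \<in> Bij (carrier SL2) \<Longrightarrow> f \<otimes>\<^bsub>SymSL\<^esub> g = compose (carrier SL2) g f"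
  by (simp_all add: SymSL_def SymR_def)

lemma lin_in_SymSL:
  "\<alpha> \<in> field_auts \<Longrightarrow> det a * det b = 1 \<Longrightarrow> lin a \<alpha> b \<in> carrier SymSL"
  by (simp add: carrier_SymSL lin_in_Bij)

lemma mult_lin:
  assumes "\<alpha> \<in> field_auts" "det a * det b = 1" "\<beta> \<in> field_auts" "det c * det d = 1"
  shows "lin a \<alpha> b \<otimes>\<^bsub>SymSL\<^esub> lin c \<beta> d = lin (c ** map_matrix \<beta> a) (\<beta> \<circ> \<alpha>) (map_matrix \<beta> b ** d)"
  using assms by (simp add: mult_SymSL lin_in_Bij compose_lin)

lemma inv_lin:
  assumes "\<alpha> \<in> field_auts" "det a * det b = 1"
  shows "inv\<^bsub>SymSL\<^esub> (lin a \<alpha> b) =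
    lin (map_matrix (inv_into UNIV \<alpha>) (adj2 a)) (inv_into UNIV \<alpha>) (map_matrix (inv_into UNIV \<alpha>) (adj2 b))"
  using compose_lin_inverse[OF assms] assms field_auts_inv(1)[OF assms(1)]
  by (intro group.inv_equality[OF group_SymSL]) (simp_all add: carrier_SymSL lin_in_Bij mult_SymSL one_SymSL)

lemma one_SymSL_lin: "\<one>\<^bsub>SymSL\<^esub> = lin (mat 1) id (mat 1)"
  by (auto simp: one_SymSL lin_def fun_eq_iff)

text \<open>Turns out to be \<open>AutR\<close>; as an explicit subgroup it bounds the generated
  group from above.\<close>

definition semilinear_maps :: "('a::field ^ 2 ^ 2 \<Rightarrow> 'a ^ 2 ^ 2) set" where
  "semilinear_maps = {lin a \<alpha> b | a \<alpha> b. \<alpha> \<in> field_auts \<and> det a * det b = 1}"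

lemma subgroup_semilinear_maps: "subgroup semilinear_maps SymSL"
proof (rule group.subgroupI[OF group_SymSL])
  show "semilinear_maps \<subseteq> carrier SymSL"
    by (auto simp: semilinear_maps_def lin_in_SymSL)
  have "lin (mat 1) id (mat 1) \<in> semilinear_maps"
    unfolding semilinear_maps_def using id_field_auts by fastforce
  thus "semilinear_maps \<noteq> {}"
    by blast
next
  fix f :: "'a ^ 2 ^ 2 \<Rightarrow> 'a ^ 2 ^ 2" assume "f \<in> semilinear_maps"
  then obtain a \<alpha> b where f: "f = lin a \<alpha> b" "\<alpha> \<in> field_auts" "det a * det b = 1"
    by (auto simp: semilinear_maps_def)
  show "inv\<^bsub>SymSL\<^esub> f \<in> semilinear_maps"
    using inv_lin[OF f(2,3)] field_auts_inv(1)[OF f(2)] compose_lin_inverse(3)[OF f(2,3)]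
    unfolding semilinear_maps_def f(1) by blast
next
  fix f g :: "'a ^ 2 ^ 2 \<Rightarrow> 'a ^ 2 ^ 2" assume "f \<in> semilinear_maps" "g \<in> semilinear_maps"
  then obtain a \<alpha> b c \<beta> d where f: "f = lin a \<alpha> b" "\<alpha> \<in> field_auts" "det a * det b = 1"
      and g: "g = lin c \<beta> d" "\<beta> \<in> field_auts" "det c * det d = 1"
    by (auto simp: semilinear_maps_def)
  have "det (c ** map_matrix \<beta> a) * det (map_matrix \<beta> b ** d) = \<beta> (det a * det b) * (det c * det d)"
    by (simp add: det_mul det_map_matrix[OF g(2)] field_auts_simps[OF g(2)])
  also have "\<dots> = 1"
    by (simp add: f g field_auts_simps[OF g(2)])
  finally show "f \<otimes>\<^bsub>SymSL\<^esub> g \<in> semilinear_maps"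
    using mult_lin[OF f(2,3) g(2,3)] field_auts_comp[OF g(2) f(2)]
    unfolding semilinear_maps_def f(1) g(1) by blast
qed

lemma theta_lin: "h \<in> carrier SL2 \<Longrightarrow> theta q h = lin (adj2 h) id (bar q h)"
  by (simp add: theta_def lin_def inv_SL2 bar_def)

lemma rho_lin: "rho h = lin (mat 1) id h"
  by (auto simp: rho_def lin_def)

lemma field_perms_lin: "field_perms = {lin (mat 1) \<alpha> (mat 1) | \<alpha>. \<alpha> \<in> field_auts}"
proof -
  have "restrict (map_matrix \<alpha>) (carrier SL2) = lin (mat 1) \<alpha> (mat 1)" for \<alpha> :: "'a \<Rightarrow> 'a"
    by (auto simp: lin_def)
  thus ?thesis
    by (simp add: field_perms_def)
qed


section \<open>Automorphisms of $\mathrm{SL}(2,F)$ for a finite field\<close>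

definition upper1 :: "'a \<Rightarrow> 'a::field ^ 2 ^ 2" where "upper1 x = mat2 1 x 0 1"
definition lower1 :: "'a \<Rightarrow> 'a::field ^ 2 ^ 2" where "lower1 x = mat2 1 0 x 1"

lemma upper1_nth [simp]:
  "upper1 x $ 1 $ 1 = 1" "upper1 x $ 1 $ 2 = x" "upper1 x $ 2 $ 1 = 0" "upper1 x $ 2 $ 2 = 1"
  and lower1_nth [simp]:
  "lower1 x $ 1 $ 1 = 1" "lower1 x $ 1 $ 2 = 0" "lower1 x $ 2 $ 1 = x" "lower1 x $ 2 $ 2 = 1"
  by (simp_all add: upper1_def lower1_def)

lemma upper1_in_SL2 [simp]: "upper1 x \<in> carrier SL2"
  and lower1_in_SL2 [simp]: "lower1 x \<in> carrier SL2"
  by (simp_all add: SL2_iff det_2)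

section \<open>Elements of order p are unipotent\<close>

lemma power_eq_1_prime_char:
  assumes "prime CHAR('a::idom)" "(a::'a) ^ CHAR('a) = 1"
  shows "a = 1"
proof -
  have "((a - 1) + 1) ^ CHAR('a) = (a - 1) ^ CHAR('a) + 1 ^ CHAR('a)"
    by (rule freshmans_dream[OF assms(1) refl])
  thus ?thesis
    using assms by simp
qed

text \<open>Modulo the characteristic polynomial \<open>c\<close> of \<open>M\<close>, \<open>X ^ n\<close> and \<open>M ^ n\<close> are the same linear
  expression in \<open>X\<close> and \<open>M\<close>.  Hence \<open>M ^ p = 1\<close> forces \<open>c\<close> to divide \<open>X ^ p - 1 = (X - 1) ^ p\<close>.\<close>

lemma trace_of_order_prime_char:
  fixes M :: "'a::field ^ 2 ^ 2"
  assumes p: "prime CHAR('a)" and M: "M \<in> carrier SL2" "M [^]\<^bsub>SL2\<^esub> CHAR('a) = mat 1"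
  shows "M $ 1 $ 1 + M $ 2 $ 2 = 2"
\<comment> \<open>Scalar matrices are treated apart: for them 1 and M are linearly dependent, so M^p
  = 1 would not determine the coefficients of the linear expression.\<close>
proof (cases "M = mat (M $ 1 $ 1)")
  case True
  have "mat a [^]\<^bsub>SL2\<^esub> n = mat (a ^ n)" for a :: 'a and n :: nat
    by (induction n) (simp_all add: nat_pow_def mat_mult_mat2 mult.commute)
  hence "mat ((M $ 1 $ 1) ^ CHAR('a)) = (mat 1 :: 'a ^ 2 ^ 2)"
    using True M(2) by metis
  hence "M $ 1 $ 1 = 1"
    using power_eq_1_prime_char[OF p] by (simp add: mat2_eq_iff)
  moreover have "M $ 2 $ 2 = M $ 1 $ 1"
    using True by (metis mat_nth2(4))
  ultimately show ?thesis
    by simp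
next
  case False
  define t where "t = M $ 1 $ 1 + M $ 2 $ 2"
  define c where "c = [:1, - t, 1:]"
  have det: "M $ 1 $ 1 * M $ 2 $ 2 - M $ 1 $ 2 * M $ 2 $ 1 = 1"
    using M(1) by (simp add: SL2_iff det_2)
  have CH: "M ** M = mat t ** M - mat 1"
    unfolding t_def using det by (simp add: mat2_eq_iff mult2_nth algebra_simps)
  have "\<exists>\<alpha> \<beta>. M [^]\<^bsub>SL2\<^esub> n = mat \<alpha> ** M + mat \<beta> \<and> c dvd [:0,1:] ^ n - [:\<beta>, \<alpha>:]" for n :: nat
  proof (induction n)
    case 0
    show ?case
      by (intro exI[of _ 0] exI[of _ 1]) (simp add: nat_pow_def mat2_eq_iff mult2_nth one_pCons)
  next
    case (Suc n)
    then obtain \<alpha> \<beta> where IH: "M [^]\<^bsub>SL2\<^esub> n = mat \<alpha> ** M + mat \<beta>" "c dvd [:0,1:] ^ n - [:\<beta>, \<alpha>:]"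
      by blast
    have "M [^]\<^bsub>SL2\<^esub> Suc n = (mat \<alpha> ** M + mat \<beta>) ** M"
      using IH(1) by (simp add: nat_pow_def)
    also have "\<dots> = mat \<alpha> ** (M ** M) + mat \<beta> ** M"
      by (simp add: mat2_eq_iff mult2_nth algebra_simps)
    also have "\<dots> = mat (\<alpha> * t + \<beta>) ** M + mat (- \<alpha>)"
      unfolding CH by (simp add: mat2_eq_iff mult2_nth algebra_simps)
    finally have "M [^]\<^bsub>SL2\<^esub> Suc n = mat (\<alpha> * t + \<beta>) ** M + mat (- \<alpha>)" .
    moreover have "[:0,1:] ^ Suc n - [:- \<alpha>, \<alpha> * t + \<beta>:] = [:0,1:] * ([:0,1:] ^ n - [:\<beta>, \<alpha>:]) + [:\<alpha>:] * c"
      by (simp add: c_def algebra_simps)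
    hence "c dvd [:0,1:] ^ Suc n - [:- \<alpha>, \<alpha> * t + \<beta>:]"
      using IH(2) by (metis dvd_add dvd_mult dvd_triv_right)
    ultimately show ?case
      by blast
  qed
  then obtain \<alpha> \<beta> where ab: "mat 1 = mat \<alpha> ** M + mat \<beta>" "c dvd [:0,1:] ^ CHAR('a) - [:\<beta>, \<alpha>:]"
    using M(2) by metis
  \<comment> \<open>As M is not scalar, 1 and M are linearly independent, and the coefficients can
    be compared.\<close>
  have "\<alpha> = 0"
    using False ab(1) by (auto simp: mat2_eq_iff mult2_nth) (metis add_right_cancel mult_cancel_left)+
  hence "\<beta> = 1"
    using ab(1) by (simp add: mat2_eq_iff mult2_nth)
  have "([:-1, 1:] + 1) ^ CHAR('a) = [:-1,1:] ^ CHAR('a) + (1 :: 'a poly) ^ CHAR('a)"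
    by (rule freshmans_dream) (use p in auto)
  moreover have "[:-1, 1:] + 1 = [:0, 1::'a:]" "[:\<beta>, \<alpha>:] = 1"
    using \<open>\<alpha> = 0\<close> \<open>\<beta> = 1\<close> by (simp_all add: one_pCons)
  ultimately have "[:0,1:] ^ CHAR('a) - [:\<beta>, \<alpha>:] = [:-1, 1:] ^ CHAR('a)"
    by simp
  hence dvd: "c dvd [:-1, 1:] ^ CHAR('a)"
    using ab(2) by simp
  \<comment> \<open>X - 1 is prime. If it did not divide \<open>c\<close>, it could be stripped from
    (X - 1)^p factor by factor, leaving \<open>c\<close> a unit, against its degree 2. The root 1 of
    \<open>c\<close> = X^2 - t X + 1 then gives t = 2.\<close>
  have "[:-1, 1:] dvd c"
  proof (rule ccontr)
    assume nd: "\<not> [:-1, 1:] dvd c"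
    have pr: "prime_elem [:-1, 1::'a:]"
      by (rule prime_elem_linear_field_poly) simp
    have "c dvd [:-1, 1:] ^ n \<Longrightarrow> c dvd 1" for n
    proof (induction n)
      case (Suc n)
      then obtain r where r: "[:-1, 1:] * [:-1, 1:] ^ n = c * r"
        by (auto elim!: dvdE)
      hence "[:-1, 1:] dvd c * r"
        by (metis dvd_triv_left)
      then obtain s where "r = [:-1, 1:] * s"
        using pr nd by (auto simp: prime_elem_dvd_mult_iff elim!: dvdE)
      hence "[:-1, 1:] * [:-1, 1:] ^ n = [:-1, 1:] * (c * s)"
        using r by (simp only: mult.left_commute)
      moreover have "[:-1, 1::'a:] \<noteq> 0"
        by simp
      ultimately have "[:-1, 1:] ^ n = c * s"
        by (metis mult_left_cancel)
      thus ?case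
        using Suc.IH by simp
    qed simp
    hence "c dvd 1"
      using dvd by blast
    thus False
      by (simp add: c_def is_unit_poly_iff)
  qed
  hence "poly c 1 = 0"
    using poly_eq_0_iff_dvd[of c 1] by simp
  thus ?thesis
    unfolding c_def t_def by (simp add: algebra_simps)
qed

text \<open>N = M - 1 satisfies N^2 = 0. A matrix with rows v and v N intertwines M with
  \<open>upper1 1\<close>; it is invertible for v = (1,0) if b is nonzero, and for v = (0,1)
  otherwise.\<close>

lemma unipotent_conj_upper1:
  fixes M :: "'a::field ^ 2 ^ 2"
  assumes M: "M \<in> carrier SL2" "M $ 1 $ 1 + M $ 2 $ 2 = 2" "M \<noteq> mat 1"
  shows "\<exists>m. det m \<noteq> 0 \<and> m ** M = upper1 1 ** m"
proof -
  define a b c where "a = M $ 1 $ 1 - 1" and "b = M $ 1 $ 2" and "c = M $ 2 $ 1"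
  have M22: "M $ 2 $ 2 = 1 - a"
    using M(2) unfolding a_def by (simp add: algebra_simps)
  have M11: "M $ 1 $ 1 = 1 + a"
    by (simp add: a_def)
  have sq: "a * a + b * c = 0"
    using M(1) unfolding SL2_iff det_2 M11 M22 by (simp add: b_def c_def algebra_simps)
  note M' = M11 M22 b_def[symmetric] c_def[symmetric]
  show ?thesis
  proof (cases "b = 0")
    case False
    show ?thesis
      using False sq
      by (intro exI[of _ "mat2 1 0 a b"])
         (auto simp: det_2 mat2_eq_iff mult2_nth M' algebra_simps add_eq_0_iff)
  next
    case True
    hence "a = 0" using sq by simp
    hence "c \<noteq> 0"
      using M(3) True M' by (auto simp: mat2_eq_iff)
    thus ?thesis
      using True \<open>a = 0\<close>
      by (intro exI[of _ "mat2 0 1 c 0"]) (auto simp: det_2 mat2_eq_iff mult2_nth M')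
  qed
qed

lemma centralizer_upper1:
  fixes X :: "'a::field ^ 2 ^ 2"
  assumes p: "prime CHAR('a)" and X: "X \<in> carrier SL2" "X ** upper1 1 = upper1 1 ** X"
    "X [^]\<^bsub>SL2\<^esub> CHAR('a) = mat 1"
  shows "X = upper1 (X $ 1 $ 2)"
proof -
  have e: "X $ 2 $ 1 = 0" "X $ 2 $ 2 = X $ 1 $ 1"
    using X(2) by (simp_all add: mat2_eq_iff mult2_nth algebra_simps)
  have "X $ 1 $ 1 * X $ 1 $ 1 = 1"
    using X(1) e by (simp add: SL2_iff det_2)
  moreover have "X $ 1 $ 1 + X $ 1 $ 1 = 2"
    using trace_of_order_prime_char[OF p X(1,3)] e by simp
  \<comment> \<open>The determinant alone leaves the value -1 possible, and in characteristic 2 the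
    trace alone says nothing; combined they give a square that vanishes in every
    characteristic.\<close>
  ultimately have "(X $ 1 $ 1 - 1) * (X $ 1 $ 1 - 1) = 0"
    by (simp add: algebra_simps)
  thus ?thesis
    using e by (simp add: mat2_eq_iff)
qed

text \<open>Injective endomorphisms, constrained on \<open>SL2\<close> only. Unlike membership in
  \<open>auto\<close>, this survives composition with a matrix conjugation without restricting to
  the carrier again.\<close>

definition SL2_mono :: "('a::field ^ 2 ^ 2 \<Rightarrow> 'a ^ 2 ^ 2) \<Rightarrow> bool" where
  "SL2_mono \<phi> \<longleftrightarrow> (\<forall>x\<in>carrier SL2. \<phi> x \<in> carrier SL2) \<and> inj_on \<phi> (carrier SL2) \<and>
     (\<forall>x\<in>carrier SL2. \<forall>y\<in>carrier SL2. \<phi> (x ** y) = \<phi> x ** \<phi> y)"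

lemma SL2_mono_conj:
  assumes "SL2_mono \<phi>" "m ** n = mat 1" "n ** m = mat 1"
  shows "SL2_mono (\<lambda>x. m ** \<phi> x ** n)"
proof -
  have d: "det m * det n = 1"
    using assms(2) by (metis det_mul det_mat1)
  hence nz: "det m \<noteq> 0" "det n \<noteq> 0" by auto
  have "m ** \<phi> x ** n ** (m ** \<phi> y ** n) = m ** (\<phi> x ** \<phi> y) ** n" for x y
  proof -
    have "m ** \<phi> x ** n ** (m ** \<phi> y ** n) = m ** \<phi> x ** (n ** m) ** (\<phi> y ** n)"
      by (simp only: matrix_mul_assoc)
    thus ?thesis
      by (simp add: assms(3) matrix_mul_assoc)
  qed
  thus ?thesis
    using assms(1) d unfolding SL2_mono_def inj_on_def
    by (auto simp: SL2_iff det_mul mult2_cancel_left[OF nz(1)] mult2_cancel_right[OF nz(2)] mult.commute)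
qed

lemma SL2_mono_simps:
  assumes "SL2_mono \<phi>"
  shows "x \<in> carrier SL2 \<Longrightarrow> \<phi> x \<in> carrier SL2"
    and "x \<in> carrier SL2 \<Longrightarrow> y \<in> carrier SL2 \<Longrightarrow> \<phi> (x ** y) = \<phi> x ** \<phi> y"
    and "x \<in> carrier SL2 \<Longrightarrow> y \<in> carrier SL2 \<Longrightarrow> \<phi> x = \<phi> y \<longleftrightarrow> x = y"
    and "\<phi> (mat 1) = mat 1"
    and "x \<in> carrier SL2 \<Longrightarrow> \<phi> (adj2 x) = adj2 (\<phi> x)"
    and "x \<in> carrier SL2 \<Longrightarrow> \<phi> (x [^]\<^bsub>SL2\<^esub> (n::nat)) = \<phi> x [^]\<^bsub>SL2\<^esub> n"
proof -
  show cl: "x \<in> carrier SL2 \<Longrightarrow> \<phi> x \<in> carrier SL2"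
    and mult: "x \<in> carrier SL2 \<Longrightarrow> y \<in> carrier SL2 \<Longrightarrow> \<phi> (x ** y) = \<phi> x ** \<phi> y"
    and "x \<in> carrier SL2 \<Longrightarrow> y \<in> carrier SL2 \<Longrightarrow> \<phi> x = \<phi> y \<longleftrightarrow> x = y" for x y
    using assms by (auto simp: SL2_mono_def inj_on_def)
  interpret h: group_hom SL2 SL2 \<phi>
    using cl mult group_SL2 by (auto simp: group_hom_def group_hom_axioms_def hom_def)
  show "\<phi> (mat 1) = mat 1"
    using h.hom_one by simp
  show "x \<in> carrier SL2 \<Longrightarrow> \<phi> (adj2 x) = adj2 (\<phi> x)"
    using h.hom_inv[of x] cl[of x] by (simp add: inv_SL2)
  show "x \<in> carrier SL2 \<Longrightarrow> \<phi> (x [^]\<^bsub>SL2\<^esub> n) = \<phi> x [^]\<^bsub>SL2\<^esub> n"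
    by (rule h.hom_nat_pow)
qed

text \<open>If (a, c) is the first column of \<open>W\<close>, the product is det W plus y times the
  column (a, c) times the row (-c, a). Thus, for nonzero y, it is lower triangular exactly if a = 0
  and upper triangular exactly if c = 0.\<close>

lemma conj_upper1_nth:
  fixes W :: "'a::field ^ 2 ^ 2"
  shows "(W ** upper1 y ** adj2 W) $ 1 $ 1 = det W - y * W $ 1 $ 1 * W $ 2 $ 1"
    "(W ** upper1 y ** adj2 W) $ 1 $ 2 = y * W $ 1 $ 1 * W $ 1 $ 1"
    "(W ** upper1 y ** adj2 W) $ 2 $ 1 = - (y * W $ 2 $ 1 * W $ 2 $ 1)"
    "(W ** upper1 y ** adj2 W) $ 2 $ 2 = det W + y * W $ 1 $ 1 * W $ 2 $ 1"
  by (simp_all add: mult2_nth det_2 algebra_simps)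

lemma upper1_pow: "upper1 x [^]\<^bsub>SL2\<^esub> (n::nat) = upper1 (of_nat n * x)"
  by (induction n) (simp_all add: nat_pow_def mat2_eq_iff mult2_nth algebra_simps)

text \<open>In characteristic 2 every x is a square; otherwise x = ((x+1)/2)^2 - ((x-1)/2)^2 is a
  difference of squares. Additivity therefore extends multiplicativity from squares to all
  elements.\<close>

lemma additive_square_multiplicative:
  fixes f :: "'a::{field,finite} \<Rightarrow> 'a"
  assumes add: "\<And>x y. f (x + y) = f x + f y" and one: "f 1 = 1"
    and sq: "\<And>x y. f (x\<^sup>2 * y) = (f x)\<^sup>2 * f y"
  shows "f (x * y) = f x * f y"
proof -
  have sub: "f (x - y) = f x - f y" for x y
    using add[of "x - y" y] by simp
  have sq': "f (x\<^sup>2) = (f x)\<^sup>2" for x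
    using sq[of x 1] one by simp
  show ?thesis
  proof (cases "(1::'a) + 1 = 0")
    case True
    then obtain s where "x = s\<^sup>2"
      using finite_field_square_char_2 by blast
    thus ?thesis
      by (simp add: sq sq')
  next
    case False
    define u v where "u = (x + 1) / 2" and "v = (x - 1) / 2"
    have "(2::'a) \<noteq> 0"
      using False by simp
    have "x = u\<^sup>2 - v\<^sup>2"
    proof -
      have "u\<^sup>2 - v\<^sup>2 = (u + v) * (u - v)"
        by (simp add: power2_eq_square algebra_simps)
      also have "u + v = x"
        unfolding u_def v_def add_divide_distrib[symmetric]
        using \<open>(2::'a) \<noteq> 0\<close> by (simp flip: mult_2_right)
      also have "u - v = 1"
        unfolding u_def v_def diff_divide_distrib[symmetric] using \<open>(2::'a) \<noteq> 0\<close> by simp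
      finally show ?thesis by simp
    qed
    thus ?thesis
      by (simp add: left_diff_distrib sub sq sq')
  qed
qed

text \<open>A nonzero lower-left entry can be used to clear both diagonal entries, which writes g as
  upper, lower, upper. If that entry is 0, multiplying by the Weyl element \<open>w\<close> moves
  the nonzero upper-left entry there, and \<open>adj2 w\<close> itself falls under the first
  case.\<close>

lemma SL2_generated:
  fixes P :: "'a::field ^ 2 ^ 2 \<Rightarrow> bool"
  assumes up: "\<And>x. P (upper1 x)" and lo: "\<And>x. P (lower1 x)"
    and mult: "\<And>A B. A \<in> carrier SL2 \<Longrightarrow> B \<in> carrier SL2 \<Longrightarrow> P A \<Longrightarrow> P B \<Longrightarrow> P (A ** B)"
    and g: "g \<in> carrier SL2"
  shows "P g"
proof -
  have ne: "P g" if g: "g \<in> carrier SL2" and c: "g $ 2 $ 1 \<noteq> 0" for g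
  proof -
    let ?x = "(g $ 1 $ 1 - 1) / g $ 2 $ 1" and ?y = "(g $ 2 $ 2 - 1) / g $ 2 $ 1"
    have "g $ 1 $ 1 * g $ 2 $ 2 - g $ 1 $ 2 * g $ 2 $ 1 = 1"
      using g by (simp add: SL2_iff det_2)
    hence b: "g $ 1 $ 2 = (g $ 1 $ 1 * g $ 2 $ 2 - 1) / g $ 2 $ 1"
      using c by (simp add: field_simps)
    have "g = upper1 ?x ** lower1 (g $ 2 $ 1) ** upper1 ?y"
      using c by (simp add: mat2_eq_iff mult2_nth) (simp add: b field_simps)
    moreover have "P (upper1 ?x ** lower1 (g $ 2 $ 1) ** upper1 ?y)"
      by (intro mult mult_in_SL2 up lo) auto
    ultimately show ?thesis
      by simp
  qed
  show ?thesis
  proof (cases "g $ 2 $ 1 = 0")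
    case True
    define w :: "'a ^ 2 ^ 2" where "w = mat2 0 1 (- 1) 0"
    have w: "w \<in> carrier SL2" "adj2 w \<in> carrier SL2"
      by (simp_all add: w_def SL2_iff det_2)
    have "g $ 1 $ 1 \<noteq> 0"
      using g True by (auto simp: SL2_iff det_2)
    hence "P (w ** g)"
      using mult_in_SL2[OF w(1) g] by (intro ne) (auto simp: w_def mult2_nth)
    moreover have "P (adj2 w)"
      using w(2) by (intro ne) (auto simp: w_def)
    ultimately have "P (adj2 w ** (w ** g))"
      by (intro mult[OF w(2) mult_in_SL2[OF w(1) g]])
    thus ?thesis
      using adj2_inverse(1)[OF w(1)] by (simp add: matrix_mul_assoc)
  qed (use ne g in blast)
qed

text \<open>The zero entry in the image of the Weyl element makes \<phi> preserve the lower
  unitriangular group as well. Relations between the two unitriangular groups then force f to be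
  multiplicative along squares.\<close>

lemma SL2_mono_normalized:
  fixes \<phi> :: "'a::{field,finite} ^ 2 ^ 2 \<Rightarrow> 'a ^ 2 ^ 2"
  assumes \<phi>: "SL2_mono \<phi>" and f: "\<And>x. \<phi> (upper1 x) = upper1 (f x)"
    and f1: "f 1 = 1" and W11: "\<phi> (mat2 0 1 (- 1) 0) $ 1 $ 1 = 0"
  shows "f \<in> field_auts" and "\<And>x. x \<in> carrier SL2 \<Longrightarrow> \<phi> x = map_matrix f x"
proof -
  note \<phi>s = SL2_mono_simps[OF \<phi>]
  define w :: "'a ^ 2 ^ 2" where "w = mat2 0 1 (- 1) 0"
  define W where "W = \<phi> w"
  define c where "c = W $ 2 $ 1"
  have w: "w \<in> carrier SL2"
    by (simp add: w_def SL2_iff det_2)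
  have W: "W \<in> carrier SL2" "W $ 1 $ 1 = 0" "det W = 1"
    using \<phi>s(1)[OF w] W11 by (auto simp: W_def w_def SL2_iff)
  have add: "f (x + y) = f x + f y" for x y
  proof -
    have "upper1 (x + y) = upper1 x ** upper1 y" for x y :: 'a
      by (simp add: mat2_eq_iff mult2_nth)
    hence "upper1 (f (x + y)) = upper1 (f x + f y)"
      using \<phi>s(2)[of "upper1 x" "upper1 y"] by (simp flip: f)
    thus ?thesis
      by (simp add: mat2_eq_iff)
  qed
  have f0: "f 0 = 0"
    using add[of 0 0] by (metis add.right_neutral add_left_cancel)
  have neg: "f (- x) = - f x" for x
    using add[of x "- x"] f0 by (simp add: eq_neg_iff_add_eq_0 add.commute)
  have fnz: "f x \<noteq> 0" if "x \<noteq> 0" for x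
  proof
    assume "f x = 0"
    hence "\<phi> (upper1 x) = \<phi> (upper1 0)"
      by (simp add: f f0)
    hence "upper1 x = upper1 0"
      by (simp add: \<phi>s(3))
    thus False
      using that by (simp add: mat2_eq_iff)
  qed
  \<comment> \<open>\<open>w\<close> conjugates \<open>upper1 (- y)\<close> to
    \<open>lower1 y\<close>, and the first column of \<open>W\<close> is (0, c).\<close>
  have lo: "\<phi> (lower1 y) = lower1 (c\<^sup>2 * f y)" for y
  proof -
    have "lower1 y = w ** upper1 (- y) ** adj2 w"
      by (simp add: mat2_eq_iff conj_upper1_nth) (simp add: w_def det_2)
    hence "\<phi> (lower1 y) = W ** upper1 (- f y) ** adj2 W"
      using w adj2_inverse(3)[OF w] by (simp add: \<phi>s mult_in_SL2 f neg W_def)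
    thus ?thesis
      by (simp add: mat2_eq_iff conj_upper1_nth W c_def power2_eq_square mult_ac)
  qed
  have key: "c\<^sup>2 * f (y / x\<^sup>2) = f y / (f x)\<^sup>2" if x: "x \<noteq> 0" for x y
  proof -
    \<comment> \<open>\<open>v\<close> is the monomial matrix with rows (0, x) and (-1/x, 0),
      written in unitriangular factors so that its image is computable. It conjugates
      \<open>upper1 y\<close> to \<open>lower1 (- (y / x\<^sup>2))\<close>.\<close>
    define v where "v = upper1 x ** lower1 (- 1 / x) ** upper1 x"
    define V where "V = \<phi> v"
    define z where "z = c\<^sup>2 * f (- 1 / x)"
    have v: "v \<in> carrier SL2"
      unfolding v_def by (intro mult_in_SL2) auto
    have vn: "v $ 1 $ 1 = 0" "v $ 2 $ 1 = - 1 / x" "det v = 1"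
      using x v by (simp_all add: v_def mult2_nth SL2_iff)
    have V: "V = upper1 (f x) ** lower1 z ** upper1 (f x)" "V \<in> carrier SL2"
      using \<phi>s(1)[OF v] by (simp_all add: V_def v_def \<phi>s mult_in_SL2 f lo z_def)
    have conj: "V ** upper1 (f y) ** adj2 V = lower1 (c\<^sup>2 * f (- (y / x\<^sup>2)))" for y
    proof -
      have "v ** upper1 y ** adj2 v = lower1 (- (y / x\<^sup>2))"
        using vn x by (simp add: mat2_eq_iff conj_upper1_nth power2_eq_square)
      hence "\<phi> (v ** upper1 y ** adj2 v) = lower1 (c\<^sup>2 * f (- (y / x\<^sup>2)))"
        by (simp add: lo)
      thus ?thesis
        using v adj2_inverse(3)[OF v] by (simp add: \<phi>s mult_in_SL2 f V_def)
    qed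
    \<comment> \<open>A conjugate of \<open>upper1 1\<close> that is lower triangular has
      upper-right entry 0, and this entry is the square of \<open>V $ 1 $ 1\<close>.\<close>
    have "V $ 1 $ 1 = 0"
      using arg_cong[OF conj[of 1], of "\<lambda>A. A $ 1 $ 2"] by (simp add: conj_upper1_nth f1)
    hence "1 + f x * z = 0"
      by (simp add: V(1) mult2_nth)
    hence z: "z = - 1 / f x"
      using fnz[OF x] by (metis add_eq_0_iff nonzero_mult_div_cancel_left)
    have "V $ 2 $ 1 = - 1 / f x"
      by (simp add: V(1) mult2_nth z)
    thus ?thesis
      using arg_cong[OF conj[of y], of "\<lambda>A. A $ 2 $ 1"]
      by (simp add: conj_upper1_nth neg power2_eq_square mult_ac)
  qed
  have c2: "c\<^sup>2 = 1"
    using key[of 1 1] f1 by simp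
  have "f (x\<^sup>2 * y) = (f x)\<^sup>2 * f y" for x y
  proof (cases "x = 0")
    case False
    thus ?thesis
      using key[OF False, of "x\<^sup>2 * y"] c2 fnz[OF False] by (simp add: field_simps)
  qed (simp add: f0)
  hence "f (x * y) = f x * f y" for x y
    by (rule additive_square_multiplicative[OF add f1])
  thus fa: "f \<in> field_auts"
    by (rule additive_multiplicative_field_auts[OF add _ f1])
  show "\<phi> x = map_matrix f x" if "x \<in> carrier SL2" for x
  proof (rule SL2_generated[OF _ _ _ that])
    show "\<phi> (upper1 x) = map_matrix f (upper1 x)" for x
      by (simp add: f mat2_eq_iff f0 f1)
    show "\<phi> (lower1 x) = map_matrix f (lower1 x)" for x
      by (simp add: lo c2 mat2_eq_iff f0 f1)
  qed (simp add: \<phi>s map_matrix_mult[OF fa])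
qed

lemma SL2_mono_semilinear:
  fixes \<phi> :: "'a::{field,finite} ^ 2 ^ 2 \<Rightarrow> 'a ^ 2 ^ 2"
  assumes \<phi>: "SL2_mono \<phi>" and p: "prime CHAR('a)"
  shows "\<exists>a \<alpha> b. \<alpha> \<in> field_auts \<and> det a * det b = 1 \<and> (\<forall>x\<in>carrier SL2. \<phi> x = a ** map_matrix \<alpha> x ** b)"
proof -
  have one: "upper1 x [^]\<^bsub>SL2\<^esub> CHAR('a) = mat 1" for x :: 'a
    by (simp add: upper1_pow mat2_eq_iff)
  define U where "U = \<phi> (upper1 1)"
  have "U $ 1 $ 1 + U $ 2 $ 2 = 2"
  proof (rule trace_of_order_prime_char[OF p])
    show "U \<in> carrier SL2"
      by (simp add: U_def SL2_mono_simps[OF \<phi>])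
    show "U [^]\<^bsub>SL2\<^esub> CHAR('a) = mat 1"
      unfolding U_def using SL2_mono_simps(6)[OF \<phi>, of "upper1 1" "CHAR('a)"] SL2_mono_simps(4)[OF \<phi>] one[of 1] by simp
  qed
  moreover have "U \<noteq> mat 1"
  proof
    assume "U = mat 1"
    hence "upper1 1 = (mat 1 :: 'a ^ 2 ^ 2)"
      unfolding U_def using SL2_mono_simps(3,4)[OF \<phi>] by (metis mat1_in_SL2 upper1_in_SL2)
    thus False
      by (simp add: mat2_eq_iff)
  qed
  \<comment> \<open>\<open>m\<close> has an arbitrary nonzero determinant; here GL(2,F)
    enters.\<close>
  ultimately obtain m where m: "det m \<noteq> 0" "m ** U = upper1 1 ** m"
    using unipotent_conj_upper1[of U] SL2_mono_simps(1)[OF \<phi>] unfolding U_def by auto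
  define n where "n = mat (1 / det m) ** adj2 m"
  have mn: "m ** n = mat 1" "n ** m = mat 1"
  proof -
    have "n ** m = mat (1 / det m) ** (adj2 m ** m)"
      by (simp add: n_def matrix_mul_assoc)
    thus "n ** m = mat 1"
      using m(1) by (simp add: adj2_mult mat_mult_mat2)
    have "m ** n = m ** adj2 m ** mat (1 / det m)"
      unfolding n_def mat_mult2_commute[of "1 / det m" "adj2 m"] by (simp add: matrix_mul_assoc)
    thus "m ** n = mat 1"
      using m(1) by (simp add: adj2_mult mat_mult_mat2)
  qed
  define \<phi>1 where "\<phi>1 = (\<lambda>x. m ** \<phi> x ** n)"
  have \<phi>1: "SL2_mono \<phi>1"
    unfolding \<phi>1_def by (rule SL2_mono_conj[OF \<phi> mn])
  note s1 = SL2_mono_simps[OF \<phi>1]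
  have u1: "\<phi>1 (upper1 1) = upper1 1"
    unfolding \<phi>1_def U_def[symmetric] m(2) by (simp add: mn flip: matrix_mul_assoc)
  define f where "f x = \<phi>1 (upper1 x) $ 1 $ 2" for x
  \<comment> \<open>The image commutes with \<open>upper1 1\<close>, which \<open>\<phi>1\<close>
    now fixes, and its p-th power is 1.\<close>
  have f: "\<phi>1 (upper1 x) = upper1 (f x)" for x
    unfolding f_def
  proof (rule centralizer_upper1[OF p])
    have "upper1 x ** upper1 1 = upper1 1 ** upper1 x"
      by (simp add: mat2_eq_iff mult2_nth)
    hence "\<phi>1 (upper1 x) ** \<phi>1 (upper1 1) = \<phi>1 (upper1 1) ** \<phi>1 (upper1 x)"
      by (simp flip: s1(2))
    thus "\<phi>1 (upper1 x) ** upper1 1 = upper1 1 ** \<phi>1 (upper1 x)"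
      by (simp add: u1)
    show "\<phi>1 (upper1 x) [^]\<^bsub>SL2\<^esub> CHAR('a) = mat 1"
      using s1(6)[of "upper1 x" "CHAR('a)"] s1(4) one[of x] by simp
  qed (simp add: s1)
  have f1: "f 1 = 1"
    using f[of 1] u1 by (simp add: mat2_eq_iff)
  have "inj f"
  proof (rule injI)
    fix x y assume "f x = f y"
    hence "\<phi>1 (upper1 x) = \<phi>1 (upper1 y)"
      by (simp add: f)
    hence "upper1 x = upper1 y"
      by (simp add: s1(3))
    thus "x = y"
      by (simp add: mat2_eq_iff)
  qed
  hence surj: "surj f"
    by (simp add: finite_UNIV_inj_surj)
  define w :: "'a ^ 2 ^ 2" where "w = mat2 0 1 (- 1) 0"
  have w: "w \<in> carrier SL2"
    by (simp add: w_def SL2_iff det_2)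
  define W where "W = \<phi>1 w"
  have W: "W \<in> carrier SL2" "det W = 1"
    using s1(1)[OF w] by (simp_all add: W_def SL2_iff)
  \<comment> \<open>Otherwise \<open>w ** upper1 1 ** adj2 w\<close>, which is not upper triangular,
    would have an upper unitriangular image. By surjectivity of \<open>f\<close> that image is also
    the image of some \<open>upper1 y\<close>, contradicting injectivity.\<close>
  have c: "W $ 2 $ 1 \<noteq> 0"
  proof
    assume c0: "W $ 2 $ 1 = 0"
    obtain y where y: "f y = W $ 1 $ 1 * W $ 1 $ 1"
      using surj by (metis surjD)
    have "W ** upper1 1 ** adj2 W = upper1 (f y)"
      by (simp add: mat2_eq_iff conj_upper1_nth c0 y W)
    hence "\<phi>1 (w ** upper1 1 ** adj2 w) = \<phi>1 (upper1 y)"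
      using w adj2_inverse(3)[OF w] by (simp add: s1 mult_in_SL2 f f1 W_def)
    moreover have "w ** upper1 1 ** adj2 w \<in> carrier SL2"
      using w adj2_inverse(3)[OF w] by (simp add: mult_in_SL2)
    ultimately have "w ** upper1 1 ** adj2 w = upper1 y"
      using s1(3) upper1_in_SL2 by blast
    hence "(w ** upper1 1 ** adj2 w) $ 2 $ 1 = 0"
      by simp
    thus False
      by (simp add: conj_upper1_nth) (simp add: w_def)
  qed
  \<comment> \<open>Conjugation by \<open>upper1 (- s)\<close> clears the upper-left entry of
    \<open>W\<close> and commutes with all \<open>upper1 x\<close>, so \<open>f\<close> stays the
    same.\<close>
  define s where "s = W $ 1 $ 1 / W $ 2 $ 1"
  define \<phi>2 where "\<phi>2 = (\<lambda>x. upper1 (- s) ** \<phi>1 x ** upper1 s)"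
  have s: "upper1 (- s) ** upper1 s = mat 1" "upper1 s ** upper1 (- s) = mat 1"
    by (simp_all add: mat2_eq_iff mult2_nth)
  have \<phi>2: "SL2_mono \<phi>2"
    unfolding \<phi>2_def by (rule SL2_mono_conj[OF \<phi>1 s])
  have u2: "\<phi>2 (upper1 x) = upper1 (f x)" for x
    by (simp add: \<phi>2_def f mat2_eq_iff mult2_nth)
  have W2: "\<phi>2 (mat2 0 1 (- 1) 0) $ 1 $ 1 = 0"
    unfolding \<phi>2_def w_def[symmetric] W_def[symmetric] using c by (simp add: mult2_nth s_def)
  note fa = SL2_mono_normalized(1)[where f = f, OF \<phi>2 u2 f1 W2]
  note eq = SL2_mono_normalized(2)[where f = f, OF \<phi>2 u2 f1 W2]
  \<comment> \<open>These undo the two conjugations by \<open>m\<close> and by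
    \<open>upper1 (- s)\<close>.\<close>
  define a b where "a = n ** upper1 s" and "b = upper1 (- s) ** m"
  have ba: "a ** b = mat 1"
  proof -
    have "a ** b = n ** (upper1 s ** upper1 (- s)) ** m"
      by (simp add: a_def b_def matrix_mul_assoc)
    thus ?thesis
      by (simp add: s mn)
  qed
  have "det a * det b = 1"
    using ba by (metis det_mul det_mat1)
  moreover have "\<phi> x = a ** map_matrix f x ** b" if "x \<in> carrier SL2" for x
  proof -
    have "a ** \<phi>2 x ** b = n ** (upper1 s ** upper1 (- s)) ** m ** \<phi> x ** n ** (upper1 s ** upper1 (- s)) ** m"
      unfolding a_def b_def \<phi>2_def \<phi>1_def by (simp only: matrix_mul_assoc)
    also have "\<dots> = \<phi> x ** (n ** m)"
      by (simp add: s mn flip: matrix_mul_assoc)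
    finally show ?thesis
      using eq[OF that] by (simp add: mn)
  qed
  ultimately show ?thesis
    using fa by blast
qed

theorem auto_SL2_semilinear:
  assumes "prime CHAR('a::{field,finite})"
  shows "auto SL2 \<subseteq> (semilinear_maps :: ('a ^ 2 ^ 2 \<Rightarrow> 'a ^ 2 ^ 2) set)"
proof
  fix \<phi> :: "'a ^ 2 ^ 2 \<Rightarrow> 'a ^ 2 ^ 2" assume "\<phi> \<in> auto SL2"
  hence \<phi>: "\<phi> \<in> hom SL2 SL2" "\<phi> \<in> extensional (carrier SL2)" "bij_betw \<phi> (carrier SL2) (carrier SL2)"
    by (auto simp: auto_def Bij_def)
  hence "SL2_mono \<phi>"
    by (auto simp: SL2_mono_def hom_def bij_betw_def)
  then obtain a \<alpha> b where a: "\<alpha> \<in> field_auts" "det a * det b = 1"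
      "\<forall>x\<in>carrier SL2. \<phi> x = a ** map_matrix \<alpha> x ** b"
    using SL2_mono_semilinear[OF _ assms] by blast
  have "\<phi> = lin a \<alpha> b"
    by (rule extensionalityI[OF \<phi>(2)]) (use a in \<open>auto simp: lin_def\<close>)
  thus "\<phi> \<in> semilinear_maps"
    using a by (auto simp: semilinear_maps_def)
qed


section \<open>Stabilizers\<close>

text \<open>Left multiplication by \<open>upper1 t\<close> adds t times the second row to the first.
  Conversely, if x and g share the second row, \<open>x ** adj2 g\<close> has second row (0, 1), and
  determinant 1 makes it unitriangular.\<close>

lemma row_coset:
  fixes g :: "'a::field ^ 2 ^ 2"
  assumes g: "g \<in> carrier SL2"
  shows "Tgrp #>\<^bsub>SL2\<^esub> g = {x \<in> carrier SL2. x $ 2 $ 1 = g $ 2 $ 1 \<and> x $ 2 $ 2 = g $ 2 $ 2}"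
proof -
  have T: "Tgrp = range (upper1 :: 'a \<Rightarrow> _)"
    by (auto simp: Tgrp_def upper1_def mat2_def)
  have "\<exists>t. x = upper1 t ** g" if x: "x \<in> carrier SL2" "x $ 2 $ 1 = g $ 2 $ 1" "x $ 2 $ 2 = g $ 2 $ 2" for x
  proof -
    define y where "y = x ** adj2 g"
    have "y $ 2 $ 1 = 0" "y $ 2 $ 2 = 1"
      using x g by (simp_all add: y_def mult2_nth SL2_iff det_2 algebra_simps)
    moreover have "y \<in> carrier SL2"
      unfolding y_def using x(1) adj2_inverse(3)[OF g] by (rule mult_in_SL2)
    ultimately have "y = upper1 (y $ 1 $ 2)"
      by (simp add: mat2_eq_iff SL2_iff det_2)
    moreover have "y ** g = x"
      by (simp add: y_def adj2_inverse(1)[OF g] flip: matrix_mul_assoc)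
    ultimately show ?thesis
      by metis
  qed
  thus ?thesis
    unfolding T r_coset_def using g by (auto simp: mult_in_SL2 mult2_nth)
qed

lemma column_coset:
  fixes g :: "'a::field ^ 2 ^ 2"
  assumes g: "g \<in> carrier SL2"
  shows "g <#\<^bsub>SL2\<^esub> Tgrp = {x \<in> carrier SL2. x $ 1 $ 1 = g $ 1 $ 1 \<and> x $ 2 $ 1 = g $ 2 $ 1}"
proof -
  have T: "Tgrp = range (upper1 :: 'a \<Rightarrow> _)"
    by (auto simp: Tgrp_def upper1_def mat2_def)
  have "\<exists>t. x = g ** upper1 t" if x: "x \<in> carrier SL2" "x $ 1 $ 1 = g $ 1 $ 1" "x $ 2 $ 1 = g $ 2 $ 1" for x
  proof -
    define y where "y = adj2 g ** x"
    have "y $ 2 $ 1 = 0" "y $ 1 $ 1 = 1"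
      using x g by (simp_all add: y_def mult2_nth SL2_iff det_2 algebra_simps)
    moreover have "y \<in> carrier SL2"
      unfolding y_def using adj2_inverse(3)[OF g] x(1) by (rule mult_in_SL2)
    ultimately have "y = upper1 (y $ 1 $ 2)"
      by (simp add: mat2_eq_iff SL2_iff det_2)
    moreover have "g ** y = x"
      by (simp add: y_def adj2_inverse(2)[OF g] matrix_mul_assoc)
    ultimately show ?thesis
      by metis
  qed
  thus ?thesis
    unfolding T l_coset_def using g by (auto simp: mult_in_SL2 mult2_nth)
qed

text \<open>Both kinds of cosets have a constant lower-left entry, so the subfield test does not
  depend on the representative g.\<close>

lemma Acls_alt:
  "Acls q = {{x \<in> carrier SL2. x $ 2 $ 1 = g $ 2 $ 1 \<and> x $ 2 $ 2 = g $ 2 $ 2} | g. g \<in> carrier SL2 \<and> (g $ 2 $ 1) ^ q = g $ 2 $ 1} \<union>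
    {{x \<in> carrier SL2. x $ 1 $ 1 = g $ 1 $ 1 \<and> x $ 2 $ 1 = g $ 2 $ 1} | g. g \<in> carrier SL2 \<and> (g $ 2 $ 1) ^ q \<noteq> g $ 2 $ 1}"
  (is "_ = ?R \<union> ?C")
proof -
  have "(\<lambda>g. Tgrp #>\<^bsub>SL2\<^esub> g) ` Omega q = (\<lambda>g. {x \<in> carrier SL2. x $ 2 $ 1 = g $ 2 $ 1 \<and> x $ 2 $ 2 = g $ 2 $ 2}) ` Omega q"
    by (rule image_cong) (auto simp: Omega_def row_coset)
  hence "{Tgrp #>\<^bsub>SL2\<^esub> g | g. g \<in> Omega q} = ?R"
    unfolding Omega_def subfield_q_def by blast
  moreover have "(\<lambda>g. g <#\<^bsub>SL2\<^esub> Tgrp) ` (carrier SL2 - Omega q) =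
      (\<lambda>g. {x \<in> carrier SL2. x $ 1 $ 1 = g $ 1 $ 1 \<and> x $ 2 $ 1 = g $ 2 $ 1}) ` (carrier SL2 - Omega q)"
    by (rule image_cong) (auto simp: column_coset)
  hence "{g <#\<^bsub>SL2\<^esub> Tgrp | g. g \<in> carrier SL2 - Omega q} = ?C"
    unfolding Omega_def subfield_q_def by blast
  ultimately show ?thesis
    by (simp add: Acls_def)
qed

text \<open>Respecting both partitions in both directions, f maps the coset of g onto the coset of
  \<open>f g\<close> of the same kind; the last assumption keeps the choice between the kinds. Meant
  for field automorphisms and the sign change.\<close>

lemma Acls_invariant:
  fixes f :: "'a::field ^ 2 ^ 2 \<Rightarrow> 'a ^ 2 ^ 2"
  assumes f: "f \<in> Bij (carrier SL2)"
    and row: "\<And>x y. x \<in> carrier SL2 \<Longrightarrow> y \<in> carrier SL2 \<Longrightarrow>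
      f x $ 2 $ 1 = f y $ 2 $ 1 \<and> f x $ 2 $ 2 = f y $ 2 $ 2 \<longleftrightarrow> x $ 2 $ 1 = y $ 2 $ 1 \<and> x $ 2 $ 2 = y $ 2 $ 2"
    and col: "\<And>x y. x \<in> carrier SL2 \<Longrightarrow> y \<in> carrier SL2 \<Longrightarrow>
      f x $ 1 $ 1 = f y $ 1 $ 1 \<and> f x $ 2 $ 1 = f y $ 2 $ 1 \<longleftrightarrow> x $ 1 $ 1 = y $ 1 $ 1 \<and> x $ 2 $ 1 = y $ 2 $ 1"
    and fixd: "\<And>x. x \<in> carrier SL2 \<Longrightarrow> (f x $ 2 $ 1) ^ q = f x $ 2 $ 1 \<longleftrightarrow> (x $ 2 $ 1) ^ q = x $ 2 $ 1"
  shows "act_class (Acls q) f = Acls q"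
proof -
  define R where "R g = {x \<in> carrier SL2. x $ 2 $ 1 = g $ 2 $ 1 \<and> x $ 2 $ 2 = g $ 2 $ 2}" for g :: "'a ^ 2 ^ 2"
  define C where "C g = {x \<in> carrier SL2. x $ 1 $ 1 = g $ 1 $ 1 \<and> x $ 2 $ 1 = g $ 2 $ 1}" for g :: "'a ^ 2 ^ 2"
  have img: "f ` carrier SL2 = carrier SL2"
    using f by (auto simp: Bij_def bij_betw_def)
  have in_SL2: "f x \<in> carrier SL2" if "x \<in> carrier SL2" for x
    using img that by blast
  have fR: "f ` R g = R (f g)" if "g \<in> carrier SL2" for g
  proof
    show "f ` R g \<subseteq> R (f g)"
      using that row in_SL2 unfolding R_def by blast
    show "R (f g) \<subseteq> f ` R g"
    proof
      fix y assume y: "y \<in> R (f g)"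
      then obtain x where "x \<in> carrier SL2" "y = f x"
        using img unfolding R_def by blast
      thus "y \<in> f ` R g"
        using y that row unfolding R_def by blast
    qed
  qed
  have fC: "f ` C g = C (f g)" if "g \<in> carrier SL2" for g
  proof
    show "f ` C g \<subseteq> C (f g)"
      using that col in_SL2 unfolding C_def by blast
    show "C (f g) \<subseteq> f ` C g"
    proof
      fix y assume y: "y \<in> C (f g)"
      then obtain x where "x \<in> carrier SL2" "y = f x"
        using img unfolding C_def by blast
      thus "y \<in> f ` C g"
        using y that col unfolding C_def by blast
    qed
  qed
  have A: "Acls q = R ` {g \<in> carrier SL2. (g $ 2 $ 1) ^ q = g $ 2 $ 1} \<union> C ` {g \<in> carrier SL2. (g $ 2 $ 1) ^ q \<noteq> g $ 2 $ 1}"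
    unfolding Acls_alt R_def C_def by blast
  have inv: "f ` {g \<in> carrier SL2. P g} = {g \<in> carrier SL2. P g}"
    if "\<And>x. x \<in> carrier SL2 \<Longrightarrow> P (f x) \<longleftrightarrow> P x" for P
  proof -
    have "f ` {g \<in> carrier SL2. P g} = {y \<in> f ` carrier SL2. P y}"
      using that by auto
    thus ?thesis
      by (simp only: img)
  qed
  note s1 = inv[of "\<lambda>g. (g $ 2 $ 1) ^ q = g $ 2 $ 1"] and s2 = inv[of "\<lambda>g. (g $ 2 $ 1) ^ q \<noteq> g $ 2 $ 1"]
  have "act_class (Acls q) f =
      (\<lambda>g. R (f g)) ` {g \<in> carrier SL2. (g $ 2 $ 1) ^ q = g $ 2 $ 1} \<union>
      (\<lambda>g. C (f g)) ` {g \<in> carrier SL2. (g $ 2 $ 1) ^ q \<noteq> g $ 2 $ 1}"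
    unfolding act_class_def A image_Un image_image
    by (intro arg_cong2[where f = "(\<union>)"] image_cong refl) (auto simp: fR fC)
  also have "\<dots> = R ` (f ` {g \<in> carrier SL2. (g $ 2 $ 1) ^ q = g $ 2 $ 1}) \<union>
      C ` (f ` {g \<in> carrier SL2. (g $ 2 $ 1) ^ q \<noteq> g $ 2 $ 1})"
    by (simp add: image_image)
  also have "\<dots> = Acls q"
    unfolding A by (simp add: s1 s2 fixd)
  finally show ?thesis .
qed

lemma Acls_subset: "X \<in> Acls q \<Longrightarrow> X \<subseteq> carrier SL2"
  unfolding Acls_alt by blast

lemma Acls_entries:
  assumes "X \<in> Acls q" "x \<in> X" "y \<in> X"
  shows "x $ 2 $ 1 = y $ 2 $ 1"
    and "(x $ 2 $ 1) ^ q \<noteq> x $ 2 $ 1 \<Longrightarrow> x $ 1 $ 1 = y $ 1 $ 1"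
  using assms unfolding Acls_alt by auto

text \<open>Two elements of one coset are compared after the map: their lower-left entries must
  agree, and outside the subfield their upper-left entries too. Each comparison makes a product of
  entries of \<open>m\<close> and \<open>n\<close> vanish.\<close>

lemma Acls_preserved:
  fixes m n :: "'a::field ^ 2 ^ 2"
  assumes q: "q > 0" and ex: "\<exists>y::'a. y ^ q \<noteq> y"
    and mn: "det m * det n = 1"
    and pres: "\<And>X. X \<in> Acls q \<Longrightarrow> lin m id n ` X \<in> Acls q"
  shows "m $ 2 $ 1 = 0" "n $ 2 $ 1 = 0" "(m $ 2 $ 2 * n $ 1 $ 1) ^ q = m $ 2 $ 2 * n $ 1 $ 1"
proof -
  have nz: "m $ 1 $ 1 * m $ 2 $ 2 - m $ 1 $ 2 * m $ 2 $ 1 \<noteq> 0" "n $ 1 $ 1 * n $ 2 $ 2 - n $ 1 $ 2 * n $ 2 $ 1 \<noteq> 0"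
    using mn by (auto simp: det_2)
  have row: "m ** x ** n \<in> lin m id n ` {x \<in> carrier SL2. x $ 2 $ 1 = g $ 2 $ 1 \<and> x $ 2 $ 2 = g $ 2 $ 2}"
    if "x \<in> carrier SL2" "x $ 2 $ 1 = g $ 2 $ 1" "x $ 2 $ 2 = g $ 2 $ 2" for x g :: "'a ^ 2 ^ 2"
    using that by (auto intro!: rev_image_eqI[of x])
  have col: "m ** x ** n \<in> lin m id n ` {x \<in> carrier SL2. x $ 1 $ 1 = g $ 1 $ 1 \<and> x $ 2 $ 1 = g $ 2 $ 1}"
    if "x \<in> carrier SL2" "x $ 1 $ 1 = g $ 1 $ 1" "x $ 2 $ 1 = g $ 2 $ 1" for x g :: "'a ^ 2 ^ 2"
    using that by (auto intro!: rev_image_eqI[of x])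
  have rowA: "lin m id n ` {x \<in> carrier SL2. x $ 2 $ 1 = g $ 2 $ 1 \<and> x $ 2 $ 2 = g $ 2 $ 2} \<in> Acls q"
    if "g \<in> carrier SL2" "(g $ 2 $ 1) ^ q = g $ 2 $ 1" for g
    by (rule pres) (use that in \<open>auto simp: Acls_alt\<close>)
  have colA: "lin m id n ` {x \<in> carrier SL2. x $ 1 $ 1 = g $ 1 $ 1 \<and> x $ 2 $ 1 = g $ 2 $ 1} \<in> Acls q"
    if "g \<in> carrier SL2" "(g $ 2 $ 1) ^ q \<noteq> g $ 2 $ 1" for g
    by (rule pres) (use that in \<open>auto simp: Acls_alt\<close>)
  have rowe: "m $ 2 $ 1 * (g $ 2 $ 1 * n $ 1 $ 1 + g $ 2 $ 2 * n $ 2 $ 1) = 0"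
    if g: "g \<in> carrier SL2" "(g $ 2 $ 1) ^ q = g $ 2 $ 1" for g
  proof -
    have "(m ** (upper1 1 ** g) ** n) $ 2 $ 1 = (m ** g ** n) $ 2 $ 1"
      by (rule Acls_entries(1)[OF rowA[OF g] row row]) (use g in \<open>simp_all add: mult_in_SL2 mult2_nth\<close>)
    thus ?thesis
      by (simp add: mult2_nth algebra_simps)
  qed
  \<comment> \<open>The second rows (0,1) and (1,0) isolate the two entries of the first column of
    \<open>n\<close>, which is not zero.\<close>
  have "m $ 2 $ 1 * n $ 2 $ 1 = 0"
    using rowe[of "mat 1"] q by (simp add: power_0_left)
  moreover have "m $ 2 $ 1 * n $ 1 $ 1 = 0"
    using rowe[of "mat2 0 (- 1) 1 0"] by (simp add: SL2_iff det_2)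
  ultimately show m21: "m $ 2 $ 1 = 0"
    using nz(2) by auto
  \<comment> \<open>With c outside the subfield, \<open>lower1 c\<close> represents a left coset, so
    multiplying it by \<open>upper1 1\<close> on the right stays inside.\<close>
  obtain c :: 'a where c: "c ^ q \<noteq> c"
    using ex by blast
  hence c0: "c \<noteq> 0"
    using q by (auto simp: power_0_left)
  have "(m ** (lower1 c ** upper1 1) ** n) $ 2 $ 1 = (m ** lower1 c ** n) $ 2 $ 1"
    by (rule Acls_entries(1)[OF colA[of "lower1 c"] col col])
       (use c in \<open>simp_all add: mult_in_SL2 mult2_nth\<close>)
  hence "m $ 2 $ 2 * c * n $ 2 $ 1 = 0"
    by (simp add: mult2_nth m21 algebra_simps)
  moreover have "m $ 2 $ 2 \<noteq> 0" "m $ 1 $ 1 \<noteq> 0"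
    using nz(1) m21 by auto
  ultimately show n21: "n $ 2 $ 1 = 0"
    using c0 by simp
  hence "n $ 1 $ 1 \<noteq> 0"
    using nz(2) by auto
  show "(m $ 2 $ 2 * n $ 1 $ 1) ^ q = m $ 2 $ 2 * n $ 1 $ 1"
  proof (rule ccontr)
    \<comment> \<open>The image of the row coset of \<open>lower1 1\<close> would then be a column
      coset with constant upper-left entry; but passing to \<open>upper1 1 ** lower1 1\<close>
      changes that entry by \<open>m $ 1 $ 1 * n $ 1 $ 1\<close>.\<close>
    assume ne: "\<not> ?thesis"
    have e: "(m ** lower1 1 ** n) $ 2 $ 1 = m $ 2 $ 2 * n $ 1 $ 1"
      by (simp add: mult2_nth m21 n21)
    have "(m ** lower1 1 ** n) $ 1 $ 1 = (m ** (upper1 1 ** lower1 1) ** n) $ 1 $ 1"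
      by (rule Acls_entries(2)[OF rowA[of "lower1 1"] row row])
         (use ne e in \<open>simp_all add: mult_in_SL2 mult2_nth\<close>)
    hence "m $ 1 $ 1 * n $ 1 $ 1 = 0"
      by (simp add: mult2_nth n21 algebra_simps)
    thus False
      using \<open>m $ 1 $ 1 \<noteq> 0\<close> \<open>n $ 1 $ 1 \<noteq> 0\<close> by simp
  qed
qed

section \<open>Induced actions on classes and parallelisms\<close>

lemma act_class_mult:
  assumes "f \<in> carrier SymSL" "g \<in> carrier SymSL" "B \<subseteq> Pow (carrier SL2)"
  shows "act_class (act_class B f) g = act_class B (f \<otimes>\<^bsub>SymSL\<^esub> g)"
proof -
  \<comment> \<open>Products in \<open>SymSL\<close> are restricted to the carrier, so
    \<open>X\<close> has to lie inside it.\<close>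
  have "g ` f ` X = (f \<otimes>\<^bsub>SymSL\<^esub> g) ` X" if "X \<in> B" for X
    unfolding image_image
    by (rule image_cong) (use assms that in \<open>auto simp: carrier_SymSL mult_SymSL compose_def\<close>)
  hence "(\<lambda>X. g ` f ` X) ` B = (\<lambda>X. (f \<otimes>\<^bsub>SymSL\<^esub> g) ` X) ` B"
    by (rule image_cong[OF refl])
  thus ?thesis
    by (simp add: act_class_def image_comp comp_def)
qed

lemma act_par_mult:
  assumes "f \<in> carrier SymSL" "g \<in> carrier SymSL" "\<pi> \<subseteq> Pow (Pow (carrier SL2))"
  shows "act_par (act_par \<pi> f) g = act_par \<pi> (f \<otimes>\<^bsub>SymSL\<^esub> g)"
proof -
  have "act_class (act_class B f) g = act_class B (f \<otimes>\<^bsub>SymSL\<^esub> g)" if "B \<in> \<pi>" for B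
    by (rule act_class_mult) (use assms that in auto)
  hence "(\<lambda>B. act_class (act_class B f) g) ` \<pi> = (\<lambda>B. act_class B (f \<otimes>\<^bsub>SymSL\<^esub> g)) ` \<pi>"
    by (rule image_cong[OF refl])
  thus ?thesis
    by (simp add: act_par_def image_comp comp_def)
qed

lemma act_class_one:
  assumes "B \<subseteq> Pow (carrier SL2)"
  shows "act_class B \<one>\<^bsub>SymSL\<^esub> = B"
proof -
  have "(\<one>\<^bsub>SymSL\<^esub> ` X) = X" if "X \<in> B" for X :: "('a::field ^ 2 ^ 2) set"
    using that assms by (force simp: one_SymSL)
  thus ?thesis
    unfolding act_class_def by simp
qed

lemma act_par_one:
  assumes "\<pi> \<subseteq> Pow (Pow (carrier SL2))"
  shows "act_par \<pi> \<one>\<^bsub>SymSL\<^esub> = \<pi>"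
proof -
  have "act_class B \<one>\<^bsub>SymSL\<^esub> = B" if "B \<in> \<pi>" for B :: "('a::field ^ 2 ^ 2) set set"
    using that assms by (intro act_class_one) auto
  thus ?thesis
    unfolding act_par_def by simp
qed

lemma act_class_subset:
  assumes "f \<in> carrier SymSL" "B \<subseteq> Pow (carrier SL2)"
  shows "act_class B f \<subseteq> Pow (carrier SL2)"
  using assms Bij_imp_funcset[of f] unfolding act_class_def carrier_SymSL by fastforce

text \<open>For the inclusion from right to left, x \<mapsto> a \<alpha>(x) b is the automorphism x
  \<mapsto> a \<alpha>(x) a^-1 followed by right translation by a b, which has determinant 1
  although a and b need not.\<close>

lemma AutR_eq:
  assumes "prime CHAR('a::{field,finite})"
  shows "AutR = (semilinear_maps :: ('a ^ 2 ^ 2 \<Rightarrow> 'a ^ 2 ^ 2) set)"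
proof -
  interpret S: group "SymSL :: ('a ^ 2 ^ 2 \<Rightarrow> 'a ^ 2 ^ 2) monoid"
    by (rule group_SymSL)
  have sub: "auto SL2 \<union> {rho h | h. h \<in> carrier SL2} \<subseteq> (semilinear_maps :: ('a ^ 2 ^ 2 \<Rightarrow> 'a ^ 2 ^ 2) set)"
  proof -
    have "rho h \<in> semilinear_maps" if "h \<in> carrier SL2" for h :: "'a ^ 2 ^ 2"
      using that id_field_auts by (force simp: rho_lin semilinear_maps_def SL2_iff)
    thus ?thesis
      using auto_SL2_semilinear[OF assms] by auto
  qed
  have "lin a \<alpha> b \<in> AutR" if \<alpha>: "\<alpha> \<in> field_auts" and ab: "det a * det b = 1" for a b :: "'a ^ 2 ^ 2" and \<alpha>
  proof -
    define d where "d = det b"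
    \<comment> \<open>The inverse of \<open>a\<close>, since det b is the reciprocal of det
      a.\<close>
    define c where "c = mat d ** adj2 a"
    have da: "d * det a = 1"
      using ab by (simp add: d_def mult.commute)
    have ca: "c ** a = mat 1" and ac: "a ** c = mat 1"
    proof -
      have "c ** a = mat d ** (adj2 a ** a)"
        by (simp add: c_def matrix_mul_assoc)
      thus "c ** a = mat 1"
        using da by (simp add: adj2_mult mat_mult_mat2)
      have "a ** c = (a ** adj2 a) ** mat d"
        unfolding c_def mat_mult2_commute[of d] by (simp add: matrix_mul_assoc)
      thus "a ** c = mat 1"
        using da by (simp add: adj2_mult mat_mult_mat2 mult.commute)
    qed
    have dac: "det a * det c = 1"
      using ac by (metis det_mul det_mat1)
    have hom: "lin a \<alpha> c \<in> hom SL2 SL2"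
    proof (rule homI)
      fix x y :: "'a ^ 2 ^ 2" assume xy: "x \<in> carrier SL2" "y \<in> carrier SL2"
      have "a ** map_matrix \<alpha> x ** c ** (a ** map_matrix \<alpha> y ** c) = a ** map_matrix \<alpha> x ** (c ** a) ** map_matrix \<alpha> y ** c"
        by (simp add: matrix_mul_assoc)
      thus "lin a \<alpha> c (x \<otimes>\<^bsub>SL2\<^esub> y) = lin a \<alpha> c x \<otimes>\<^bsub>SL2\<^esub> lin a \<alpha> c y"
        using xy by (simp add: mult_in_SL2 ca map_matrix_mult[OF \<alpha>] matrix_mul_assoc)
    qed (use lin_closed[OF \<alpha> dac] in simp)
    have "lin a \<alpha> c \<in> auto SL2"
      using hom lin_in_Bij[OF \<alpha> dac] by (simp add: auto_def)
    moreover have "det (a ** b) = 1"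
      using ab by (simp add: det_mul)
    moreover have "lin a \<alpha> b = lin a \<alpha> c \<otimes>\<^bsub>SymSL\<^esub> rho (a ** b)"
    proof -
      have "c ** (a ** b) = b"
        by (simp add: matrix_mul_assoc ca)
      thus ?thesis
        unfolding rho_lin using \<open>det (a ** b) = 1\<close>
        by (subst mult_lin[OF \<alpha> dac id_field_auts]) simp_all
    qed
    ultimately show ?thesis
      unfolding AutR_def SL2_iff[symmetric] by (auto intro!: generate.eng intro: generate.incl)
  qed
  hence "(semilinear_maps :: ('a ^ 2 ^ 2 \<Rightarrow> 'a ^ 2 ^ 2) set) \<subseteq> AutR"
    unfolding semilinear_maps_def by blast
  moreover have "AutR \<subseteq> (semilinear_maps :: ('a ^ 2 ^ 2 \<Rightarrow> 'a ^ 2 ^ 2) set)"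
    unfolding AutR_def by (rule S.generate_subgroup_incl[OF sub subgroup_semilinear_maps])
  ultimately show ?thesis
    by blast
qed

section \<open>The field with q^2 elements and the linear part of the stabilizer\<close>

locale square_field =
  fixes p e q :: nat and F :: "'a::{field,finite} itself"
  assumes prime: "prime p" and e: "e \<ge> 1" and q: "q = p ^ e" and card: "CARD('a) = q ^ 2"
begin

lemma card_p: "CARD('a) = p ^ (2 * e)"
  using card q by (simp add: mult.commute flip: power_mult)

lemma CHAR_p: "CHAR('a) = p"
  by (rule CHAR_finite_field[OF prime card_p])

lemma q_gt_1: "q > 1"
  unfolding q using prime_gt_1_nat[OF prime] e by (intro one_less_power) auto

lemma frob: "(\<lambda>y::'a. y ^ q) \<in> field_auts"
  using frobenius_power_field_auts[where ?'a = 'a, of e] prime unfolding q CHAR_p by simp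

lemma frob_frob: "((y::'a) ^ q) ^ q = y"
  using power_CARD_finite_field[of y] unfolding card by (simp add: power2_eq_square flip: power_mult)

lemma ex_not_fixed: "\<exists>y::'a. y ^ q \<noteq> y"
  using q_gt_1 card by (intro ex_power_not_fixed) (auto simp: power2_eq_square)

lemma bar_simps:
  fixes A B :: "'a ^ 2 ^ 2"
  shows "bar q (A ** B) = bar q A ** bar q B" "det (bar q A) = (det A) ^ q"
    "bar q (adj2 A) = adj2 (bar q A)" "bar q (mat k) = (mat (k ^ q) :: 'a ^ 2 ^ 2)" "bar q (- A) = - bar q A"
    "bar q A $ i $ j = (A $ i $ j) ^ q"
  unfolding bar_def
  by (simp_all add: map_matrix_mult[OF frob] det_map_matrix[OF frob] map_matrix_adj2[OF frob]
      map_matrix_mat[OF frob] map_matrix_uminus[OF frob])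

lemma bar_in_SL2: "h \<in> carrier SL2 \<Longrightarrow> bar q h \<in> carrier SL2" for h :: "'a ^ 2 ^ 2"
  by (simp add: SL2_iff bar_simps)

lemma det_theta: "h \<in> carrier SL2 \<Longrightarrow> det h * det (bar q h) = 1" for h :: "'a ^ 2 ^ 2"
  by (simp add: SL2_iff bar_simps)

lemma theta_in_SymSL: "h \<in> carrier SL2 \<Longrightarrow> theta q h \<in> carrier SymSL" for h :: "'a ^ 2 ^ 2"
  by (simp add: theta_lin lin_in_SymSL[OF id_field_auts] det_theta)

text \<open>Because permutations compose from left to right and inversion reverses products,
  \<open>theta q\<close> is a homomorphism, not an anti-homomorphism.\<close>

lemma theta_mult:
  fixes h k :: "'a ^ 2 ^ 2"
  assumes "h \<in> carrier SL2" "k \<in> carrier SL2"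
  shows "theta q h \<otimes>\<^bsub>SymSL\<^esub> theta q k = theta q (h ** k)"
  using assms
  by (simp add: theta_lin mult_lin id_field_auts det_theta mult_in_SL2 adj2_mult_distrib bar_simps(1))

lemma pi_sq_subset: "pi_sq q \<subseteq> Pow (Pow (carrier (SL2 :: ('a ^ 2 ^ 2) monoid)))"
proof -
  have "Acls q \<subseteq> Pow (carrier (SL2 :: ('a ^ 2 ^ 2) monoid))"
    using Acls_subset by blast
  thus ?thesis
    unfolding pi_sq_def using act_class_subset theta_in_SymSL by blast
qed

text \<open>The two relations between \<open>\<mu>\<close> and \<open>d\<close> turn Euler's criterion for \<open>d\<close> into
  \<open>\<mu> ^ (q + 1) = 1\<close>.\<close>

lemma square_of_norm_condition:
  fixes d \<mu> :: 'a
  assumes "d \<noteq> 0" "\<mu>\<^sup>2 * d = d ^ q" "\<mu> * \<mu> ^ q = 1"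
  shows "\<exists>\<nu>. d = \<nu>\<^sup>2"
proof (cases "even q")
  case True
  hence "even p"
    unfolding q by simp
  hence "p = 2"
    using prime prime_odd_nat prime_ge_2_nat by (metis le_neq_implies_less)
  hence "of_nat 2 = (0::'a)"
    using CHAR_p of_nat_CHAR[where ?'a = 'a] by simp
  hence "(1::'a) + 1 = 0"
    by simp
  thus ?thesis
    by (rule finite_field_square_char_2)
next
  case False
  then obtain i where i: "q = 2 * i + 1"
    by (elim oddE)
  have "d * d ^ (2 * i) = \<mu>\<^sup>2 * d"
    using assms(2) i by auto
  hence "d ^ (2 * i) = \<mu>\<^sup>2"
    using assms(1) by (auto simp: mult.commute)
  \<comment> \<open>For q = 2 i + 1 the exponents 2 i (i + 1) and 2 (i + 1) are (q^2 - 1) / 2 and q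
    + 1.\<close>
  hence "d ^ (2 * i * (i + 1)) = \<mu> ^ (2 * (i + 1))"
    by (simp only: power_mult)
  also have "\<dots> = \<mu> * \<mu> ^ q"
    using i by simp
  finally have "d ^ (2 * i * (i + 1)) = 1"
    using assms(3) by simp
  moreover have "CARD('a) = 2 * (2 * i * (i + 1)) + 1"
    unfolding card i by (simp add: power2_eq_square)
  ultimately show ?thesis
    by (intro euler_criterion_finite_field)
qed

lemma pi_sq_stabilizer_linear:
  fixes m n :: "'a ^ 2 ^ 2"
  assumes mn: "det m * det n = 1" and stab: "act_par (pi_sq q) (lin m id n) = pi_sq q"
  shows "\<exists>h\<in>carrier SL2. lin m id n = theta q h \<or> lin m id n = theta q h \<otimes>\<^bsub>SymSL\<^esub> rho (- mat 1)"
proof -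
  interpret S: group "SymSL :: ('a ^ 2 ^ 2 \<Rightarrow> 'a ^ 2 ^ 2) monoid"
    by (rule group_SymSL)
  note lin_mn = lin_in_SymSL[OF id_field_auts mn]
  have A: "Acls q \<subseteq> Pow (carrier (SL2 :: ('a ^ 2 ^ 2) monoid))"
    using Acls_subset by blast
  have cond: "\<exists>k\<in>carrier SL2. (k ** m ** adj2 h) $ 2 $ 1 = 0 \<and> (bar q h ** n ** bar q (adj2 k)) $ 2 $ 1 = 0 \<and>
      ((k ** m ** adj2 h) $ 2 $ 2 * (bar q h ** n ** bar q (adj2 k)) $ 1 $ 1) ^ q =
       (k ** m ** adj2 h) $ 2 $ 2 * (bar q h ** n ** bar q (adj2 k)) $ 1 $ 1"
    if h: "h \<in> carrier SL2" for h
  proof -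
    have "act_class (act_class (Acls q) (theta q h)) (lin m id n) \<in> act_par (pi_sq q) (lin m id n)"
      using h unfolding act_par_def pi_sq_def by blast
    then obtain k where k: "k \<in> carrier SL2"
        "act_class (act_class (Acls q) (theta q h)) (lin m id n) = act_class (Acls q) (theta q k)"
      unfolding stab unfolding pi_sq_def by blast
    \<comment> \<open>Appending \<open>theta q ?k\<close>, the inverse of \<open>theta q k\<close>,
      turns an equality between members of \<open>pi_sq q\<close> into invariance of
      \<open>Acls q\<close>.\<close>
    let ?k = "adj2 k"
    have k': "?k \<in> carrier SL2"
      by (rule adj2_inverse(3)[OF k(1)])
    have "act_class (act_class (Acls q) (theta q h \<otimes>\<^bsub>SymSL\<^esub> lin m id n)) (theta q ?k) =
        act_class (act_class (Acls q) (theta q k)) (theta q ?k)"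
      using k(2) by (simp add: act_class_mult[OF theta_in_SymSL[OF h] lin_mn A])
    hence "act_class (Acls q) (theta q h \<otimes>\<^bsub>SymSL\<^esub> lin m id n \<otimes>\<^bsub>SymSL\<^esub> theta q ?k) =
        act_class (Acls q) (theta q k \<otimes>\<^bsub>SymSL\<^esub> theta q ?k)"
      using theta_in_SymSL[OF h] theta_in_SymSL[OF k(1)] theta_in_SymSL[OF k'] lin_mn
      by (simp add: act_class_mult[OF _ _ A])
    moreover have "theta q k \<otimes>\<^bsub>SymSL\<^esub> theta q ?k = \<one>\<^bsub>SymSL\<^esub>"
      by (simp add: theta_mult[OF k(1) k'] adj2_inverse(2)[OF k(1)] theta_lin one_SymSL_lin bar_simps)
    moreover have "theta q h \<otimes>\<^bsub>SymSL\<^esub> lin m id n \<otimes>\<^bsub>SymSL\<^esub> theta q ?k =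
        lin (k ** m ** adj2 h) id (bar q h ** n ** bar q ?k)"
      and dd: "det (k ** m ** adj2 h) * det (bar q h ** n ** bar q ?k) = 1"
      using h k(1) k' mn
      by (simp_all add: theta_lin mult_lin id_field_auts det_theta det_mul matrix_mul_assoc bar_simps SL2_iff)
    ultimately have "act_class (Acls q) (lin (k ** m ** adj2 h) id (bar q h ** n ** bar q ?k)) = Acls q"
      using act_class_one[OF A] by simp
    hence "lin (k ** m ** adj2 h) id (bar q h ** n ** bar q ?k) ` X \<in> Acls q" if "X \<in> Acls q" for X
      using that unfolding act_class_def by blast
    from Acls_preserved[OF _ ex_not_fixed dd this] k(1) q_gt_1
    show ?thesis
      by auto
  qed
  define N where "N = n ** bar q m"
  \<comment> \<open>Applying \<open>bar q\<close> to the left factor and multiplying it by the right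
    one cancels the unknown \<open>k\<close>, and a product of upper triangular matrices is upper
    triangular.\<close>
  have N21: "(bar q h ** N ** adj2 (bar q h)) $ 2 $ 1 = 0" if h: "h \<in> carrier SL2" for h
  proof -
    obtain k where k: "k \<in> carrier SL2" "(k ** m ** adj2 h) $ 2 $ 1 = 0" "(bar q h ** n ** bar q (adj2 k)) $ 2 $ 1 = 0"
      using cond[OF h] by blast
    have "bar q (adj2 k) ** bar q k = mat 1"
      using adj2_inverse(1)[OF bar_in_SL2[OF k(1)]] by (simp add: bar_simps(3))
    hence "bar q h ** N ** adj2 (bar q h) = bar q h ** n ** (bar q (adj2 k) ** bar q k) ** bar q m ** adj2 (bar q h)"
      by (simp add: N_def matrix_mul_assoc)
    also have "\<dots> = (bar q h ** n ** bar q (adj2 k)) ** bar q (k ** m ** adj2 h)"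
      by (simp add: bar_simps(1,3) matrix_mul_assoc)
    finally show ?thesis
      using k q_gt_1 by (simp only: mult2_nth[of "bar q h ** n ** bar q (adj2 k)"] bar_simps(6)) (simp add: power_0_left)
  qed
  have minus1: "(- 1 :: 'a) ^ q = - 1"
    using field_auts_simps(5)[OF frob, of 1] by simp
  \<comment> \<open>Three choices of h show that N is scalar: the identity and the Weyl element
    clear the off-diagonal entries, then \<open>lower1 1\<close> equates the diagonal ones.\<close>
  have "N $ 2 $ 1 = 0"
    using N21[of "mat 1"] by (simp add: bar_simps)
  moreover have "N $ 1 $ 2 = 0"
    using N21[of "mat2 0 1 (- 1) 0"] q_gt_1 by (simp add: SL2_iff det_2 mult2_nth bar_simps(6) minus1 power_0_left)
  moreover have "N $ 1 $ 1 = N $ 2 $ 2"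
    using N21[of "lower1 1"] calculation q_gt_1 by (simp add: mult2_nth bar_simps(6) power_0_left)
  ultimately have N: "N = mat (N $ 1 $ 1)"
    by (simp add: mat2_eq_iff)
  define \<mu> d where "\<mu> = N $ 1 $ 1" and "d = det m"
  have d0: "d \<noteq> 0"
    using mn by (auto simp: d_def)
  have "det N = \<mu>\<^sup>2"
    unfolding \<mu>_def by (subst N) simp
  hence dn: "det n * d ^ q = \<mu>\<^sup>2"
    by (simp add: N_def det_mul bar_simps d_def)
  have "\<mu>\<^sup>2 * d = (d * det n) * d ^ q"
    using dn by (simp add: mult_ac)
  hence rel1: "\<mu>\<^sup>2 * d = d ^ q"
    using mn by (simp add: d_def)
  have \<mu>0: "\<mu> \<noteq> 0"
    using rel1 d0 by auto
  \<comment> \<open>Take h = 1. Then d \<mu> is the product of \<open>X $ 2 $ 2 * Y $ 1 $ 1\<close>,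
    which lies in the subfield by the third condition, and of the norm of
    \<open>X $ 1 $ 1\<close>.\<close>
  have rel2: "(d * \<mu>) ^ q = d * \<mu>"
  proof -
    obtain k where k: "k \<in> carrier SL2" and "(k ** m ** adj2 (mat 1)) $ 2 $ 1 = 0"
      "((k ** m ** adj2 (mat 1)) $ 2 $ 2 * (bar q (mat 1) ** n ** bar q (adj2 k)) $ 1 $ 1) ^ q =
       (k ** m ** adj2 (mat 1)) $ 2 $ 2 * (bar q (mat 1) ** n ** bar q (adj2 k)) $ 1 $ 1"
      using cond[OF mat1_in_SL2] by blast
    moreover define X Y where "X = k ** m" and "Y = n ** bar q (adj2 k)"
    ultimately have X21: "X $ 2 $ 1 = 0" and fx: "(X $ 2 $ 2 * Y $ 1 $ 1) ^ q = X $ 2 $ 2 * Y $ 1 $ 1"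
      by (simp_all add: bar_simps)
    have "det X = d"
      using k by (simp add: X_def d_def det_mul SL2_iff)
    hence dX: "X $ 1 $ 1 * X $ 2 $ 2 = d"
      using X21 by (simp add: det_2)
    have "bar q (adj2 k) ** bar q k = mat 1"
      using adj2_inverse(1)[OF bar_in_SL2[OF k]] by (simp add: bar_simps(3))
    moreover have "Y ** bar q X = n ** (bar q (adj2 k) ** bar q k) ** bar q m"
      by (simp add: X_def Y_def bar_simps(1) matrix_mul_assoc)
    ultimately have "Y ** bar q X = N"
      by (simp add: N_def)
    hence "\<mu> = (Y ** bar q X) $ 1 $ 1"
      by (simp add: \<mu>_def)
    hence "\<mu> = Y $ 1 $ 1 * (X $ 1 $ 1) ^ q"
      using X21 q_gt_1 by (simp add: mult2_nth bar_simps(6) power_0_left)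
    hence e: "d * \<mu> = (X $ 2 $ 2 * Y $ 1 $ 1) * (X $ 1 $ 1 * (X $ 1 $ 1) ^ q)"
      by (simp flip: dX add: mult_ac)
    show ?thesis
      unfolding e power_mult_distrib[of "X $ 2 $ 2 * Y $ 1 $ 1"] fx
      by (simp add: power_mult_distrib frob_frob mult.commute)
  qed
  have "d * \<mu> * (\<mu> * \<mu> ^ q) = d * \<mu> * 1"
  proof -
    have "d * \<mu> * (\<mu> * \<mu> ^ q) = (\<mu>\<^sup>2 * d) * \<mu> ^ q"
      by (simp add: power2_eq_square mult_ac)
    also have "\<dots> = (d * \<mu>) ^ q"
      by (simp add: rel1 power_mult_distrib)
    finally show ?thesis
      using rel2 by simp
  qed
  hence "\<mu> * \<mu> ^ q = 1"
    using d0 \<mu>0 by (metis mult_eq_0_iff mult_left_cancel)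
  then obtain \<nu> where \<nu>: "d = \<nu>\<^sup>2"
    using square_of_norm_condition[OF d0 rel1] by blast
  have \<nu>0: "\<nu> \<noteq> 0"
    using \<nu> d0 by auto
  \<comment> \<open>\<open>adj2 h\<close> is \<open>m\<close> divided by \<nu>, so h has determinant
    1 and \<open>theta q h\<close> multiplies by the rescaled \<open>m\<close> on the left.\<close>
  define h where "h = mat (1 / \<nu>) ** adj2 m"
  have h: "h \<in> carrier SL2"
    using \<nu> \<nu>0 by (simp add: h_def SL2_iff det_mul d_def[symmetric] power_divide)
  \<comment> \<open>The scalar by which x \<mapsto> m x n still differs from
    \<open>theta q h\<close>; its square is \<mu>^2 d / d^q = 1.\<close>
  define s where "s = \<mu> * \<nu> / \<nu> ^ q"
  have "(\<nu> ^ q)\<^sup>2 = d ^ q"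
    using \<nu> by (simp add: mult.commute flip: power_mult)
  hence "s\<^sup>2 = 1"
    using rel1 \<nu> d0 by (simp add: s_def power_divide power_mult_distrib)
  hence s: "s = 1 \<or> s = - 1"
    by (simp add: power2_eq_1_iff)
  have n: "n = mat (\<mu> / d ^ q) ** adj2 (bar q m)"
  proof -
    have "N ** adj2 (bar q m) = n ** (bar q m ** adj2 (bar q m))"
      by (simp add: N_def matrix_mul_assoc)
    also have "\<dots> = mat (d ^ q) ** n"
      by (simp add: adj2_mult bar_simps d_def mat_mult2_commute)
    finally have "mat (1 / d ^ q) ** (mat (d ^ q) ** n) = mat (1 / d ^ q) ** (mat \<mu> ** adj2 (bar q m))"
      using N unfolding \<mu>_def by simp
    thus ?thesis
      using d0 by (simp add: matrix_mul_assoc mat_mult_mat2)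
  qed
  have "\<mu> / d ^ q = s * (1 / \<nu>) * (1 / \<nu> ^ q)"
  proof -
    have "d ^ q = \<nu> ^ q * \<nu> ^ q"
      using \<nu> by (simp add: power2_eq_square power_mult_distrib)
    thus ?thesis
      using \<nu>0 by (simp add: s_def)
  qed
  hence lin: "m ** x ** n = mat s ** (adj2 h ** x ** bar q h)" for x
  proof -
    assume e: "\<mu> / d ^ q = s * (1 / \<nu>) * (1 / \<nu> ^ q)"
    have pull: "A ** x ** (mat c ** B) = mat c ** (A ** x ** B)" for A B :: "'a ^ 2 ^ 2" and c
      by (simp add: mat2_eq_iff mult2_nth algebra_simps)
    have "adj2 h = mat (1 / \<nu>) ** m"
      by (simp add: h_def mat2_eq_iff mult2_nth)
    moreover have "bar q h = mat (1 / \<nu> ^ q) ** adj2 (bar q m)"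
      by (simp add: h_def bar_simps power_divide)
    ultimately have "adj2 h ** x ** bar q h = mat (1 / \<nu> ^ q) ** (mat (1 / \<nu>) ** (m ** x ** adj2 (bar q m)))"
      by (simp only: pull) (simp only: matrix_mul_assoc)
    hence "mat s ** (adj2 h ** x ** bar q h) = mat (\<mu> / d ^ q) ** (m ** x ** adj2 (bar q m))"
      unfolding e by (simp add: matrix_mul_assoc mat_mult_mat2 mult_ac)
    thus ?thesis
      by (subst n) (simp only: pull)
  qed
  from s show ?thesis
  proof
    assume "s = 1"
    hence "lin m id n = theta q h"
      by (simp add: theta_lin[OF h] lin_def lin)
    thus ?thesis
      using h by blast
  next
    assume "s = - 1"
    have m1: "mat (- 1) ** B = B ** (- mat 1)" for B :: "'a ^ 2 ^ 2"
      by (simp add: mat2_eq_iff mult2_nth)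
    have "theta q h \<otimes>\<^bsub>SymSL\<^esub> rho (- mat 1) = lin (adj2 h) id (bar q h ** (- mat 1))"
      unfolding theta_lin[OF h] rho_lin by (subst mult_lin) (simp_all add: id_field_auts det_theta[OF h])
    moreover have "adj2 h ** x ** (bar q h ** (- mat 1)) = m ** x ** n" for x
      unfolding lin \<open>s = - 1\<close> m1[of "adj2 h ** x ** bar q h"] by (simp only: matrix_mul_assoc)
    hence "lin (adj2 h) id (bar q h ** (- mat 1)) = lin m id n"
      by (simp add: lin_def)
    ultimately have "theta q h \<otimes>\<^bsub>SymSL\<^esub> rho (- mat 1) = lin m id n"
      by simp
    thus ?thesis
      using h by metis
  qed
qed

end


section \<open>Internal products\<close>

lemma (in group) normal_in_subgroup:
  assumes K: "subgroup K G" and N: "subgroup N G" and "N \<subseteq> K"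
    and conj: "\<And>x n. x \<in> K \<Longrightarrow> n \<in> N \<Longrightarrow> x \<otimes> n \<otimes> inv x \<in> N"
  shows "N \<lhd> G\<lparr>carrier := K\<rparr>"
proof (rule group.normal_invI[OF subgroup_imp_group[OF K]])
  show "subgroup N (G\<lparr>carrier := K\<rparr>)"
    by (rule subgroup_incl[OF N K \<open>N \<subseteq> K\<close>])
  show "x \<otimes>\<^bsub>G\<lparr>carrier := K\<rparr>\<^esub> n \<otimes>\<^bsub>G\<lparr>carrier := K\<rparr>\<^esub> inv\<^bsub>G\<lparr>carrier := K\<rparr>\<^esub> x \<in> N"
    if "x \<in> carrier (G\<lparr>carrier := K\<rparr>)" "n \<in> N" for x n
    using that conj by (simp add: m_inv_consistent[OF K])
qed

lemma (in group) product_unique: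
  assumes A: "subgroup A G" and B: "subgroup B G" and "A \<inter> B = {\<one>}"
    and ab: "a \<in> A" "a' \<in> A" "b \<in> B" "b' \<in> B" and eq: "a \<otimes> b = a' \<otimes> b'"
  shows "a = a'" "b = b'"
proof -
  note cl = subgroup.mem_carrier[OF A ab(1)] subgroup.mem_carrier[OF A ab(2)]
    subgroup.mem_carrier[OF B ab(3)] subgroup.mem_carrier[OF B ab(4)]
  have "inv a' \<otimes> a = inv a' \<otimes> (a \<otimes> b) \<otimes> inv b"
    using cl by (simp add: m_assoc)
  also have "\<dots> = b' \<otimes> inv b"
    using cl by (simp add: eq flip: m_assoc)
  finally have e: "inv a' \<otimes> a = b' \<otimes> inv b" .
  have "inv a' \<otimes> a \<in> A"
    by (intro subgroup.m_closed[OF A] subgroup.m_inv_closed[OF A] ab)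
  moreover have "inv a' \<otimes> a \<in> B"
    unfolding e by (intro subgroup.m_closed[OF B] subgroup.m_inv_closed[OF B] ab)
  ultimately have "inv a' \<otimes> a = \<one>" "b' \<otimes> inv b = \<one>"
    using assms(3) e by auto
  thus "a = a'" "b = b'"
    using cl by (metis inv_closed inv_inv inv_unique' l_inv r_inv inv_equality)+
qed

text \<open>The explicit map will go from the external product to the stabilizer; its inverse is the
  isomorphism in the required direction.\<close>

lemma is_iso_of_inverse:
  assumes bij: "bij_betw f (carrier H) (carrier G)"
    and mult: "\<And>x y. x \<in> carrier H \<Longrightarrow> y \<in> carrier H \<Longrightarrow> f (x \<otimes>\<^bsub>H\<^esub> y) = f x \<otimes>\<^bsub>G\<^esub> f y"
    and closed: "\<And>x y. x \<in> carrier H \<Longrightarrow> y \<in> carrier H \<Longrightarrow> x \<otimes>\<^bsub>H\<^esub> y \<in> carrier H"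
  shows "G \<cong> H"
proof -
  let ?g = "inv_into (carrier H) f"
  have g: "bij_betw ?g (carrier G) (carrier H)"
    by (rule bij_betw_inv_into[OF bij])
  have "?g (x \<otimes>\<^bsub>G\<^esub> y) = ?g x \<otimes>\<^bsub>H\<^esub> ?g y" if "x \<in> carrier G" "y \<in> carrier G" for x y
  proof -
    have m: "?g x \<in> carrier H" "?g y \<in> carrier H"
      using bij_betwE[OF g] that by auto
    have "f (?g x \<otimes>\<^bsub>H\<^esub> ?g y) = x \<otimes>\<^bsub>G\<^esub> y"
      using mult[OF m] bij_betw_inv_into_right[OF bij] that by simp
    thus ?thesis
      using bij_betw_inv_into_left[OF bij closed[OF m]] by simp
  qed
  hence "?g \<in> iso G H"
    using g bij_betwE[OF g] by (auto simp: iso_def hom_def)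
  thus ?thesis
    by (auto simp: is_iso_def)
qed


section \<open>The projective special linear group\<close>

text \<open>Two elementary matrices suffice. Their entries 0 and 1 are fixed by every field
  automorphism, which permits the use in a twisted commutation relation.\<close>

lemma commute_upper1_lower1:
  fixes h :: "'a::field ^ 2 ^ 2"
  assumes h: "h \<in> carrier SL2"
    and u: "upper1 1 ** h = h ** upper1 1" and l: "lower1 1 ** h = h ** lower1 1"
  shows "h = mat 1 \<or> h = - mat 1"
proof -
  have e: "h $ 2 $ 1 = 0" "h $ 1 $ 2 = 0" "h $ 1 $ 1 = h $ 2 $ 2"
    using u l by (auto simp: mat2_eq_iff mult2_nth)
  have "(h $ 2 $ 2)\<^sup>2 = 1"
    using h e by (simp add: SL2_iff det_2 power2_eq_square)
  hence "h $ 2 $ 2 = 1 \<or> h $ 2 $ 2 = - 1"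
    by (simp add: power2_eq_1_iff)
  thus ?thesis
    using e by (auto simp: mat2_eq_iff)
qed

lemma centre_SL2: "group_centre SL2 = {mat 1, - mat 1 :: 'a::field ^ 2 ^ 2}"
proof -
  have "h = mat 1 \<or> h = - mat 1" if "h \<in> group_centre SL2" for h :: "'a ^ 2 ^ 2"
    using that by (intro commute_upper1_lower1) (auto simp: group_centre_def)
  thus ?thesis
    by (auto simp: group_centre_def mult2_uminus)
qed

lemma r_coset_centre: "group_centre SL2 #>\<^bsub>SL2\<^esub> h = {h, - h}" for h :: "'a::field ^ 2 ^ 2"
  by (auto simp: centre_SL2 r_coset_def mult2_uminus)

text \<open>In characteristic 2 the cosets \<open>{h, - h}\<close> are singletons, and the
  description remains valid.\<close>

lemma carrier_PSL2: "carrier PSL2 = (\<lambda>h :: 'a::field ^ 2 ^ 2. {h, - h}) ` carrier SL2"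
  by (auto simp: PSL2_def FactGroup_def RCOSETS_def r_coset_centre)

lemma mult_PSL2: "{h, - h} \<otimes>\<^bsub>PSL2\<^esub> {k, - k} = {h ** k, - (h ** k)}" for h k :: "'a::field ^ 2 ^ 2"
  by (auto simp: PSL2_def FactGroup_def set_mult_def mult2_uminus)

text \<open>Let Q be the size of the field. A nonzero lower-left entry c leaves a and d free and
  determines b, in (Q - 1) Q^2 ways; for c = 0 the entry a is nonzero, d is its inverse and b is
  free, in (Q - 1) Q ways.\<close>

lemma card_SL2:
  "card (carrier (SL2 :: ('a::{field,finite} ^ 2 ^ 2) monoid)) = (CARD('a) - 1) * CARD('a) * (CARD('a) + 1)"
proof -
  let ?C = "carrier SL2 :: ('a ^ 2 ^ 2) set"
  have "bij_betw (\<lambda>(c, a, d). mat2 a ((a * d - 1) / c) c d) ((UNIV - {0}) \<times> UNIV \<times> UNIV) {M \<in> ?C. M $ 2 $ 1 \<noteq> 0}"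
  proof (rule bij_betw_byWitness[where f' = "\<lambda>M. (M $ 2 $ 1, M $ 1 $ 1, M $ 2 $ 2)"])
    show "\<forall>M\<in>{M \<in> ?C. M $ 2 $ 1 \<noteq> 0}.
        (\<lambda>(c, a, d). mat2 a ((a * d - 1) / c) c d) (M $ 2 $ 1, M $ 1 $ 1, M $ 2 $ 2) = M"
      by (auto simp: mat2_eq_iff SL2_iff det_2 field_simps)
  qed (auto simp: SL2_iff det_2)
  hence "card {M \<in> ?C. M $ 2 $ 1 \<noteq> 0} = (CARD('a) - 1) * (CARD('a) * CARD('a))"
    by (simp add: card_cartesian_product card_Diff_singleton flip: bij_betw_same_card)
  moreover have "bij_betw (\<lambda>(a, b). mat2 a b 0 (1 / a)) ((UNIV - {0}) \<times> UNIV) {M \<in> ?C. M $ 2 $ 1 = 0}"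
  proof (rule bij_betw_byWitness[where f' = "\<lambda>M. (M $ 1 $ 1, M $ 1 $ 2)"])
    show "\<forall>M\<in>{M \<in> ?C. M $ 2 $ 1 = 0}. (\<lambda>(a, b). mat2 a b 0 (1 / a)) (M $ 1 $ 1, M $ 1 $ 2) = M"
      by (auto simp: mat2_eq_iff SL2_iff det_2) (metis mult_zero_left nonzero_eq_divide_eq mult.commute zero_neq_one)
  qed (auto simp: SL2_iff det_2)
  hence "card {M \<in> ?C. M $ 2 $ 1 = 0} = (CARD('a) - 1) * CARD('a)"
    by (simp add: card_cartesian_product card_Diff_singleton flip: bij_betw_same_card)
  moreover have "card ?C = card {M \<in> ?C. M $ 2 $ 1 \<noteq> 0} + card {M \<in> ?C. M $ 2 $ 1 = 0}"
    by (subst card_Un_disjoint[symmetric]) (auto intro: arg_cong[where f = card])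
  ultimately show ?thesis
    by (simp add: algebra_simps)
qed


section \<open>Structure of the stabilizer\<close>

context square_field
begin

sublocale S: group "SymSL :: ('a ^ 2 ^ 2 \<Rightarrow> 'a ^ 2 ^ 2) monoid"
  by (rule group_SymSL)

section \<open>Relations between the three kinds of permutations\<close>

abbreviation fperm :: "('a \<Rightarrow> 'a) \<Rightarrow> 'a ^ 2 ^ 2 \<Rightarrow> 'a ^ 2 ^ 2" where
  "fperm \<alpha> \<equiv> lin (mat 1) \<alpha> (mat 1)"

abbreviation neg :: "'a ^ 2 ^ 2 \<Rightarrow> 'a ^ 2 ^ 2" where
  "neg \<equiv> rho (- mat 1)"

lemma fperm_in_SymSL: "\<alpha> \<in> field_auts \<Longrightarrow> fperm \<alpha> \<in> carrier SymSL"
  by (simp add: lin_in_SymSL)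

lemma neg_in_SymSL: "neg \<in> carrier SymSL"
  by (simp add: rho_lin lin_in_SymSL id_field_auts)

lemma fperm_mult:
  "\<alpha> \<in> field_auts \<Longrightarrow> \<beta> \<in> field_auts \<Longrightarrow> fperm \<alpha> \<otimes>\<^bsub>SymSL\<^esub> fperm \<beta> = fperm (\<beta> \<circ> \<alpha>)"
  by (subst mult_lin) (simp_all add: map_matrix_mat field_auts_simps(1))

lemma fperm_inv: "\<alpha> \<in> field_auts \<Longrightarrow> inv\<^bsub>SymSL\<^esub> (fperm \<alpha>) = fperm (inv_into UNIV \<alpha>)"
  using field_auts_inv[of \<alpha>] by (subst inv_lin) (simp_all add: map_matrix_mat field_auts_simps(1))

lemma theta_one: "theta q (mat 1 :: 'a ^ 2 ^ 2) = \<one>\<^bsub>SymSL\<^esub>"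
  by (simp add: theta_lin one_SymSL_lin bar_simps)

lemma theta_inv: "h \<in> carrier SL2 \<Longrightarrow> inv\<^bsub>SymSL\<^esub> (theta q h) = theta q (adj2 h)" for h :: "'a ^ 2 ^ 2"
  by (rule S.inv_equality) (simp_all add: theta_mult adj2_inverse theta_one theta_in_SymSL)

lemma theta_uminus: "h \<in> carrier SL2 \<Longrightarrow> theta q (- h) = theta q h" for h :: "'a ^ 2 ^ 2"
  by (simp add: theta_lin SL2_iff adj2_uminus bar_simps lin_def mult2_uminus)

lemma bar_map_matrix: "\<alpha> \<in> field_auts \<Longrightarrow> bar q (map_matrix \<alpha> h) = map_matrix \<alpha> (bar q h)" for h :: "'a ^ 2 ^ 2"
  by (simp add: mat2_eq_iff bar_simps(6) field_auts_simps(7))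

text \<open>Field automorphisms commute with \<open>bar q\<close>, so \<alpha> carries
  \<open>theta q h\<close> to \<open>theta q (map_matrix \<alpha> h)\<close>. Normality of
  \<open>Theta q\<close> and invariance of the parallelism both rest on this.\<close>

lemma fperm_theta:
  fixes h :: "'a ^ 2 ^ 2"
  assumes "\<alpha> \<in> field_auts" "h \<in> carrier SL2"
  shows "fperm \<alpha> \<otimes>\<^bsub>SymSL\<^esub> theta q (map_matrix \<alpha> h) = theta q h \<otimes>\<^bsub>SymSL\<^esub> fperm \<alpha>"
proof -
  have h: "map_matrix \<alpha> h \<in> carrier SL2"
    using assms by (simp add: map_matrix_in_SL2)
  have "fperm \<alpha> \<otimes>\<^bsub>SymSL\<^esub> theta q (map_matrix \<alpha> h) = lin (adj2 (map_matrix \<alpha> h)) \<alpha> (bar q (map_matrix \<alpha> h))"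
    unfolding theta_lin[OF h] using det_theta[OF h] assms(1)
    by (subst mult_lin) (simp_all add: id_field_auts)
  also have "\<dots> = theta q h \<otimes>\<^bsub>SymSL\<^esub> fperm \<alpha>"
    unfolding theta_lin[OF assms(2)] using det_theta[OF assms(2)] assms(1)
    by (subst mult_lin) (simp_all add: id_field_auts map_matrix_adj2 bar_map_matrix)
  finally show ?thesis .
qed

lemma neg_theta:
  fixes h :: "'a ^ 2 ^ 2"
  assumes h: "h \<in> carrier SL2"
  shows "neg \<otimes>\<^bsub>SymSL\<^esub> theta q h = theta q h \<otimes>\<^bsub>SymSL\<^esub> neg"
  unfolding rho_lin theta_lin[OF h] using det_theta[OF h]
  by (simp add: mult_lin id_field_auts mult2_uminus)

lemma neg_fperm:
  assumes "\<alpha> \<in> field_auts"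
  shows "neg \<otimes>\<^bsub>SymSL\<^esub> fperm \<alpha> = fperm \<alpha> \<otimes>\<^bsub>SymSL\<^esub> neg"
  unfolding rho_lin
  by (simp add: mult_lin id_field_auts assms mult2_uminus map_matrix_uminus[OF assms] map_matrix_mat[OF assms]
      field_auts_simps(1)[OF assms])

lemma neg_neg: "neg \<otimes>\<^bsub>SymSL\<^esub> neg = \<one>\<^bsub>SymSL\<^esub>"
  unfolding rho_lin one_SymSL_lin by (simp add: mult_lin id_field_auts mult2_uminus)

section \<open>The constituents as subgroups, and their intersections\<close>

lemma Theta_eq: "Theta q = theta q ` (carrier SL2 :: ('a ^ 2 ^ 2) set)"
  and subgroup_Theta: "subgroup (Theta q :: ('a ^ 2 ^ 2 \<Rightarrow> 'a ^ 2 ^ 2) set) SymSL"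
proof -
  have sub: "subgroup (theta q ` (carrier SL2 :: ('a ^ 2 ^ 2) set)) SymSL"
  proof (rule S.subgroupI)
    show "theta q ` (carrier SL2 :: ('a ^ 2 ^ 2) set) \<noteq> {}"
      using mat1_in_SL2 by blast
  qed (auto simp: theta_in_SymSL theta_inv theta_mult adj2_inverse mult_in_SL2)
  have "theta q ` (carrier SL2 :: ('a ^ 2 ^ 2) set) = generate SymSL {theta q h | h. h \<in> carrier SL2}"
    by (rule S.generateI[OF sub]) auto
  thus "Theta q = theta q ` (carrier SL2 :: ('a ^ 2 ^ 2) set)"
    by (simp add: Theta_def)
  thus "subgroup (Theta q :: ('a ^ 2 ^ 2 \<Rightarrow> 'a ^ 2 ^ 2) set) SymSL"
    using sub by simp
qed

lemma field_perms_eq: "field_perms = fperm ` field_auts"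
  by (auto simp: field_perms_lin)

lemma subgroup_field_perms: "subgroup (field_perms :: ('a ^ 2 ^ 2 \<Rightarrow> 'a ^ 2 ^ 2) set) SymSL"
  unfolding field_perms_eq
proof (rule S.subgroupI)
  show "fperm ` field_auts \<noteq> {}"
    using id_field_auts by blast
qed (auto simp: fperm_in_SymSL fperm_inv fperm_mult field_auts_inv field_auts_comp)

text \<open>In characteristic 2 \<open>neg\<close> is the identity, and the set on the right has one
  element.\<close>

lemma rho_minus_eq: "rho_minus = {\<one>\<^bsub>SymSL\<^esub>, neg}"
  and subgroup_rho_minus: "subgroup (rho_minus :: ('a ^ 2 ^ 2 \<Rightarrow> 'a ^ 2 ^ 2) set) SymSL"
proof -
  have "inv\<^bsub>SymSL\<^esub> neg = neg"
    by (rule S.inv_equality) (simp_all add: neg_neg neg_in_SymSL)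
  hence sub: "subgroup {\<one>\<^bsub>SymSL\<^esub>, neg} SymSL"
    by (intro S.subgroupI) (auto simp: neg_in_SymSL neg_neg)
  have "{\<one>\<^bsub>SymSL\<^esub>, neg} = generate SymSL {neg}"
    by (rule S.generateI[OF sub]) (auto dest: subgroup.one_closed)
  thus "rho_minus = {\<one>\<^bsub>SymSL\<^esub>, neg}"
    by (simp add: rho_minus_def)
  thus "subgroup (rho_minus :: ('a ^ 2 ^ 2 \<Rightarrow> 'a ^ 2 ^ 2) set) SymSL"
    using sub by simp
qed

definition Lam :: "('a ^ 2 ^ 2 \<Rightarrow> 'a ^ 2 ^ 2) set" where
  "Lam = Theta q <#>\<^bsub>SymSL\<^esub> field_perms"

lemma Lam_iff: "\<sigma> \<in> Lam \<longleftrightarrow> (\<exists>h\<in>carrier SL2. \<exists>\<alpha>\<in>field_auts. \<sigma> = theta q h \<otimes>\<^bsub>SymSL\<^esub> fperm \<alpha>)"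
  by (auto simp: Lam_def set_mult_def Theta_eq field_perms_eq)

text \<open>Moving \<open>fperm \<alpha>\<close> to the right past \<open>theta q k\<close> applies
  the inverse of \<alpha> to \<open>k\<close>.\<close>

lemma theta_fperm_mult:
  fixes h k :: "'a ^ 2 ^ 2"
  assumes h: "h \<in> carrier SL2" and k: "k \<in> carrier SL2" and \<alpha>: "\<alpha> \<in> field_auts" and \<beta>: "\<beta> \<in> field_auts"
  shows "theta q h \<otimes>\<^bsub>SymSL\<^esub> fperm \<alpha> \<otimes>\<^bsub>SymSL\<^esub> (theta q k \<otimes>\<^bsub>SymSL\<^esub> fperm \<beta>) =
    theta q (h ** map_matrix (inv_into UNIV \<alpha>) k) \<otimes>\<^bsub>SymSL\<^esub> fperm (\<beta> \<circ> \<alpha>)"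
proof -
  note i = field_auts_inv[OF \<alpha>]
  let ?k = "map_matrix (inv_into UNIV \<alpha>) k"
  have k': "?k \<in> carrier SL2"
    using i(1) k by (simp add: map_matrix_in_SL2)
  have "fperm \<alpha> \<otimes>\<^bsub>SymSL\<^esub> theta q k = theta q ?k \<otimes>\<^bsub>SymSL\<^esub> fperm \<alpha>"
    using fperm_theta[OF \<alpha> k'] by (simp add: map_matrix_comp i)
  hence "fperm \<alpha> \<otimes>\<^bsub>SymSL\<^esub> (theta q k \<otimes>\<^bsub>SymSL\<^esub> fperm \<beta>) = theta q ?k \<otimes>\<^bsub>SymSL\<^esub> (fperm \<alpha> \<otimes>\<^bsub>SymSL\<^esub> fperm \<beta>)"
    using theta_in_SymSL[OF k] theta_in_SymSL[OF k'] fperm_in_SymSL[OF \<alpha>] fperm_in_SymSL[OF \<beta>]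
    by (simp flip: S.m_assoc)
  hence "theta q h \<otimes>\<^bsub>SymSL\<^esub> fperm \<alpha> \<otimes>\<^bsub>SymSL\<^esub> (theta q k \<otimes>\<^bsub>SymSL\<^esub> fperm \<beta>) =
      theta q h \<otimes>\<^bsub>SymSL\<^esub> (theta q ?k \<otimes>\<^bsub>SymSL\<^esub> (fperm \<alpha> \<otimes>\<^bsub>SymSL\<^esub> fperm \<beta>))"
    using theta_in_SymSL[OF h] theta_in_SymSL[OF k] fperm_in_SymSL[OF \<alpha>] fperm_in_SymSL[OF \<beta>] by (simp add: S.m_assoc)
  also have "\<dots> = theta q h \<otimes>\<^bsub>SymSL\<^esub> theta q ?k \<otimes>\<^bsub>SymSL\<^esub> (fperm \<alpha> \<otimes>\<^bsub>SymSL\<^esub> fperm \<beta>)"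
    using theta_in_SymSL[OF h] theta_in_SymSL[OF k'] fperm_in_SymSL[OF \<alpha>] fperm_in_SymSL[OF \<beta>] by (simp add: S.m_assoc)
  finally show ?thesis
    by (simp add: theta_mult[OF h k'] fperm_mult[OF \<alpha> \<beta>])
qed

lemma theta_subset_Lam: "h \<in> carrier SL2 \<Longrightarrow> theta q h \<in> Lam" for h :: "'a ^ 2 ^ 2"
  unfolding Lam_iff using theta_in_SymSL[of h] id_field_auts
  by (intro bexI[of _ h] bexI[of _ id]) (simp_all flip: one_SymSL_lin)

lemma fperm_subset_Lam: "\<alpha> \<in> field_auts \<Longrightarrow> fperm \<alpha> \<in> Lam"
  unfolding Lam_iff using fperm_in_SymSL[of \<alpha>]
  by (intro bexI[of _ "mat 1"] bexI[of _ \<alpha>]) (simp_all add: theta_one)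

lemma subgroup_Lam: "subgroup Lam SymSL"
proof (rule S.subgroupI)
  show "Lam \<subseteq> carrier SymSL"
    by (auto simp: Lam_iff theta_in_SymSL fperm_in_SymSL)
  show "Lam \<noteq> {}"
    using theta_subset_Lam[OF mat1_in_SL2] by blast
  show mult: "f \<otimes>\<^bsub>SymSL\<^esub> g \<in> Lam" if "f \<in> Lam" "g \<in> Lam" for f g
  proof -
    obtain h \<alpha> where f: "h \<in> carrier SL2" "\<alpha> \<in> field_auts" "f = theta q h \<otimes>\<^bsub>SymSL\<^esub> fperm \<alpha>"
      using \<open>f \<in> Lam\<close> by (auto simp: Lam_iff)
    obtain k \<beta> where g: "k \<in> carrier SL2" "\<beta> \<in> field_auts" "g = theta q k \<otimes>\<^bsub>SymSL\<^esub> fperm \<beta>"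
      using \<open>g \<in> Lam\<close> by (auto simp: Lam_iff)
    have "h ** map_matrix (inv_into UNIV \<alpha>) k \<in> carrier SL2"
      using f(1) g(1) field_auts_inv(1)[OF f(2)] by (simp add: mult_in_SL2 map_matrix_in_SL2)
    thus ?thesis
      unfolding f(3) g(3) theta_fperm_mult[OF f(1) g(1) f(2) g(2)]
      using field_auts_comp[OF g(2) f(2)] unfolding Lam_iff by blast
  qed
  show "inv\<^bsub>SymSL\<^esub> f \<in> Lam" if "f \<in> Lam" for f
  proof -
    obtain h \<alpha> where f: "h \<in> carrier SL2" "\<alpha> \<in> field_auts" "f = theta q h \<otimes>\<^bsub>SymSL\<^esub> fperm \<alpha>"
      using \<open>f \<in> Lam\<close> by (auto simp: Lam_iff)
    have "inv\<^bsub>SymSL\<^esub> f = fperm (inv_into UNIV \<alpha>) \<otimes>\<^bsub>SymSL\<^esub> theta q (adj2 h)"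
      using f theta_in_SymSL fperm_in_SymSL by (simp add: S.inv_mult_group theta_inv fperm_inv)
    thus ?thesis
      using mult fperm_subset_Lam[OF field_auts_inv(1)[OF f(2)]] theta_subset_Lam[OF adj2_inverse(3)[OF f(1)]] by simp
  qed
qed

text \<open>One computation for three purposes: \<open>Theta q\<close> meets
  \<open>field_perms\<close> trivially, \<open>neg\<close> lies in \<open>Lam\<close> only if it is
  the identity, and \<open>theta q\<close> has kernel consisting of 1 and -1.\<close>

lemma twisted_conj_eq_scalar:
  fixes h :: "'a ^ 2 ^ 2"
  assumes h: "h \<in> carrier SL2" and \<alpha>: "\<alpha> \<in> field_auts" and s: "s = 1 \<or> s = - 1"
    and eq: "\<And>x. x \<in> carrier SL2 \<Longrightarrow> map_matrix \<alpha> (adj2 h ** x ** bar q h) = mat s ** x"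
  shows "h = mat 1 \<or> h = - mat 1" "\<alpha> = id" "s = 1"
proof -
  define \<beta> where "\<beta> = inv_into UNIV \<alpha>"
  note \<beta> = field_auts_inv[OF \<alpha>, folded \<beta>_def]
  have \<beta>s: "\<beta> s = s"
    using s field_auts_simps(1,5)[OF \<beta>(1)] by auto
  have ss: "mat s ** (mat s ** x) = x" for x :: "'a ^ 2 ^ 2"
    using s by (auto simp: mat2_eq_iff mult2_nth)
  have b: "adj2 h ** x ** bar q h = mat s ** map_matrix \<beta> x" if "x \<in> carrier SL2" for x
  proof -
    have "map_matrix \<beta> (map_matrix \<alpha> (adj2 h ** x ** bar q h)) = map_matrix \<beta> (mat s ** x)"
      using eq[OF that] by simp
    thus ?thesis
      by (simp add: map_matrix_comp \<beta> map_matrix_mult[OF \<beta>(1)] map_matrix_mat[OF \<beta>(1)] \<beta>s)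
  qed
  \<comment> \<open>Evaluation at the identity expresses \<open>bar q h\<close> through
    \<open>h\<close>; after substitution the scalar \<open>s\<close> cancels.\<close>
  have "h ** (adj2 h ** bar q h) = h ** mat s"
    using b[of "mat 1"] by (simp add: map_matrix_mat[OF \<beta>(1)] field_auts_simps(1)[OF \<beta>(1)])
  hence bh: "bar q h = mat s ** h"
    using h by (simp add: matrix_mul_assoc adj2_inverse mat_mult2_commute)
  have c: "x ** h = h ** map_matrix \<beta> x" if "x \<in> carrier SL2" for x
  proof -
    have "mat s ** (adj2 h ** x ** h) = mat s ** map_matrix \<beta> x"
      using b[OF that] unfolding bh by (simp add: matrix_mul_assoc mat_mult2_commute[of s "adj2 h ** x"] flip: mat_mult2_commute)
    hence "adj2 h ** x ** h = map_matrix \<beta> x"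
      using ss by metis
    hence "h ** (adj2 h ** x ** h) = h ** map_matrix \<beta> x"
      by simp
    thus ?thesis
      using h by (simp add: matrix_mul_assoc adj2_inverse)
  qed
  have "map_matrix \<beta> (upper1 1) = upper1 1" "map_matrix \<beta> (lower1 1) = lower1 1"
    by (simp_all add: mat2_eq_iff field_auts_simps(1,2)[OF \<beta>(1)])
  thus hh: "h = mat 1 \<or> h = - mat 1"
    using c[of "upper1 1"] c[of "lower1 1"] by (intro commute_upper1_lower1[OF h]) auto
  have "\<beta> y = y" for y
    using hh c[of "upper1 y"] by (auto simp: mat2_eq_iff mult2_nth)
  hence "\<beta> = id"
    by auto
  thus "\<alpha> = id"
    using \<beta>(2) by simp
  \<comment> \<open>The entries of 1 and -1 are fixed by \<open>bar q\<close>, so the relation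
    \<open>bar q h = mat s ** h\<close> leaves only s = 1.\<close>
  have "bar q h = h"
    using hh by (auto simp: bar_simps)
  hence "mat s ** h = h"
    using bh by simp
  thus "s = 1"
    using hh by (auto simp: mat2_eq_iff mult2_nth)
qed

lemma theta_fperm_apply:
  fixes h :: "'a ^ 2 ^ 2"
  assumes "h \<in> carrier SL2" "\<alpha> \<in> field_auts" "x \<in> carrier SL2"
  shows "(theta q h \<otimes>\<^bsub>SymSL\<^esub> fperm \<alpha>) x = map_matrix \<alpha> (adj2 h ** x ** bar q h)"
proof -
  have "adj2 h ** x ** bar q h \<in> carrier SL2"
    by (intro mult_in_SL2 adj2_inverse bar_in_SL2 assms)
  moreover have "theta q h \<in> Bij (carrier SL2)" "fperm \<alpha> \<in> Bij (carrier SL2)"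
    using theta_in_SymSL fperm_in_SymSL assms by (auto simp: carrier_SymSL)
  ultimately show ?thesis
    using assms by (simp add: mult_SymSL compose_def theta_lin)
qed

lemma Theta_field_perms_disjoint: "Theta q \<inter> field_perms = {\<one>\<^bsub>SymSL\<^esub> :: 'a ^ 2 ^ 2 \<Rightarrow> 'a ^ 2 ^ 2}"
proof -
  have "\<sigma> = \<one>\<^bsub>SymSL\<^esub>" if \<sigma>: "\<sigma> \<in> Theta q" "\<sigma> \<in> field_perms" for \<sigma> :: "'a ^ 2 ^ 2 \<Rightarrow> 'a ^ 2 ^ 2"
  proof -
    obtain h \<alpha> where h: "h \<in> carrier SL2" "\<sigma> = theta q h" and \<alpha>: "\<alpha> \<in> field_auts" "\<sigma> = fperm \<alpha>"
      using \<sigma> by (auto simp: Theta_eq field_perms_eq)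
    note i = field_auts_inv[OF \<alpha>(1)]
    have "theta q h \<otimes>\<^bsub>SymSL\<^esub> fperm (inv_into UNIV \<alpha>) = \<one>\<^bsub>SymSL\<^esub>"
      unfolding h(2)[symmetric] \<alpha>(2) by (simp add: fperm_mult \<alpha>(1) i one_SymSL_lin)
    hence "map_matrix (inv_into UNIV \<alpha>) (adj2 h ** x ** bar q h) = mat 1 ** x" if "x \<in> carrier SL2" for x
      using theta_fperm_apply[OF h(1) i(1) that] that by (simp add: one_SymSL)
    hence "inv_into UNIV \<alpha> = id"
      by (intro twisted_conj_eq_scalar(2)[OF h(1) i(1), of 1]) auto
    hence "\<alpha> = id"
      using i(2) by simp
    thus ?thesis
      using \<alpha>(2) by (simp add: one_SymSL_lin)
  qed
  thus ?thesis
    using subgroup.one_closed[OF subgroup_Theta] subgroup.one_closed[OF subgroup_field_perms] by blast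
qed

text \<open>Membership of \<open>neg\<close> in \<open>Lam\<close> forces -1 = 1 in the field, and
  then \<open>neg\<close> is the identity anyway.\<close>

lemma Lam_rho_minus_disjoint: "Lam \<inter> rho_minus = {\<one>\<^bsub>SymSL\<^esub>}"
proof -
  have "neg = \<one>\<^bsub>SymSL\<^esub>" if L: "neg \<in> Lam"
  proof -
    obtain h \<alpha> where h: "h \<in> carrier SL2" and \<alpha>: "\<alpha> \<in> field_auts" and eq: "neg = theta q h \<otimes>\<^bsub>SymSL\<^esub> fperm \<alpha>"
      using L by (auto simp: Lam_iff)
    have "map_matrix \<alpha> (adj2 h ** x ** bar q h) = mat (- 1) ** x" if "x \<in> carrier SL2" for x
      unfolding theta_fperm_apply[OF h \<alpha> that, symmetric] eq[symmetric]
      using that by (simp add: rho_def mat2_eq_iff mult2_nth)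
    hence "(- 1 :: 'a) = 1"
      by (intro twisted_conj_eq_scalar(3)[OF h \<alpha>]) auto
    hence "- mat 1 = (mat 1 :: 'a ^ 2 ^ 2)"
      by (simp add: mat2_eq_iff)
    thus ?thesis
      by (simp only: rho_lin one_SymSL_lin)
  qed
  thus ?thesis
    using subgroup.one_closed[OF subgroup_Lam] by (auto simp: rho_minus_eq)
qed

lemma theta_eq_iff:
  fixes h k :: "'a ^ 2 ^ 2"
  assumes h: "h \<in> carrier SL2" and k: "k \<in> carrier SL2" and eq: "theta q h = theta q k"
  shows "h = k \<or> h = - k"
proof -
  let ?g = "adj2 k ** h"
  have k': "adj2 k \<in> carrier SL2"
    by (rule adj2_inverse(3)[OF k])
  have g: "?g \<in> carrier SL2"
    by (rule mult_in_SL2[OF k' h])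
  have "theta q ?g = \<one>\<^bsub>SymSL\<^esub>"
    using theta_mult[OF k' h] theta_mult[OF k' k] by (simp add: eq adj2_inverse[OF k] theta_one)
  hence "map_matrix id (adj2 ?g ** x ** bar q ?g) = mat 1 ** x" if "x \<in> carrier SL2" for x
    using that g by (metis theta_lin lin_apply map_matrix_id one_SymSL restrict_apply' matrix_mul_lid)
  hence "?g = mat 1 \<or> ?g = - mat 1"
    by (intro twisted_conj_eq_scalar(1)[OF g id_field_auts, of 1]) auto
  moreover have "k ** ?g = h"
    by (simp add: matrix_mul_assoc adj2_inverse[OF k])
  ultimately show ?thesis
    by (metis matrix_mul_rid mult2_uminus(2))
qed

lemma fperm_inj: "fperm \<alpha> = fperm \<beta> \<Longrightarrow> \<alpha> = \<beta>"
proof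
  fix y assume "fperm \<alpha> = fperm \<beta>"
  hence "fperm \<alpha> (upper1 y) = fperm \<beta> (upper1 y)"
    by simp
  thus "\<alpha> y = \<beta> y"
    by (simp add: mat2_eq_iff)
qed

section \<open>Permutations that preserve the parallelism\<close>

lemma fperm_Acls: "\<alpha> \<in> field_auts \<Longrightarrow> act_class (Acls q) (fperm \<alpha>) = Acls q"
proof (rule Acls_invariant)
  assume \<alpha>: "\<alpha> \<in> field_auts"
  show "fperm \<alpha> \<in> Bij (carrier SL2)"
    using fperm_in_SymSL[OF \<alpha>] by (simp add: carrier_SymSL)
qed (simp_all add: field_auts_simps(8) flip: field_auts_simps(7))

lemma neg_Acls: "act_class (Acls q) neg = Acls q"
proof (rule Acls_invariant)
  show "neg \<in> Bij (carrier SL2)"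
    using neg_in_SymSL by (simp add: carrier_SymSL)
  have "(- y) ^ q = - (y ^ q)" for y :: 'a
    using field_auts_simps(5)[OF frob] .
  thus "(neg x $ 2 $ 1) ^ q = neg x $ 2 $ 1 \<longleftrightarrow> (x $ 2 $ 1) ^ q = x $ 2 $ 1" if "x \<in> carrier SL2" for x
    using that by (simp add: rho_def mult2_uminus)
qed (simp_all add: rho_def mult2_uminus)

lemma Acls_Pow: "Acls q \<subseteq> Pow (carrier (SL2 :: ('a ^ 2 ^ 2) monoid))"
  using Acls_subset by blast

lemma act_par_theta:
  fixes k :: "'a ^ 2 ^ 2"
  assumes k: "k \<in> carrier SL2"
  shows "act_par (pi_sq q) (theta q k) = pi_sq q"
proof -
  have "act_class (act_class (Acls q) (theta q h)) (theta q k) = act_class (Acls q) (theta q (h ** k))"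
    if "h \<in> carrier SL2" for h
    using that k by (simp add: act_class_mult[OF _ _ Acls_Pow] theta_in_SymSL theta_mult)
  hence "act_par (pi_sq q) (theta q k) = (\<lambda>h. act_class (Acls q) (theta q (h ** k))) ` carrier SL2"
    unfolding act_par_def pi_sq_def by (auto simp: image_iff)
  also have "\<dots> = (\<lambda>h. act_class (Acls q) (theta q h)) ` ((\<lambda>h. h ** k) ` carrier SL2)"
    by (simp add: image_image)
  also have "(\<lambda>h. h ** k) ` carrier SL2 = carrier SL2"
  proof -
    have "h \<in> (\<lambda>h. h ** k) ` carrier SL2" if "h \<in> carrier SL2" for h
      using that k by (intro image_eqI[of _ _ "h ** adj2 k"])
        (simp_all add: mult_in_SL2 adj2_inverse flip: matrix_mul_assoc)
    thus ?thesis
      using k by (auto simp: mult_in_SL2)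
  qed
  also have "(\<lambda>h. act_class (Acls q) (theta q h)) ` carrier SL2 = pi_sq q"
    unfolding pi_sq_def by blast
  finally show ?thesis .
qed

text \<open>If f fixes \<open>Acls q\<close> and conjugates \<open>theta q h\<close> to
  \<open>theta q (g h)\<close>, it sends the member of index h to the member of index
  \<open>g h\<close>. Applied with g = \<open>map_matrix \<alpha>\<close> and g =
  \<open>id\<close>.\<close>

lemma act_par_commuting:
  fixes f :: "'a ^ 2 ^ 2 \<Rightarrow> 'a ^ 2 ^ 2"
  assumes f: "f \<in> carrier SymSL" and A: "act_class (Acls q) f = Acls q"
    and g: "g ` carrier SL2 = carrier SL2"
    and comm: "\<And>h. h \<in> carrier SL2 \<Longrightarrow> theta q h \<otimes>\<^bsub>SymSL\<^esub> f = f \<otimes>\<^bsub>SymSL\<^esub> theta q (g h)"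
  shows "act_par (pi_sq q) f = pi_sq q"
proof -
  have "act_class (act_class (Acls q) (theta q h)) f = act_class (Acls q) (theta q (g h))" if h: "h \<in> carrier SL2" for h
  proof -
    have gh: "g h \<in> carrier SL2"
      using g h by blast
    have "act_class (act_class (Acls q) (theta q h)) f = act_class (act_class (Acls q) f) (theta q (g h))"
      by (simp add: act_class_mult[OF _ _ Acls_Pow] theta_in_SymSL h gh f comm)
    thus ?thesis
      by (simp add: A)
  qed
  hence "act_par (pi_sq q) f = (\<lambda>h. act_class (Acls q) (theta q (g h))) ` carrier SL2"
    unfolding act_par_def pi_sq_def by (auto simp: image_iff)
  also have "\<dots> = (\<lambda>h. act_class (Acls q) (theta q h)) ` (g ` carrier SL2)"
    by (simp add: image_image)
  also have "\<dots> = pi_sq q"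
    unfolding g pi_sq_def by blast
  finally show ?thesis .
qed

lemma act_par_fperm:
  assumes \<alpha>: "\<alpha> \<in> field_auts"
  shows "act_par (pi_sq q) (fperm \<alpha>) = pi_sq q"
proof (rule act_par_commuting[OF fperm_in_SymSL[OF \<alpha>] fperm_Acls[OF \<alpha>]])
  have "h \<in> map_matrix \<alpha> ` carrier SL2" if "h \<in> carrier SL2" for h :: "'a ^ 2 ^ 2"
    using that field_auts_inv[OF \<alpha>]
    by (intro image_eqI[of _ _ "map_matrix (inv_into UNIV \<alpha>) h"]) (simp_all add: map_matrix_comp map_matrix_in_SL2)
  thus "map_matrix \<alpha> ` carrier SL2 = (carrier SL2 :: ('a ^ 2 ^ 2) set)"
    using map_matrix_in_SL2[OF \<alpha>] by auto
qed (simp add: fperm_theta[OF \<alpha>])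

lemma act_par_neg: "act_par (pi_sq q) neg = pi_sq q"
  by (rule act_par_commuting[OF neg_in_SymSL neg_Acls, of id]) (simp_all add: neg_theta)

section \<open>The stabilizer and its decomposition\<close>

lemma Gam_iff: "\<sigma> \<in> Gam q \<longleftrightarrow> \<sigma> \<in> semilinear_maps \<and> act_par (pi_sq q) \<sigma> = pi_sq q"
  for \<sigma> :: "'a ^ 2 ^ 2 \<Rightarrow> 'a ^ 2 ^ 2"
  using AutR_eq[where ?'a = 'a] CHAR_p prime by (simp add: Gam_def)

lemma subgroup_Gam: "subgroup (Gam q :: ('a ^ 2 ^ 2 \<Rightarrow> 'a ^ 2 ^ 2) set) SymSL"
proof (rule S.subgroupI)
  note L = subgroup_semilinear_maps[where ?'a = 'a]
  note c = subgroup.mem_carrier[OF L]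
  show "Gam q \<subseteq> (carrier SymSL :: ('a ^ 2 ^ 2 \<Rightarrow> 'a ^ 2 ^ 2) set)"
    using c by (auto simp: Gam_iff)
  have "\<one>\<^bsub>SymSL\<^esub> \<in> (Gam q :: ('a ^ 2 ^ 2 \<Rightarrow> 'a ^ 2 ^ 2) set)"
    by (simp add: Gam_iff subgroup.one_closed[OF L] act_par_one[OF pi_sq_subset])
  thus "(Gam q :: ('a ^ 2 ^ 2 \<Rightarrow> 'a ^ 2 ^ 2) set) \<noteq> {}"
    by blast
  fix f :: "'a ^ 2 ^ 2 \<Rightarrow> 'a ^ 2 ^ 2" assume "f \<in> Gam q"
  hence f: "f \<in> semilinear_maps" "act_par (pi_sq q) f = pi_sq q"
    by (auto simp: Gam_iff)
  have "act_par (act_par (pi_sq q) f) (inv\<^bsub>SymSL\<^esub> f) = pi_sq q"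
    using c[OF f(1)] by (simp add: act_par_mult[OF _ _ pi_sq_subset] act_par_one[OF pi_sq_subset])
  thus "inv\<^bsub>SymSL\<^esub> f \<in> Gam q"
    by (simp add: Gam_iff f subgroup.m_inv_closed[OF L])
  fix g :: "'a ^ 2 ^ 2 \<Rightarrow> 'a ^ 2 ^ 2" assume "g \<in> Gam q"
  hence g: "g \<in> semilinear_maps" "act_par (pi_sq q) g = pi_sq q"
    by (auto simp: Gam_iff)
  have "act_par (act_par (pi_sq q) f) g = act_par (pi_sq q) (f \<otimes>\<^bsub>SymSL\<^esub> g)"
    by (rule act_par_mult[OF c[OF f(1)] c[OF g(1)] pi_sq_subset])
  thus "f \<otimes>\<^bsub>SymSL\<^esub> g \<in> Gam q"
    by (simp add: Gam_iff f g subgroup.m_closed[OF L])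
qed

lemma lin_semilinear: "\<alpha> \<in> field_auts \<Longrightarrow> det a * det b = 1 \<Longrightarrow> lin a \<alpha> b \<in> semilinear_maps"
  unfolding semilinear_maps_def by blast

lemma theta_in_Gam: "h \<in> carrier SL2 \<Longrightarrow> theta q h \<in> Gam q" for h :: "'a ^ 2 ^ 2"
  using lin_semilinear[OF id_field_auts, of "adj2 h" "bar q h"]
  by (simp add: Gam_iff act_par_theta det_theta theta_lin[symmetric])

lemma fperm_in_Gam: "\<alpha> \<in> field_auts \<Longrightarrow> fperm \<alpha> \<in> Gam q"
  by (simp add: Gam_iff act_par_fperm lin_semilinear)

lemma neg_in_Gam: "neg \<in> Gam q"
  by (simp add: Gam_iff act_par_neg lin_semilinear[OF id_field_auts] rho_lin[symmetric] flip: rho_lin)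
     (simp add: rho_lin lin_semilinear id_field_auts)

lemma Gam_eq: "Gam q = Lam <#>\<^bsub>SymSL\<^esub> rho_minus"
proof
  have "theta q h \<otimes>\<^bsub>SymSL\<^esub> fperm \<alpha> \<otimes>\<^bsub>SymSL\<^esub> r \<in> Gam q"
    if "h \<in> carrier SL2" "\<alpha> \<in> field_auts" "r \<in> rho_minus" for h \<alpha> and r :: "'a ^ 2 ^ 2 \<Rightarrow> 'a ^ 2 ^ 2"
    using that neg_in_Gam subgroup.one_closed[OF subgroup_Gam]
    by (intro subgroup.m_closed[OF subgroup_Gam] theta_in_Gam fperm_in_Gam) (auto simp: rho_minus_eq)
  thus "Lam <#>\<^bsub>SymSL\<^esub> rho_minus \<subseteq> Gam q"
    by (auto simp: set_mult_def Lam_iff)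
  show "Gam q \<subseteq> Lam <#>\<^bsub>SymSL\<^esub> rho_minus"
  proof
    fix \<sigma> :: "'a ^ 2 ^ 2 \<Rightarrow> 'a ^ 2 ^ 2" assume \<sigma>: "\<sigma> \<in> Gam q"
    then obtain a \<alpha> b where ab: "\<sigma> = lin a \<alpha> b" "\<alpha> \<in> field_auts" "det a * det b = 1"
      unfolding Gam_iff semilinear_maps_def by blast
    note F = fperm_in_SymSL[OF ab(2)]
    have dec: "\<sigma> = fperm \<alpha> \<otimes>\<^bsub>SymSL\<^esub> lin a id b"
      unfolding ab(1) using ab(2,3) by (subst mult_lin) (simp_all add: id_field_auts)
    have L: "lin a id b \<in> carrier SymSL"
      using lin_in_SymSL[OF id_field_auts ab(3)] .
    \<comment> \<open>Since \<open>fperm \<alpha>\<close> preserves the parallelism by itself, the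
      linear remainder has to preserve it too.\<close>
    have "act_par (act_par (pi_sq q) (fperm \<alpha>)) (lin a id b) = pi_sq q"
      using \<sigma> by (simp only: act_par_mult[OF F L pi_sq_subset] dec Gam_iff)
    hence "act_par (pi_sq q) (lin a id b) = pi_sq q"
      by (simp add: act_par_fperm[OF ab(2)])
    then obtain h where h: "h \<in> carrier SL2" and
        disj: "lin a id b = theta q h \<or> lin a id b = theta q h \<otimes>\<^bsub>SymSL\<^esub> neg"
      using pi_sq_stabilizer_linear[OF ab(3)] by blast
    from disj have "\<exists>r\<in>rho_minus. lin a id b = theta q h \<otimes>\<^bsub>SymSL\<^esub> r"
    proof
      assume "lin a id b = theta q h"
      thus ?thesis
        by (intro bexI[of _ "\<one>\<^bsub>SymSL\<^esub>"]) (simp_all add: rho_minus_eq theta_in_SymSL[OF h])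
    next
      assume "lin a id b = theta q h \<otimes>\<^bsub>SymSL\<^esub> neg"
      thus ?thesis
        by (intro bexI[of _ neg]) (simp_all add: rho_minus_eq)
    qed
    then obtain r where r: "r \<in> rho_minus" "lin a id b = theta q h \<otimes>\<^bsub>SymSL\<^esub> r"
      by blast
    have rS: "r \<in> carrier SymSL"
      using r(1) subgroup.mem_carrier[OF subgroup_rho_minus] by blast
    have "\<sigma> = fperm \<alpha> \<otimes>\<^bsub>SymSL\<^esub> theta q h \<otimes>\<^bsub>SymSL\<^esub> r"
      unfolding dec r(2) using F rS theta_in_SymSL[OF h] by (simp add: S.m_assoc)
    moreover have "fperm \<alpha> \<otimes>\<^bsub>SymSL\<^esub> theta q h \<in> Lam"
      using subgroup.m_closed[OF subgroup_Lam fperm_subset_Lam[OF ab(2)] theta_subset_Lam[OF h]] .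
    ultimately show "\<sigma> \<in> Lam <#>\<^bsub>SymSL\<^esub> rho_minus"
      using r(1) unfolding set_mult_def by blast
  qed
qed

lemma rho_minus_central:
  assumes f: "f \<in> Lam" and r: "r \<in> rho_minus"
  shows "r \<otimes>\<^bsub>SymSL\<^esub> f = f \<otimes>\<^bsub>SymSL\<^esub> r"
proof -
  obtain h \<alpha> where h: "h \<in> carrier SL2" and \<alpha>: "\<alpha> \<in> field_auts" and f': "f = theta q h \<otimes>\<^bsub>SymSL\<^esub> fperm \<alpha>"
    using f by (auto simp: Lam_iff)
  note cl = theta_in_SymSL[OF h] fperm_in_SymSL[OF \<alpha>] neg_in_SymSL
  have "neg \<otimes>\<^bsub>SymSL\<^esub> f = theta q h \<otimes>\<^bsub>SymSL\<^esub> (neg \<otimes>\<^bsub>SymSL\<^esub> fperm \<alpha>)"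
    unfolding f' using cl neg_theta[OF h] by (simp flip: S.m_assoc)
  also have "\<dots> = f \<otimes>\<^bsub>SymSL\<^esub> neg"
    unfolding f' neg_fperm[OF \<alpha>] using cl by (simp add: S.m_assoc)
  finally show ?thesis
    using r cl unfolding rho_minus_eq by (auto simp: f')
qed

lemma internal_semidirect_Lam: "internal_semidirect SymSL Lam (Theta q) field_perms"
  unfolding internal_semidirect_def
proof (intro conjI)
  have sub: "Theta q \<subseteq> Lam" "field_perms \<subseteq> Lam"
    by (auto simp: Theta_eq field_perms_eq theta_subset_Lam fperm_subset_Lam)
  show "Theta q \<lhd> SymSL\<lparr>carrier := Lam\<rparr>"
  proof (rule S.normal_in_subgroup[OF subgroup_Lam subgroup_Theta sub(1)])
    fix f t :: "'a ^ 2 ^ 2 \<Rightarrow> 'a ^ 2 ^ 2" assume "f \<in> Lam" and "t \<in> Theta q"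
    obtain h \<alpha> where h: "h \<in> carrier SL2" and \<alpha>: "\<alpha> \<in> field_auts" and f: "f = theta q h \<otimes>\<^bsub>SymSL\<^esub> fperm \<alpha>"
      using \<open>f \<in> Lam\<close> by (auto simp: Lam_iff)
    obtain k where k: "k \<in> carrier SL2" "t = theta q k"
      using \<open>t \<in> Theta q\<close> by (auto simp: Theta_eq)
    define k' where "k' = map_matrix (inv_into UNIV \<alpha>) k"
    note i = field_auts_inv[OF \<alpha>]
    have k': "k' \<in> carrier SL2"
      using k(1) i(1) by (simp add: k'_def map_matrix_in_SL2)
    note cl = theta_in_SymSL[OF h] fperm_in_SymSL[OF \<alpha>] theta_in_SymSL[OF k(1)] theta_in_SymSL[OF k']
    have "fperm \<alpha> \<otimes>\<^bsub>SymSL\<^esub> theta q k = theta q k' \<otimes>\<^bsub>SymSL\<^esub> fperm \<alpha>"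
      using fperm_theta[OF \<alpha> k'] by (simp add: k'_def map_matrix_comp i)
    hence "f \<otimes>\<^bsub>SymSL\<^esub> t = theta q h \<otimes>\<^bsub>SymSL\<^esub> theta q k' \<otimes>\<^bsub>SymSL\<^esub> fperm \<alpha>"
      unfolding f k(2) using cl by (simp add: S.m_assoc)
    \<comment> \<open>Inserting \<open>theta q h\<close> and its inverse turns the trailing
      \<open>fperm \<alpha>\<close> back into \<open>f\<close>, so the conjugate of \<open>t\<close>
      is a product of elements of \<open>Theta q\<close>.\<close>
    also have "\<dots> = theta q h \<otimes>\<^bsub>SymSL\<^esub> theta q k' \<otimes>\<^bsub>SymSL\<^esub> inv\<^bsub>SymSL\<^esub> (theta q h) \<otimes>\<^bsub>SymSL\<^esub> f"
    proof -
      have "inv\<^bsub>SymSL\<^esub> (theta q h) \<otimes>\<^bsub>SymSL\<^esub> f = fperm \<alpha>"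
        unfolding f using cl by (simp flip: S.m_assoc)
      thus ?thesis
        using cl f by (simp add: S.m_assoc)
    qed
    finally have "f \<otimes>\<^bsub>SymSL\<^esub> t \<otimes>\<^bsub>SymSL\<^esub> inv\<^bsub>SymSL\<^esub> f = theta q h \<otimes>\<^bsub>SymSL\<^esub> theta q k' \<otimes>\<^bsub>SymSL\<^esub> inv\<^bsub>SymSL\<^esub> (theta q h)"
      using cl f by (simp add: S.m_assoc)
    thus "f \<otimes>\<^bsub>SymSL\<^esub> t \<otimes>\<^bsub>SymSL\<^esub> inv\<^bsub>SymSL\<^esub> f \<in> Theta q"
      using h k' by (simp add: theta_inv theta_mult mult_in_SL2 adj2_inverse Theta_eq)
  qed
  show "subgroup field_perms (SymSL\<lparr>carrier := Lam\<rparr>)"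
    by (rule S.subgroup_incl[OF subgroup_field_perms subgroup_Lam sub(2)])
qed (simp_all add: subgroup_Lam Theta_field_perms_disjoint Lam_def[symmetric])

lemma internal_direct_Gam: "internal_direct SymSL (Gam q) Lam rho_minus"
  unfolding internal_direct_def
proof (intro conjI)
  note one = subgroup.one_closed[OF subgroup_rho_minus] subgroup.one_closed[OF subgroup_Lam]
  have cl: "x \<in> Lam \<Longrightarrow> x \<in> carrier SymSL" "y \<in> rho_minus \<Longrightarrow> y \<in> carrier SymSL"
    for x y :: "'a ^ 2 ^ 2 \<Rightarrow> 'a ^ 2 ^ 2"
    using subgroup.mem_carrier[OF subgroup_rho_minus] subgroup.mem_carrier[OF subgroup_Lam] by auto
  have sub: "Lam \<subseteq> Gam q" "rho_minus \<subseteq> (Gam q :: ('a ^ 2 ^ 2 \<Rightarrow> 'a ^ 2 ^ 2) set)"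
    unfolding Gam_eq set_mult_def using one cl by force+
  show "Lam \<lhd> SymSL\<lparr>carrier := Gam q\<rparr>"
  proof (rule S.normal_in_subgroup[OF subgroup_Gam subgroup_Lam sub(1)])
    fix g n :: "'a ^ 2 ^ 2 \<Rightarrow> 'a ^ 2 ^ 2" assume "g \<in> Gam q" and n: "n \<in> Lam"
    then obtain f r where g: "f \<in> Lam" "r \<in> rho_minus" "g = f \<otimes>\<^bsub>SymSL\<^esub> r"
      unfolding Gam_eq set_mult_def by blast
    have "g \<otimes>\<^bsub>SymSL\<^esub> n = f \<otimes>\<^bsub>SymSL\<^esub> n \<otimes>\<^bsub>SymSL\<^esub> r"
      unfolding g(3) using cl g n rho_minus_central[OF n g(2)] by (simp add: S.m_assoc)
    also have "r = inv\<^bsub>SymSL\<^esub> f \<otimes>\<^bsub>SymSL\<^esub> g"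
      unfolding g(3) using cl g by (simp flip: S.m_assoc)
    finally have "g \<otimes>\<^bsub>SymSL\<^esub> n \<otimes>\<^bsub>SymSL\<^esub> inv\<^bsub>SymSL\<^esub> g = f \<otimes>\<^bsub>SymSL\<^esub> n \<otimes>\<^bsub>SymSL\<^esub> inv\<^bsub>SymSL\<^esub> f"
      using cl g n by (simp add: S.m_assoc)
    thus "g \<otimes>\<^bsub>SymSL\<^esub> n \<otimes>\<^bsub>SymSL\<^esub> inv\<^bsub>SymSL\<^esub> g \<in> Lam"
      using subgroup.m_closed[OF subgroup_Lam] subgroup.m_inv_closed[OF subgroup_Lam] g n by simp
  qed
  show "rho_minus \<lhd> SymSL\<lparr>carrier := Gam q :: ('a ^ 2 ^ 2 \<Rightarrow> 'a ^ 2 ^ 2) set\<rparr>"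
  proof (rule S.normal_in_subgroup[OF subgroup_Gam subgroup_rho_minus sub(2)])
    fix g s :: "'a ^ 2 ^ 2 \<Rightarrow> 'a ^ 2 ^ 2" assume "g \<in> Gam q" and s: "s \<in> rho_minus"
    then obtain f r where g: "f \<in> Lam" "r \<in> rho_minus" "g = f \<otimes>\<^bsub>SymSL\<^esub> r"
      unfolding Gam_eq set_mult_def by blast
    have rs: "r \<otimes>\<^bsub>SymSL\<^esub> s = s \<otimes>\<^bsub>SymSL\<^esub> r"
      using g(2) s neg_in_SymSL by (auto simp: rho_minus_eq)
    have "g \<otimes>\<^bsub>SymSL\<^esub> s = f \<otimes>\<^bsub>SymSL\<^esub> s \<otimes>\<^bsub>SymSL\<^esub> r"
      unfolding g(3) using cl g s rs by (simp add: S.m_assoc)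
    also have "\<dots> = s \<otimes>\<^bsub>SymSL\<^esub> g"
      unfolding g(3) rho_minus_central[OF g(1) s, symmetric] using cl g s by (simp add: S.m_assoc)
    finally show "g \<otimes>\<^bsub>SymSL\<^esub> s \<otimes>\<^bsub>SymSL\<^esub> inv\<^bsub>SymSL\<^esub> g \<in> rho_minus"
      using cl g s by (simp add: S.m_assoc)
  qed
qed (simp_all add: subgroup_Gam Lam_rho_minus_disjoint flip: Gam_eq)

text \<open>Permutations compose left to right, so that \<open>\<alpha>\<close> has to be sent to the permutation induced
  by its inverse.\<close>

definition Psi :: "(('a ^ 2 ^ 2) set \<times> ('a \<Rightarrow> 'a)) \<times> ('a ^ 2 ^ 2 \<Rightarrow> 'a ^ 2 ^ 2) \<Rightarrow> ('a ^ 2 ^ 2 \<Rightarrow> 'a ^ 2 ^ 2)" where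
  "Psi = (\<lambda>((X, \<alpha>), r). theta q (SOME h. h \<in> X) \<otimes>\<^bsub>SymSL\<^esub> fperm (inv_into UNIV \<alpha>) \<otimes>\<^bsub>SymSL\<^esub> r)"

abbreviation PSr :: "((('a ^ 2 ^ 2) set \<times> ('a \<Rightarrow> 'a)) \<times> ('a ^ 2 ^ 2 \<Rightarrow> 'a ^ 2 ^ 2)) monoid" where
  "PSr \<equiv> PSigmaL2 \<times>\<times> SymSL\<lparr>carrier := rho_minus\<rparr>"

text \<open>The choice of a representative is harmless, because \<open>theta q\<close> takes the
  same value at h and at \<open>- h\<close>.\<close>

lemma Psi_apply:
  assumes h: "h \<in> carrier SL2"
  shows "Psi (({h, - h}, \<alpha>), r) = theta q h \<otimes>\<^bsub>SymSL\<^esub> fperm (inv_into UNIV \<alpha>) \<otimes>\<^bsub>SymSL\<^esub> r"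
proof -
  have "(SOME k. k \<in> {h, - h}) \<in> {h, - h}"
    by (rule someI[of _ h]) simp
  hence "theta q (SOME k. k \<in> {h, - h}) = theta q h"
    using theta_uminus[OF h] by (auto simp del: insert_iff)
  thus ?thesis
    by (simp add: Psi_def)
qed

lemma PSr_carrier: "carrier PSr = {(({h, - h}, \<alpha>), r) | h \<alpha> r. h \<in> carrier SL2 \<and> \<alpha> \<in> field_auts \<and> r \<in> rho_minus}"
  by (auto simp: DirProd_def PSigmaL2_def semidirect_def carrier_PSL2 AutF_def)

lemma PSr_mult:
  assumes "\<alpha> \<in> field_auts"
  shows "(({h, - h}, \<alpha>), r) \<otimes>\<^bsub>PSr\<^esub> (({k, - k}, \<beta>), s) =
    (({h ** map_matrix \<alpha> k, - (h ** map_matrix \<alpha> k)}, \<alpha> \<circ> \<beta>), r \<otimes>\<^bsub>SymSL\<^esub> s)"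
proof -
  have "map_matrix \<alpha> ` {k, - k} = {map_matrix \<alpha> k, - map_matrix \<alpha> k}"
    by (simp add: map_matrix_uminus[OF assms])
  thus ?thesis
    using mult_PSL2[of h "map_matrix \<alpha> k"] by (simp add: DirProd_def PSigmaL2_def semidirect_def AutF_def)
qed

text \<open>Injectivity is uniqueness of the factorization, used for the direct product and then for
  the semidirect one. What remains is that h is determined up to sign, hence as an element of
  \<open>PSL2\<close>.\<close>

lemma Psi_bij: "bij_betw Psi (carrier PSr) (Gam q)"
  unfolding bij_betw_def
proof
  show "inj_on Psi (carrier PSr)"
  proof (rule inj_onI)
    fix u v assume u: "u \<in> carrier PSr" and v: "v \<in> carrier PSr" and eq: "Psi u = Psi v"
    obtain h \<alpha> r where u': "u = (({h, - h}, \<alpha>), r)" "h \<in> carrier SL2" "\<alpha> \<in> field_auts" "r \<in> rho_minus"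
      using u unfolding PSr_carrier by blast
    obtain k \<beta> s where v': "v = (({k, - k}, \<beta>), s)" "k \<in> carrier SL2" "\<beta> \<in> field_auts" "s \<in> rho_minus"
      using v unfolding PSr_carrier by blast
    note ia = field_auts_inv[OF u'(3)] and ib = field_auts_inv[OF v'(3)]
    have L: "theta q h \<otimes>\<^bsub>SymSL\<^esub> fperm (inv_into UNIV \<alpha>) \<in> Lam" "theta q k \<otimes>\<^bsub>SymSL\<^esub> fperm (inv_into UNIV \<beta>) \<in> Lam"
      unfolding Lam_iff using u'(2) v'(2) ia(1) ib(1) by blast+
    note e = eq[unfolded u'(1) v'(1) Psi_apply[OF u'(2)] Psi_apply[OF v'(2)]]
    note p1 = S.product_unique[OF subgroup_Lam subgroup_rho_minus Lam_rho_minus_disjoint L u'(4) v'(4) e]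
    have "theta q h \<in> Theta q" "theta q k \<in> Theta q"
      "fperm (inv_into UNIV \<alpha>) \<in> field_perms" "fperm (inv_into UNIV \<beta>) \<in> field_perms"
      using u'(2) v'(2) ia(1) ib(1) by (auto simp: Theta_eq field_perms_eq)
    note p2 = S.product_unique[OF subgroup_Theta subgroup_field_perms Theta_field_perms_disjoint this p1(1)]
    have "inv_into UNIV \<alpha> = inv_into UNIV \<beta>"
      by (rule fperm_inj[OF p2(2)])
    hence "\<alpha> = \<beta>"
      using ia ib by (metis comp_assoc comp_id id_comp)
    moreover have "{h, - h} = {k, - k}"
      using theta_eq_iff[OF u'(2) v'(2) p2(1)] by auto
    ultimately show "u = v"
      using p1(2) u'(1) v'(1) by simp
  qed
  show "Psi ` carrier PSr = Gam q"
  proof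
    have "Psi (({h, - h}, \<alpha>), r) \<in> Gam q" if "h \<in> carrier SL2" "\<alpha> \<in> field_auts" "r \<in> rho_minus" for h \<alpha> r
      unfolding Psi_apply[OF that(1)] Gam_eq set_mult_def using that field_auts_inv(1)[OF that(2)] Lam_iff by blast
    thus "Psi ` carrier PSr \<subseteq> Gam q"
      unfolding PSr_carrier by blast
    show "Gam q \<subseteq> Psi ` carrier PSr"
    proof
      fix g :: "'a ^ 2 ^ 2 \<Rightarrow> 'a ^ 2 ^ 2" assume "g \<in> Gam q"
      then obtain f r where f: "f \<in> Lam" "r \<in> rho_minus" "g = f \<otimes>\<^bsub>SymSL\<^esub> r"
        unfolding Gam_eq set_mult_def by blast
      then obtain h \<alpha> where g: "h \<in> carrier SL2" "\<alpha> \<in> field_auts" "r \<in> rho_minus"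
          "g = theta q h \<otimes>\<^bsub>SymSL\<^esub> fperm \<alpha> \<otimes>\<^bsub>SymSL\<^esub> r"
        unfolding Lam_iff by blast
      have "inv_into UNIV (inv_into UNIV \<alpha>) = \<alpha>"
        using g(2) by (simp add: field_auts_def inv_inv_eq)
      hence "g = Psi (({h, - h}, inv_into UNIV \<alpha>), r)"
        using g by (simp add: Psi_apply)
      thus "g \<in> Psi ` carrier PSr"
        using g field_auts_inv(1)[OF g(2)] unfolding PSr_carrier by blast
    qed
  qed
qed

text \<open>Passing the permutation of the inverse of \<alpha> over \<open>theta q k\<close> turns
  \<open>k\<close> into \<open>map_matrix \<alpha> k\<close>, which is the action in
  \<open>PSigmaL2\<close>; the factor \<open>r\<close> moves freely because it is central.\<close>

lemma Psi_mult:
  assumes u: "u \<in> carrier PSr" and v: "v \<in> carrier PSr"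
  shows "Psi (u \<otimes>\<^bsub>PSr\<^esub> v) = Psi u \<otimes>\<^bsub>SymSL\<^esub> Psi v" "u \<otimes>\<^bsub>PSr\<^esub> v \<in> carrier PSr"
proof -
  obtain h \<alpha> r where u': "u = (({h, - h}, \<alpha>), r)" "h \<in> carrier SL2" "\<alpha> \<in> field_auts" "r \<in> rho_minus"
    using u unfolding PSr_carrier by blast
  obtain k \<beta> s where v': "v = (({k, - k}, \<beta>), s)" "k \<in> carrier SL2" "\<beta> \<in> field_auts" "s \<in> rho_minus"
    using v unfolding PSr_carrier by blast
  note ia = field_auts_inv[OF u'(3)] and ib = field_auts_inv[OF v'(3)]
  have hk: "h ** map_matrix \<alpha> k \<in> carrier SL2"
    using u' v' by (simp add: mult_in_SL2 map_matrix_in_SL2)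
  have rs: "r \<otimes>\<^bsub>SymSL\<^esub> s \<in> rho_minus"
    by (rule subgroup.m_closed[OF subgroup_rho_minus u'(4) v'(4)])
  have uv: "u \<otimes>\<^bsub>PSr\<^esub> v = (({h ** map_matrix \<alpha> k, - (h ** map_matrix \<alpha> k)}, \<alpha> \<circ> \<beta>), r \<otimes>\<^bsub>SymSL\<^esub> s)"
    unfolding u'(1) v'(1) by (rule PSr_mult[OF u'(3)])
  show "u \<otimes>\<^bsub>PSr\<^esub> v \<in> carrier PSr"
    unfolding uv PSr_carrier using hk rs field_auts_comp[OF u'(3) v'(3)] by blast
  define f g where "f = theta q h \<otimes>\<^bsub>SymSL\<^esub> fperm (inv_into UNIV \<alpha>)"
    and "g = theta q k \<otimes>\<^bsub>SymSL\<^esub> fperm (inv_into UNIV \<beta>)"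
  have fg: "f \<in> Lam" "g \<in> Lam"
    unfolding Lam_iff f_def g_def using u'(2) v'(2) ia(1) ib(1) by blast+
  note cl = subgroup.mem_carrier[OF subgroup_Lam fg(1)] subgroup.mem_carrier[OF subgroup_Lam fg(2)]
    subgroup.mem_carrier[OF subgroup_rho_minus u'(4)] subgroup.mem_carrier[OF subgroup_rho_minus v'(4)]
  have inv_comp: "inv_into UNIV (\<alpha> \<circ> \<beta>) = inv_into UNIV \<beta> \<circ> inv_into UNIV \<alpha>"
    using u'(3) v'(3) by (simp add: field_auts_def o_inv_distrib)
  have inv_inv: "inv_into UNIV (inv_into UNIV \<alpha>) = \<alpha>"
    using u'(3) by (simp add: field_auts_def inv_inv_eq)
  have "f \<otimes>\<^bsub>SymSL\<^esub> g = theta q (h ** map_matrix \<alpha> k) \<otimes>\<^bsub>SymSL\<^esub> fperm (inv_into UNIV (\<alpha> \<circ> \<beta>))"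
    unfolding f_def g_def theta_fperm_mult[OF u'(2) v'(2) ia(1) ib(1)] inv_comp inv_inv ..
  hence "Psi (u \<otimes>\<^bsub>PSr\<^esub> v) = f \<otimes>\<^bsub>SymSL\<^esub> g \<otimes>\<^bsub>SymSL\<^esub> (r \<otimes>\<^bsub>SymSL\<^esub> s)"
    unfolding uv Psi_apply[OF hk] by simp
  also have "\<dots> = f \<otimes>\<^bsub>SymSL\<^esub> (r \<otimes>\<^bsub>SymSL\<^esub> g) \<otimes>\<^bsub>SymSL\<^esub> s"
    unfolding rho_minus_central[OF fg(2) u'(4)] using cl by (simp add: S.m_assoc)
  also have "\<dots> = Psi u \<otimes>\<^bsub>SymSL\<^esub> Psi v"
    unfolding u'(1) v'(1) Psi_apply[OF u'(2)] Psi_apply[OF v'(2)] f_def[symmetric] g_def[symmetric]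
    using cl by (simp add: S.m_assoc)
  finally show "Psi (u \<otimes>\<^bsub>PSr\<^esub> v) = Psi u \<otimes>\<^bsub>SymSL\<^esub> Psi v" .
qed

lemma Gam_iso: "SymSL\<lparr>carrier := Gam q :: ('a ^ 2 ^ 2 \<Rightarrow> 'a ^ 2 ^ 2) set\<rparr> \<cong> PSr"
  by (rule is_iso_of_inverse[of Psi]) (use Psi_bij Psi_mult in auto)

text \<open>\<open>rho_minus\<close> and the centre of \<open>SL2\<close> have equally many
  elements, two or one according to whether -1 differs from 1. Hence |PSL2| * |rho_minus| = |SL2| by
  Lagrange in every characteristic; the factor 2 e counts the field automorphisms.\<close>

lemma card_Gam: "card (Gam q :: ('a ^ 2 ^ 2 \<Rightarrow> 'a ^ 2 ^ 2) set) = 2 * e * (q\<^sup>2 - 1) * q\<^sup>2 * (q\<^sup>2 + 1)"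
proof -
  let ?Z = "group_centre SL2 :: ('a ^ 2 ^ 2) set"
  have "carrier PSr = (carrier PSL2 \<times> field_auts) \<times> rho_minus"
    by (simp add: DirProd_def PSigmaL2_def semidirect_def AutF_def)
  hence "card (Gam q :: ('a ^ 2 ^ 2 \<Rightarrow> 'a ^ 2 ^ 2) set) =
      card (carrier (PSL2 :: ('a ^ 2 ^ 2) set monoid)) * (2 * e) * card (rho_minus :: ('a ^ 2 ^ 2 \<Rightarrow> 'a ^ 2 ^ 2) set)"
    using bij_betw_same_card[OF Psi_bij] by (simp add: card_cartesian_product card_field_auts[OF prime card_p])
  moreover have "card (rho_minus :: ('a ^ 2 ^ 2 \<Rightarrow> 'a ^ 2 ^ 2) set) = card ?Z"
  proof -
    have "neg = \<one>\<^bsub>SymSL\<^esub> \<longleftrightarrow> - mat 1 = (mat 1 :: 'a ^ 2 ^ 2)"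
    proof
      assume "neg = \<one>\<^bsub>SymSL\<^esub>"
      hence "neg (mat 1) = \<one>\<^bsub>SymSL\<^esub> (mat 1)"
        by simp
      thus "- mat 1 = (mat 1 :: 'a ^ 2 ^ 2)"
        by (simp add: rho_def one_SymSL)
    qed (simp only: rho_lin one_SymSL_lin)
    thus ?thesis
      by (auto simp: rho_minus_eq centre_SL2 card_insert_if)
  qed
  moreover have "card (carrier (PSL2 :: ('a ^ 2 ^ 2) set monoid)) * card ?Z = card (carrier (SL2 :: ('a ^ 2 ^ 2) monoid))"
  proof -
    interpret SL: group "SL2 :: ('a ^ 2 ^ 2) monoid"
      by (rule group_SL2)
    have "subgroup ?Z SL2"
      unfolding centre_SL2 by (rule SL.subgroupI) (auto simp: inv_SL2 mult2_uminus adj2_uminus)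
    from SL.lagrange[OF this] show ?thesis
      by (simp add: Coset.order_def PSL2_def FactGroup_def)
  qed
  ultimately have "card (Gam q :: ('a ^ 2 ^ 2 \<Rightarrow> 'a ^ 2 ^ 2) set) = 2 * e * ((q\<^sup>2 - 1) * q\<^sup>2 * (q\<^sup>2 + 1))"
    unfolding card_SL2 card by (metis mult.commute mult.left_commute)
  thus ?thesis
    by (simp only: mult.assoc)
qed

end

theorem mainTheorem7:
  fixes p e q :: nat
  assumes "prime p" and "e \<ge> 1" and "q = p ^ e"
    and "CARD('a::{field, finite}) = q ^ 2"
  shows
    "(let \<Gamma> = (Gam q :: ('a ^ 2 ^ 2 \<Rightarrow> 'a ^ 2 ^ 2) set);
          \<Lambda> = Theta q <#>\<^bsub>SymSL\<^esub> field_perms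
      in internal_semidirect SymSL \<Lambda> (Theta q) field_perms \<and>
         internal_direct SymSL \<Gamma> \<Lambda> rho_minus \<and>
         SymSL\<lparr>carrier := \<Gamma>\<rparr> \<cong>
           (PSigmaL2 :: (('a ^ 2 ^ 2) set \<times> ('a \<Rightarrow> 'a)) monoid) \<times>\<times>
           (SymSL\<lparr>carrier := rho_minus\<rparr> :: ('a ^ 2 ^ 2 \<Rightarrow> 'a ^ 2 ^ 2) monoid)) \<and>
     card (Gam q :: ('a ^ 2 ^ 2 \<Rightarrow> 'a ^ 2 ^ 2) set)
       = 2 * e * (q\<^sup>2 - 1) * q\<^sup>2 * (q\<^sup>2 + 1)"
proof -
  interpret square_field p e q "TYPE('a)"
    by unfold_locales (use assms in auto)
  show ?thesis
    using internal_semidirect_Lam internal_direct_Gam Gam_iso card_Gam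
    unfolding Let_def Lam_def by blast
qed

end
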